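(* Let $(X,\mathscr{B},\mu)$ be a probability space and let $T,S:X\to X$ be measure preserving automorphisms. Let $(k_n)_{n=1}^\infty\subseteq\mathbb{N}$ be a sequence for which $((k_{n+h}-k_n)\alpha)_{n=1}^\infty$ is uniformly distributed in the orbit closure of $\alpha$ for all $\alpha\in\mathbb{R}$ and $h\in\mathbb{N}$. (i) For any $f,g\in L^\infty(X,\mu)$ with $\mu_{f,T}\perp\mathcal{L}$, $$\lim_{N\to\infty}\frac1N\sum_{n=1}^N T^nf\cdot S^{k_n}g=\mathbb{E}[f|\mathcal{I}_T]\,\mathbb{E}[g|\mathcal{I}_S],$$ with convergence taking place in $L^2(X,\mu)$. (ii) If $A\in\mathscr{B}$ satisfies $\mu_{\mathbf{1}_A,T}\perp\mathcal{L}$, then $$\lim_{N\to\infty}\frac1N\sum_{n=1}^N\mu\left(A\cap T^{-n}A\cap S^{-k_n}A\right)\ge\mu(A)^3.$$ (iii) If we only assume that $((k_{n+h}-k_n)\alpha)_{n=1}^\infty$ is uniformly distributed for all $\alpha\in\mathbb{R}\setminus\mathbb{Q}$ and $h\in\mathbb{N}$, then (i) holds when we further assume that $\mathbb{E}[g|\mathcal{K}_{\mathrm{rat}}(S)]=\mathbb{E}[g|\mathcal{I}_S]$, and (ii) holds when we further assume that $\mathbb{E}[\mathbf{1}_A|\mathcal{K}_{\mathrm{rat}}(S)]=\mathbb{E}[\mathbf{1}_A|\mathcal{I}_S]$.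
   Context: $\mathbb{N}=\{1,2,\dots\}$. A measure preserving automorphism $R$ of $(X,\mathscr{B},\mu)$ is an invertible bi-measurable map with $\mu(R^{-1}A)=\mu(A)=\mu(RA)$ for all $A\in\mathscr{B}$; it acts on functions by $Rf=f\circ R$. $\mathcal{I}_R$ is the $\sigma$-algebra of $R$-invariant sets; $\mathcal{K}_{\mathrm{rat}}(R)$ is the sub-$\sigma$-algebra generated by the rational eigenfunctions of $R$ (those $\phi\in L^2(X,\mu)$ with $R\phi=e^{2\pi ir}\phi$ for some $r\in\mathbb{Q}$). $\mathbb{E}[\cdot|\mathscr{A}]$ is the orthogonal projection of $L^2(X,\mathscr{B},\mu)$ onto $L^2(X,\mathscr{A},\mu)$. For $f\in L^2(X,\mu)$, the spectral measure $\mu_{f,R}$ is the positive measure on $[0,1]$ with $\widehat{\mu_{f,R}}(n)=\langle R^nf,f\rangle$ (Fourier coefficients). $\mathcal{L}$ is Lebesgue measure on $[0,1]$. Quantities such as $(k_{n+h}-k_n)\alpha$ and $n\alpha$ are reduced modulo $1$. The orbit closure of $\alpha$ is $\overline{\{n\alpha\mid n\in\mathbb{N}\}}$, with closure taken in $\mathbb{R}/\mathbb{Z}$; it is a closed subgroup, and uniform distribution in it is with respect to its Haar probability measure. "Uniformly distributed" without further specification means uniformly distributed modulo $1$ with respect to Lebesgue measure. *)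

theory Defs
  imports "HOL-Probability.Probability"
begin

section \<open>Measure preserving automorphisms\<close>

definition mp_automorphism :: "'a measure \<Rightarrow> ('a \<Rightarrow> 'a) \<Rightarrow> bool" where
  "mp_automorphism M R \<longleftrightarrow>
     bij_betw R (space M) (space M) \<and>
     R \<in> measurable M M \<and>
     the_inv_into (space M) R \<in> measurable M M \<and>
     (\<forall>A\<in>sets M. emeasure M (R -` A \<inter> space M) = emeasure M A \<and>
                  emeasure M (R ` A) = emeasure M A)"

definition int_iterate :: "'a measure \<Rightarrow> ('a \<Rightarrow> 'a) \<Rightarrow> int \<Rightarrow> 'a \<Rightarrow> 'a" where
  "int_iterate M R n =
     (if 0 \<le> n then R ^^ nat n else the_inv_into (space M) R ^^ nat (- n))"


section \<open>Function spaces\<close>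

text \<open>Elements of the Lebesgue spaces are represented by complex-valued functions; equality in
  these spaces is equality almost everywhere.\<close>

definition L2 :: "'a measure \<Rightarrow> ('a \<Rightarrow> complex) set" where
  "L2 M = {f \<in> borel_measurable M. integrable M (\<lambda>x. (cmod (f x))\<^sup>2)}"

definition Linfty :: "'a measure \<Rightarrow> ('a \<Rightarrow> complex) set" where
  "Linfty M = {f \<in> borel_measurable M. \<exists>C. AE x in M. cmod (f x) \<le> C}"

definition L2_inner :: "'a measure \<Rightarrow> ('a \<Rightarrow> complex) \<Rightarrow> ('a \<Rightarrow> complex) \<Rightarrow> complex" where
  "L2_inner M f g = (\<integral>x. f x * cnj (g x) \<partial>M)"

definition L2_converges ::
    "'a measure \<Rightarrow> (nat \<Rightarrow> 'a \<Rightarrow> complex) \<Rightarrow> ('a \<Rightarrow> complex) \<Rightarrow> bool" where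
  "L2_converges M F g \<longleftrightarrow>
     (\<forall>N. F N \<in> L2 M) \<and> g \<in> L2 M \<and>
     (\<lambda>N. \<integral>\<^sup>+x. ennreal ((cmod (F N x - g x))\<^sup>2) \<partial>M) \<longlonglongrightarrow> 0"


section \<open>Sub-sigma-algebras and conditional expectation\<close>

text \<open>As in \<open>HOL-Probability.Conditional_Expectation\<close>, a sub-sigma-algebra is given as a measure of
  which only the space and the measurable sets matter.\<close>

definition invariant_algebra :: "'a measure \<Rightarrow> ('a \<Rightarrow> 'a) \<Rightarrow> 'a measure" where
  "invariant_algebra M R = sigma (space M) {A \<in> sets M. R -` A \<inter> space M = A}"

definition rational_eigenfunctions :: "'a measure \<Rightarrow> ('a \<Rightarrow> 'a) \<Rightarrow> ('a \<Rightarrow> complex) set" where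
  "rational_eigenfunctions M R =
     {\<phi> \<in> L2 M. \<exists>r\<in>\<rat>. AE x in M. \<phi> (R x) = cis (2 * pi * r) * \<phi> x}"

text \<open>Every representative of an eigenfunction is taken as a generator, so that this sigma-algebra
  contains all null sets of \<open>M\<close>.\<close>

definition K_rat :: "'a measure \<Rightarrow> ('a \<Rightarrow> 'a) \<Rightarrow> 'a measure" where
  "K_rat M R =
     sigma (space M) (\<Union>\<phi>\<in>rational_eigenfunctions M R. {\<phi> -` B \<inter> space M | B. B \<in> sets borel})"

definition complex_cond_exp ::
    "'a measure \<Rightarrow> 'a measure \<Rightarrow> ('a \<Rightarrow> complex) \<Rightarrow> 'a \<Rightarrow> complex" where
  "complex_cond_exp M F f x =
     Complex (real_cond_exp M F (\<lambda>y. Re (f y)) x) (real_cond_exp M F (\<lambda>y. Im (f y)) x)"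

lemma sets_invariant_algebra:
  assumes "R \<in> measurable M M"
  shows "sets (invariant_algebra M R) = {A \<in> sets M. R -` A \<inter> space M = A}"
proof -
  let ?I = "{A \<in> sets M. R -` A \<inter> space M = A}"
  have "sigma_algebra (space M) ?I"
    unfolding sigma_algebra_iff2
  proof (intro conjI ballI allI impI)
    show "?I \<subseteq> Pow (space M)"
      using sets.sets_into_space by auto
    show "{} \<in> ?I"
      by simp
    show "space M - A \<in> ?I" if "A \<in> ?I" for A
      using that measurable_space[OF assms] by auto
    show "(\<Union>i. A i) \<in> ?I" if "range A \<subseteq> ?I" for A :: "nat \<Rightarrow> 'a set"
    proof -
      have A: "A i \<in> sets M" "R -` A i \<inter> space M = A i" for i
        using that by auto
      have "R -` (\<Union>i. A i) \<inter> space M = (\<Union>i. R -` A i \<inter> space M)"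
        by auto
      then show ?thesis
        using A by simp
    qed
  qed
  then show ?thesis
    unfolding invariant_algebra_def by (rule sigma_algebra.sets_measure_of_eq)
qed

lemma subalgebra_invariant_algebra: "subalgebra M (invariant_algebra M R)"
proof -
  have "{A \<in> sets M. R -` A \<inter> space M = A} \<subseteq> sets M"
    by auto
  then show ?thesis
    unfolding subalgebra_def invariant_algebra_def
    by (metis (no_types, lifting) sets.sets_measure_of_eq sets.sigma_sets_subset sets.space_closed
        sets_measure_of space_measure_of subset_trans)
qed

lemma subalgebra_K_rat: "subalgebra M (K_rat M R)"
proof -
  let ?G = "\<Union>\<phi>\<in>rational_eigenfunctions M R. {\<phi> -` B \<inter> space M | B. B \<in> sets borel}"
  have "?G \<subseteq> sets M"
    by (auto simp: rational_eigenfunctions_def L2_def intro: measurable_sets)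
  then show ?thesis
    unfolding subalgebra_def K_rat_def
    by (metis (no_types, lifting) sets.sets_measure_of_eq sets.sigma_sets_subset sets.space_closed
        sets_measure_of space_measure_of subset_trans)
qed

text \<open>Conditional expectation is the orthogonal projection onto the square integrable functions that
  are measurable with respect to the sub-sigma-algebra.\<close>

lemma L2_iff_Re_Im:
  "f \<in> L2 M \<longleftrightarrow>
     (\<lambda>x. Re (f x)) \<in> borel_measurable M \<and> (\<lambda>x. Im (f x)) \<in> borel_measurable M \<and>
     integrable M (\<lambda>x. (Re (f x))\<^sup>2) \<and> integrable M (\<lambda>x. (Im (f x))\<^sup>2)"
  (is "?L \<longleftrightarrow> ?R")
proof
  assume L: ?L
  then have m: "(\<lambda>x. Re (f x)) \<in> borel_measurable M" "(\<lambda>x. Im (f x)) \<in> borel_measurable M"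
    and i: "integrable M (\<lambda>x. (cmod (f x))\<^sup>2)"
    by (auto simp: L2_def borel_measurable_complex_iff)
  have "integrable M (\<lambda>x. (Re (f x))\<^sup>2)" "integrable M (\<lambda>x. (Im (f x))\<^sup>2)"
    by (rule Bochner_Integration.integrable_bound[OF i]; use m in \<open>simp add: cmod_power2\<close>)+
  with m show ?R
    by simp
next
  assume ?R
  then show ?L
    by (simp add: L2_def borel_measurable_complex_iff cmod_power2)
qed

lemma complex_cond_exp_in_L2:
  assumes "prob_space M" "subalgebra M F" "f \<in> L2 M"
  shows "complex_cond_exp M F f \<in> L2 (restr_to_subalg M F)"
proof -
  interpret prob_space M by fact
  interpret finite_measure_subalgebra M F
    by unfold_locales fact
  note f = assms(3)[unfolded L2_iff_Re_Im]
  have sq: "integrable (restr_to_subalg M F) (\<lambda>x. (real_cond_exp M F g x)\<^sup>2)"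
    if "g \<in> borel_measurable M" "integrable M (\<lambda>x. (g x)\<^sup>2)" for g
  proof (rule integrable_in_subalg[OF assms(2)])
    show "(\<lambda>x. (real_cond_exp M F g x)\<^sup>2) \<in> borel_measurable F"
      by measurable
    show "integrable M (\<lambda>x. (real_cond_exp M F g x)\<^sup>2)"
      by (rule integrable_convex_cond_exp[where I = UNIV])
         (use that square_integrable_imp_integrable[OF that] convex_power2 in \<open>auto\<close>)
  qed
  have "real_cond_exp M F g \<in> borel_measurable (restr_to_subalg M F)" for g
    by (rule measurable_in_subalg[OF assms(2)]) simp
  then show ?thesis
    unfolding L2_iff_Re_Im complex_cond_exp_def using sq f by simp
qed

lemma complex_cond_exp_orthogonal:
  assumes "prob_space M" "subalgebra M F" "f \<in> L2 M" "h \<in> L2 (restr_to_subalg M F)"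
  shows "L2_inner M (\<lambda>x. f x - complex_cond_exp M F f x) h = 0"
proof -
  interpret prob_space M by fact
  interpret finite_measure_subalgebra M F
    by unfold_locales fact
  note f = assms(3)[unfolded L2_iff_Re_Im]
  have hF: "(\<lambda>x. Re (h x)) \<in> borel_measurable F" "(\<lambda>x. Im (h x)) \<in> borel_measurable F"
    using assms(4) measurable_in_subalg'[OF assms(2)] by (auto simp: L2_iff_Re_Im)
  have hM: "integrable M (\<lambda>x. (Re (h x))\<^sup>2)" "integrable M (\<lambda>x. (Im (h x))\<^sup>2)"
    using assms(4) integrable_from_subalg[OF assms(2)] by (auto simp: L2_iff_Re_Im)
  have *: "integrable M (\<lambda>x. u x * g x)" "integrable M (\<lambda>x. u x * real_cond_exp M F g x)"
      "(\<integral>x. u x * real_cond_exp M F g x \<partial>M) = (\<integral>x. u x * g x \<partial>M)"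
    if u: "u \<in> borel_measurable F" "integrable M (\<lambda>x. (u x)\<^sup>2)"
      and g: "g \<in> borel_measurable M" "integrable M (\<lambda>x. (g x)\<^sup>2)" for u g :: "'a \<Rightarrow> real"
  proof -
    have uM: "u \<in> borel_measurable M"
      by (rule measurable_from_subalg[OF assms(2) u(1)])
    show i: "integrable M (\<lambda>x. u x * g x)"
    proof (rule Bochner_Integration.integrable_bound)
      show "integrable M (\<lambda>x. (u x)\<^sup>2 + (g x)\<^sup>2)"
        using u g by simp
      show "(\<lambda>x. u x * g x) \<in> borel_measurable M"
        using uM g by simp
      have "\<bar>u x * g x\<bar> \<le> (u x)\<^sup>2 + (g x)\<^sup>2" for x
        using sum_squares_bound[of "\<bar>u x\<bar>" "\<bar>g x\<bar>"] abs_ge_zero[of "u x * g x"]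
        unfolding abs_mult power2_abs by linarith
      then show "AE x in M. norm (u x * g x) \<le> norm ((u x)\<^sup>2 + (g x)\<^sup>2)"
        by simp
    qed
    show "integrable M (\<lambda>x. u x * real_cond_exp M F g x)"
      "(\<integral>x. u x * real_cond_exp M F g x \<partial>M) = (\<integral>x. u x * g x \<partial>M)"
      using real_cond_exp_intg[OF i u(1) g(1)] by auto
  qed
  let ?E = "real_cond_exp M F"
  let ?a = "\<lambda>x. Re (f x)" and ?b = "\<lambda>x. Im (f x)" and ?u = "\<lambda>x. Re (h x)" and ?v = "\<lambda>x. Im (h x)"
  note facts = *[OF hF(1) hM(1), of ?a] *[OF hF(1) hM(1), of ?b]
    *[OF hF(2) hM(2), of ?a] *[OF hF(2) hM(2), of ?b]
  define P where "P x = ?u x * ?a x - ?u x * ?E ?a x + (?v x * ?b x - ?v x * ?E ?b x)" for x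
  define Q where "Q x = ?u x * ?b x - ?u x * ?E ?b x - (?v x * ?a x - ?v x * ?E ?a x)" for x
  have eq: "(f x - complex_cond_exp M F f x) * cnj (h x) =
      complex_of_real (P x) + \<i> * complex_of_real (Q x)" for x
    by (simp add: complex_eq_iff complex_cond_exp_def P_def Q_def algebra_simps)
  have PQ: "integrable M P" "integrable M Q" "integral\<^sup>L M P = 0" "integral\<^sup>L M Q = 0"
    unfolding P_def Q_def using facts f by simp_all
  have "integrable M (\<lambda>x. complex_of_real (P x))" "integrable M (\<lambda>x. \<i> * complex_of_real (Q x))"
    using PQ by simp_all
  then have "(\<integral>x. complex_of_real (P x) + \<i> * complex_of_real (Q x) \<partial>M) = 0"
    using PQ by (simp only: Bochner_Integration.integral_add integral_mult_right_zero
        integral_complex_of_real) simp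
  then show ?thesis
    unfolding L2_inner_def eq .
qed


section \<open>Spectral measures\<close>

definition mutually_singular :: "'a measure \<Rightarrow> 'a measure \<Rightarrow> bool" where
  "mutually_singular \<mu> \<nu> \<longleftrightarrow>
     sets \<mu> = sets \<nu> \<and> (\<exists>A\<in>sets \<mu>. emeasure \<mu> A = 0 \<and> emeasure \<nu> (space \<nu> - A) = 0)"

definition lebesgue01 :: "real measure" where
  "lebesgue01 = restrict_space lborel {0..1}"

text \<open>The \<open>n\<close>-th Fourier coefficient is taken against \<open>cis (2 * pi * n * x)\<close>, so that an
  eigenfunction \<open>f\<close> of norm one with \<open>f \<circ> R = cis (2 * pi * r) * f\<close>, \<open>0 < r < 1\<close>, has the point mass
  at \<open>r\<close> as spectral measure. With the opposite sign the measure is reflected by \<open>x \<mapsto> 1 - x\<close>, which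
  preserves singularity. As Fourier coefficients do not separate the endpoints of
  the interval, \<open>\<nu>\<close> is determined up to the distribution of the mass of \<open>{0, 1}\<close> between the two
  points; this does not affect singularity either.\<close>

definition is_spectral_measure ::
    "'a measure \<Rightarrow> ('a \<Rightarrow> 'a) \<Rightarrow> ('a \<Rightarrow> complex) \<Rightarrow> real measure \<Rightarrow> bool" where
  "is_spectral_measure M R f \<nu> \<longleftrightarrow>
     finite_measure \<nu> \<and> sets \<nu> = sets (restrict_space borel {0..1}) \<and>
     (\<forall>n::int. (\<integral>x. cis (2 * pi * of_int n * x) \<partial>\<nu>) = L2_inner M (\<lambda>x. f (int_iterate M R n x)) f)"


section \<open>Uniform distribution\<close>

definition uniformly_distributed_mod1 :: "(nat \<Rightarrow> real) \<Rightarrow> bool" where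
  "uniformly_distributed_mod1 x \<longleftrightarrow>
     (\<forall>a b. 0 \<le> a \<and> a < b \<and> b \<le> 1 \<longrightarrow>
        (\<lambda>N. real (card {n \<in> {1..N}. a \<le> frac (x n) \<and> frac (x n) < b}) / real N)
          \<longlonglongrightarrow> b - a)"

text \<open>The group of reals modulo \<open>1\<close> is identified with the unit circle in the complex plane through
  the isomorphism induced by \<open>t \<mapsto> cis (2 * pi * t)\<close>.\<close>

definition circle_of :: "real \<Rightarrow> complex" where
  "circle_of t = cis (2 * pi * t)"

definition orbit_closure :: "real \<Rightarrow> complex set" where
  "orbit_closure \<alpha> = closure ((\<lambda>n::nat. circle_of (real n * \<alpha>)) ` {1..})"

definition is_haar_prob :: "complex set \<Rightarrow> complex measure \<Rightarrow> bool" where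
  "is_haar_prob H m \<longleftrightarrow>
     prob_space m \<and> sets m = sets (restrict_space borel H) \<and>
     (\<forall>z\<in>H. distr m m (\<lambda>w. z * w) = m)"

definition uniformly_distributed_in :: "complex set \<Rightarrow> (nat \<Rightarrow> real) \<Rightarrow> bool" where
  "uniformly_distributed_in H x \<longleftrightarrow>
     (\<forall>n\<ge>1. circle_of (x n) \<in> H) \<and>
     (\<exists>m. is_haar_prob H m \<and>
        (\<forall>\<phi> :: complex \<Rightarrow> complex. continuous_on H \<phi> \<longrightarrow>
           (\<lambda>N. (\<Sum>n=1..N. \<phi> (circle_of (x n))) / of_nat N) \<longlonglongrightarrow> (\<integral>w. \<phi> w \<partial>m)))"

end

theory Submission
  imports Defs "HOL-Computational_Algebra.Polynomial" "HOL-Real_Asymp.Real_Asymp"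
begin

text \<open>
  The theorem rests on the opposition of two kinds of sequences. Write \<open>e(t)\<close> for \<open>e\<^sup>2\<^sup>\<pi>\<^sup>i\<^sup>t\<close>
  (\<^const>\<open>circle_of\<close>). If the spectral measure \<open>\<nu>\<close> of \<open>f\<close> is singular, some trigonometric polynomial is
  close to \<open>1\<close> in \<open>L\<^sup>2(\<nu>)\<close> and small in \<open>L\<^sup>2\<close> of Lebesgue measure (\<open>singular_trig_approx\<close>). Through the
  spectral isometry, a shifted term \<open>T\<^sup>n\<^sup>+\<^sup>J f\<close> is then close to a combination \<open>\<Sum>\<^sub>j c\<^sub>j T\<^sup>n\<^sup>+\<^sup>j f\<close> with small
  \<open>\<Sum>\<^sub>j \<bar>c\<^sub>j\<bar>\<^sup>2\<close>. In the average of the products with a sequence \<open>w\<^sub>n\<close> the shifts can be moved to \<open>w\<close>; if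
  the correlations of \<open>w\<close> at every nonzero lag average to zero, the resulting combinations of \<open>w\<close> have
  small norm on average. Hence the averages of \<open>T\<^sup>n f \<cdot> w\<^sub>n\<close> tend to zero
  (\<open>singular_times_uncorrelated\<close>).

  This applies to \<open>w\<^sub>n = S\<^sup>k\<^sup>(\<^sup>n\<^sup>) g'\<close> with \<open>g' = g - E[g|I\<^sub>S]\<close>. Its correlations at lag \<open>h\<close> are the integrals of
  \<open>e((k(n+h) - k(n))t)\<close> against the spectral measure of \<open>g'\<close>, whose existence is Herglotz' theorem
  (\<open>has_spectrum_exists\<close>). By uniform distribution the averages of these functions tend to zero outside
  a countable set \<open>Z\<close>, the integers under the first hypothesis and the rationals under the second. The
  mass that the spectral measure gives to \<open>\<alpha> + \<int>\<close> is the inner product of \<open>g'\<close> with an eigenfunction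
  (\<open>eigenfunction_of_atom\<close>); the eigenfunction is measurable for the invariant sigma-algebra if \<open>\<alpha>\<close> is an
  integer, and for the one of the rational eigenfunctions, where \<open>g\<close> is assumed to have the same conditional
  expectation, if \<open>\<alpha>\<close> is rational. So the mass is zero for \<open>\<alpha> \<in> Z\<close> (\<open>orbit_uncorrelated\<close>). The remaining part
  \<open>E[g|I\<^sub>S]\<close> of \<open>g\<close> does not move under \<open>S\<close>, and the averages of \<open>T\<^sup>n f\<close> converge by the mean ergodic
  theorem.

  For the statement on recurrence, \<open>f\<close> and \<open>g\<close> are the indicator of \<open>A\<close>, and the limit is the integral of
  \<open>1\<^sub>A E[1\<^sub>A|I\<^sub>T] E[1\<^sub>A|I\<^sub>S]\<close>, which is at least \<open>\<mu>(A)\<^sup>3\<close> (\<open>product_cond_exp_lower_bound\<close>).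
\<close>

section \<open>Characters and square integrable functions\<close>

lemma circle_of_add: "circle_of (s + t) = circle_of s * circle_of t"
  by (simp add: circle_of_def cis_mult ring_distribs)

lemma cnj_circle_of: "cnj (circle_of t) = circle_of (- t)"
  by (simp add: circle_of_def cis_cnj)

lemma circle_of_diff: "circle_of (s - t) = circle_of s * cnj (circle_of t)"
  using circle_of_add[of s "- t"] by (simp add: cnj_circle_of)

lemma norm_circle_of [simp]: "cmod (circle_of t) = 1"
  by (simp add: circle_of_def)

lemma circle_of_0 [simp]: "circle_of 0 = 1"
  by (simp add: circle_of_def)

lemma circle_of_power: "circle_of t ^ n = circle_of (real n * t)"
  unfolding circle_of_def Complex.DeMoivre by (simp add: mult.left_commute)

lemma circle_of_eq_1_iff: "circle_of t = 1 \<longleftrightarrow> t \<in> \<int>"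
proof -
  have "circle_of t = 1 \<longleftrightarrow> cos (2 * pi * t) = 1"
    unfolding circle_of_def complex_eq_iff using sin_cos_squared_add[of "2 * pi * t"]
    by (auto simp del: sin_cos_squared_add)
  also have "\<dots> \<longleftrightarrow> (\<exists>n::int. 2 * pi * t = of_int n * (2 * pi))"
    by (simp add: cos_one_2pi_int)
  also have "\<dots> \<longleftrightarrow> (\<exists>n::int. t = of_int n)"
    by (simp add: mult.commute)
  finally show ?thesis
    by (auto simp: Ints_def)
qed

lemma continuous_on_circle_of [continuous_intros]:
  "continuous_on A f \<Longrightarrow> continuous_on A (\<lambda>x. circle_of (f x))"
  unfolding circle_of_def by (intro continuous_intros)

lemma borel_measurable_circle_of [measurable]: "circle_of \<in> borel_measurable borel"
  by (intro borel_measurable_continuous_onI continuous_intros)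

lemma borel_measurable_cnj [measurable (raw)]:
  "f \<in> borel_measurable M \<Longrightarrow> (\<lambda>x. cnj (f x)) \<in> borel_measurable M"
  by (simp add: borel_measurable_complex_iff)

lemma L2_measurable: "f \<in> L2 M \<Longrightarrow> f \<in> borel_measurable M"
  by (simp add: L2_def)

lemma L2_mult_cnj_integrable:
  assumes "f \<in> L2 M" "g \<in> L2 M"
  shows "integrable M (\<lambda>x. f x * cnj (g x))"
proof (rule Bochner_Integration.integrable_bound)
  show "integrable M (\<lambda>x. (cmod (f x))\<^sup>2 + (cmod (g x))\<^sup>2)"
    using assms by (simp add: L2_def)
  show "(\<lambda>x. f x * cnj (g x)) \<in> borel_measurable M"
    using assms[THEN L2_measurable] by measurable
  have "cmod (f x) * cmod (g x) \<le> (cmod (f x))\<^sup>2 + (cmod (g x))\<^sup>2" for x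
    using sum_squares_bound[of "cmod (f x)" "cmod (g x)"]
      mult_nonneg_nonneg[of "cmod (f x)" "cmod (g x)"] by (simp del: mult_nonneg_nonneg)
  then show "AE x in M. norm (f x * cnj (g x)) \<le> norm ((cmod (f x))\<^sup>2 + (cmod (g x))\<^sup>2)"
    by (simp add: norm_mult)
qed

lemma bounded_in_L2:
  assumes "finite_measure M" "f \<in> borel_measurable M" "AE x in M. cmod (f x) \<le> C"
  shows "f \<in> L2 M"
proof -
  interpret finite_measure M by fact
  have "integrable M (\<lambda>x. (cmod (f x))\<^sup>2)"
  proof (rule integrable_const_bound[where B = "C\<^sup>2"])
    show "AE x in M. norm ((cmod (f x))\<^sup>2) \<le> C\<^sup>2"
      using assms(3) by eventually_elim (simp add: power_mono)
  qed (use assms(2) in measurable)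
  then show ?thesis
    using assms(2) by (simp add: L2_def)
qed

lemma character_in_L2:
  assumes "finite_measure \<nu>" "sets \<nu> = sets borel"
  shows "(\<lambda>t. circle_of (c * t)) \<in> L2 \<nu>"
proof -
  have "(\<lambda>t. circle_of (c * t)) \<in> borel_measurable \<nu>"
    unfolding measurable_cong_sets[OF assms(2) refl] by measurable
  then show ?thesis
    by (intro bounded_in_L2[OF assms(1), of _ 1]) auto
qed

text \<open>Norms of linear combinations are determined by the Gram matrix. This is the source of the spectral
  isometry below and of the orthogonality relations.\<close>

lemma norm_sum_eq_Gram:
  fixes c :: "'i \<Rightarrow> complex"
  assumes "finite I" "\<And>n. n \<in> I \<Longrightarrow> u n \<in> L2 M"
  shows "complex_of_real (\<integral>x. (cmod (\<Sum>n\<in>I. c n * u n x))\<^sup>2 \<partial>M)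
    = (\<Sum>n\<in>I. \<Sum>m\<in>I. c n * cnj (c m) * L2_inner M (u n) (u m))"
proof -
  have "complex_of_real (\<integral>x. (cmod (\<Sum>n\<in>I. c n * u n x))\<^sup>2 \<partial>M)
      = (\<integral>x. (\<Sum>n\<in>I. \<Sum>m\<in>I. c n * cnj (c m) * (u n x * cnj (u m x))) \<partial>M)"
    unfolding integral_complex_of_real[symmetric] complex_norm_square
    by (simp add: sum_product mult_ac)
  also have "\<dots> = (\<Sum>n\<in>I. \<Sum>m\<in>I. c n * cnj (c m) * L2_inner M (u n) (u m))"
    using assms by (simp add: L2_inner_def L2_mult_cnj_integrable)
  finally show ?thesis .
qed

text \<open>A measure \<open>\<nu>\<close> on the line is a spectral measure of a sequence \<open>u\<close> if \<open>u\<close> and the characters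
  \<open>t \<mapsto> e\<^sup>2\<^sup>\<pi>\<^sup>i\<^sup>n\<^sup>t\<close> have the same Gram matrix. The mass of \<open>\<nu>\<close> may lie anywhere: only its image on the
  circle matters.\<close>

definition has_spectrum :: "'a measure \<Rightarrow> (nat \<Rightarrow> 'a \<Rightarrow> complex) \<Rightarrow> real measure \<Rightarrow> bool" where
  "has_spectrum M u \<nu> \<longleftrightarrow> finite_measure \<nu> \<and> sets \<nu> = sets borel \<and>
     (\<forall>a b. L2_inner M (u a) (u b)
        = L2_inner \<nu> (\<lambda>t. circle_of (real a * t)) (\<lambda>t. circle_of (real b * t)))"

lemma has_spectrum_norm_sum:
  fixes c :: "nat \<Rightarrow> complex"
  assumes "has_spectrum M u \<nu>" "finite I" "\<And>n. n \<in> I \<Longrightarrow> u n \<in> L2 M"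
  shows "(\<integral>x. (cmod (\<Sum>n\<in>I. c n * u n x))\<^sup>2 \<partial>M)
    = (\<integral>t. (cmod (\<Sum>n\<in>I. c n * circle_of (real n * t)))\<^sup>2 \<partial>\<nu>)"
proof -
  have \<nu>: "finite_measure \<nu>" "sets \<nu> = sets borel"
    "\<And>a b. L2_inner M (u a) (u b)
        = L2_inner \<nu> (\<lambda>t. circle_of (real a * t)) (\<lambda>t. circle_of (real b * t))"
    using assms(1) by (auto simp: has_spectrum_def)
  show ?thesis
    unfolding of_real_eq_iff[where 'a = complex, symmetric]
    using norm_sum_eq_Gram[OF assms(2,3), where c = c]
      norm_sum_eq_Gram[OF assms(2) character_in_L2[OF \<nu>(1,2)], where c = c]
    by (simp add: \<nu>(3))
qed

lemma L2_inner_characters: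
  "L2_inner \<nu> (\<lambda>t. circle_of (a * t)) (\<lambda>t. circle_of (b * t)) = (\<integral>t. circle_of ((a - b) * t) \<partial>\<nu>)"
  by (simp add: L2_inner_def circle_of_diff left_diff_distrib)

lemma prob_space_lebesgue01: "prob_space lebesgue01"
  unfolding lebesgue01_def by (rule prob_space_restrict_space) auto

lemma space_lebesgue01 [simp]: "space lebesgue01 = {0..1}"
  by (simp add: lebesgue01_def space_restrict_space)

lemma borel_measurable_lebesgue01: "f \<in> borel_measurable borel \<Longrightarrow> f \<in> borel_measurable lebesgue01"
  unfolding lebesgue01_def by (intro measurable_restrict_space1) simp

lemma integral_character_lebesgue01:
  "(\<integral>t. circle_of (of_int k * t) \<partial>lebesgue01) = (if k = 0 then 1 else 0)"
proof (cases "k = 0")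
  case True
  interpret prob_space lebesgue01 by (rule prob_space_lebesgue01)
  show ?thesis using True by (simp add: prob_space[simplified])
next
  case False
  define c where "c = 2 * pi * of_int k"
  have c: "c \<noteq> 0" using False by (simp add: c_def)
  have e: "circle_of (of_int k * t) = exp (\<i> * c * t)" for t
    by (simp add: circle_of_def cis_conv_exp c_def mult_ac)
  have d: "((\<lambda>t. exp (\<i> * c * t) / (\<i> * c)) has_vector_derivative exp (\<i> * c * x)) (at x within {0..1})"
    for x :: real
  proof -
    have "((\<lambda>z. exp (\<i> * c * z) / (\<i> * c)) has_field_derivative exp (\<i> * c * x)) (at (of_real x))"
      using c by (auto intro!: derivative_eq_intros)
    from has_vector_derivative_real_field[OF this] show ?thesis
      by simp
  qed
  have "(\<integral>t. circle_of (of_int k * t) \<partial>lebesgue01)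
      = (\<integral>t. indicator {0..1} t *\<^sub>R exp (\<i> * c * complex_of_real t) \<partial>lborel)"
    unfolding lebesgue01_def e by (subst integral_restrict_space) auto
  also have "\<dots> = exp (\<i> * c * complex_of_real 1) / (\<i> * c) - exp (\<i> * c * complex_of_real 0) / (\<i> * c)"
    by (rule integral_FTC_Icc[OF _ d]) (auto intro!: continuous_intros)
  also have "\<dots> = 0"
    using e[of 1] circle_of_eq_1_iff[of "of_int k"] by simp
  finally show ?thesis using False by simp
qed

section \<open>Spectral measures of stationary sequences\<close>

lemma L2_inner_commute: "L2_inner M g f = cnj (L2_inner M f g)"
proof -
  have "cnj (L2_inner M f g) = (\<integral>x. cnj (f x * cnj (g x)) \<partial>M)"
    unfolding L2_inner_def by (rule Bochner_Integration.integral_cnj[symmetric])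
  then show ?thesis
    by (simp add: L2_inner_def mult.commute)
qed

lemma L2_inner_self: "L2_inner M f f = complex_of_real (\<integral>x. (cmod (f x))\<^sup>2 \<partial>M)"
  unfolding L2_inner_def complex_norm_square[symmetric] by (rule integral_complex_of_real)

lemma L2_inner_eq_0:
  assumes "f \<in> L2 M" "(\<integral>x. (cmod (f x))\<^sup>2 \<partial>M) = 0"
  shows "L2_inner M g f = 0"
proof -
  have "AE x in M. (cmod (f x))\<^sup>2 = 0"
    using assms by (subst integral_nonneg_eq_0_iff_AE[symmetric]) (auto simp: L2_def)
  then have "AE x in M. g x * cnj (f x) = 0"
    by eventually_elim simp
  then show ?thesis
    unfolding L2_inner_def by (rule integral_eq_zero_AE)
qed

lemma integrable_character_lebesgue01: "integrable lebesgue01 (\<lambda>t. circle_of (c * t))"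
proof -
  interpret prob_space lebesgue01 by (rule prob_space_lebesgue01)
  have "(\<lambda>t. circle_of (c * t)) \<in> borel_measurable lebesgue01"
    by (intro borel_measurable_lebesgue01) measurable
  then show ?thesis
    by (intro integrable_const_bound[where B = 1]) auto
qed

lemma L2_inner_shift:
  assumes "\<And>a b. L2_inner M (u (Suc a)) (u (Suc b)) = L2_inner M (u a) (u b)"
  shows "L2_inner M (u (b + h)) (u b) = L2_inner M (u h) (u 0)"
  by (induction b) (simp_all add: assms)

lemma has_spectrumI:
  assumes stat: "\<And>a b. L2_inner M (u (Suc a)) (u (Suc b)) = L2_inner M (u a) (u b)"
    and \<nu>: "finite_measure \<nu>" "sets \<nu> = sets borel"
    and coeff: "\<And>h. L2_inner M (u h) (u 0) = (\<integral>t. circle_of (real h * t) \<partial>\<nu>)"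
  shows "has_spectrum M u \<nu>"
proof -
  have *: "L2_inner M (u a) (u b)
      = L2_inner \<nu> (\<lambda>t. circle_of (real a * t)) (\<lambda>t. circle_of (real b * t))" if "b \<le> a" for a b
    using L2_inner_shift[where M = M and u = u, OF stat, of b "a - b"] coeff[of "a - b"] that
    by (simp add: L2_inner_characters of_nat_diff)
  have "L2_inner M (u a) (u b)
      = L2_inner \<nu> (\<lambda>t. circle_of (real a * t)) (\<lambda>t. circle_of (real b * t))" for a b
    using *[of b a] *[of a b] L2_inner_commute by (metis nat_le_linear)
  then show ?thesis
    using \<nu> by (simp add: has_spectrum_def)
qed

text \<open>Herglotz' theorem. The Fejer means \<open>F N\<close> of the would-be spectral measure are non-negative
  densities on \<open>[0, 1]\<close> because they are squared norms; a weak limit of them has the right Fourier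
  coefficients.\<close>

lemma has_spectrum_exists:
  assumes u: "\<And>n. u n \<in> L2 M"
    and stat: "\<And>a b. L2_inner M (u (Suc a)) (u (Suc b)) = L2_inner M (u a) (u b)"
  shows "\<exists>\<nu>. has_spectrum M u \<nu>"
proof -
  define c where "c = (\<integral>x. (cmod (u 0 x))\<^sup>2 \<partial>M)"
  have "c \<ge> 0" by (simp add: c_def)
  note enough = has_spectrumI[where M = M and u = u, OF stat]
  show ?thesis
  proof (cases "c = 0")
    case True
    have "has_spectrum M u (null_measure borel)"
    proof (rule enough)
      show "L2_inner M (u h) (u 0) = (\<integral>t. circle_of (real h * t) \<partial>null_measure borel)" for h
        using L2_inner_eq_0[OF u, of 0 "u h"] True by (simp add: c_def)
    qed (auto intro!: finite_measureI)
    then show ?thesis ..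
  next
    case False
    with \<open>c \<ge> 0\<close> have c: "c > 0" by simp
    interpret U: prob_space lebesgue01 by (rule prob_space_lebesgue01)
    define F where "F N t =
      (\<integral>x. (cmod (\<Sum>n<N. circle_of (- real n * t) * u n x))\<^sup>2 \<partial>M) / (real N * c)" for N t
    have F_nonneg: "F N t \<ge> 0" for N t
      using c by (simp add: F_def)
    have F_eq: "complex_of_real (F N t) =
        (\<Sum>n<N. \<Sum>m<N. circle_of (of_int (int m - int n) * t) * L2_inner M (u n) (u m))
          / (real N * c)" for N t
    proof -
      have "circle_of (- real n * t) * cnj (circle_of (- real m * t))
          = circle_of (of_int (int m - int n) * t)" for n m
        unfolding circle_of_diff[symmetric] by (simp add: algebra_simps)
      then show ?thesis
        unfolding F_def of_real_divide
        by (subst norm_sum_eq_Gram) (use u in auto)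
    qed
    have iF: "integrable lebesgue01 (\<lambda>t. complex_of_real (F N t))" for N
      unfolding F_eq
      by (intro integrable_divide Bochner_Integration.integrable_sum integrable_mult_left
          integrable_character_lebesgue01)
    have iF': "integrable lebesgue01 (F N)" for N
      using integrable_Re[OF iF[of N]] by simp
    have orth: "(\<integral>t. (\<Sum>n<N. \<Sum>m<N. circle_of (of_int (j n m) * t) * A n m) / K \<partial>lebesgue01)
        = (\<Sum>n<N. \<Sum>m<N. (if j n m = 0 then 1 else 0) * A n m) / K"
      for j :: "nat \<Rightarrow> nat \<Rightarrow> int" and A and K :: complex and N :: nat
      by (simp add: integrable_character_lebesgue01 integral_character_lebesgue01)
    have F_hat: "(\<integral>t. complex_of_real (F N t) * circle_of (real h * t) \<partial>lebesgue01)
        = of_nat (N - h) * L2_inner M (u h) (u 0) / (real N * c)" for N h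
    proof -
      have "complex_of_real (F N t) * circle_of (real h * t) =
          (\<Sum>n<N. \<Sum>m<N. circle_of (of_int (int h + int m - int n) * t) * L2_inner M (u n) (u m))
            / (real N * c)" for t
      proof -
        have "circle_of (of_int (int m - int n) * t) * circle_of (real h * t)
            = circle_of (of_int (int h + int m - int n) * t)" for n m
          unfolding circle_of_add[symmetric] by (simp add: algebra_simps)
        then show ?thesis
          unfolding F_eq times_divide_eq_left sum_distrib_right
          by (intro arg_cong2[where f = "(/)"] sum.cong refl) (metis mult.assoc mult.commute)
      qed
      then have "(\<integral>t. complex_of_real (F N t) * circle_of (real h * t) \<partial>lebesgue01) =
          (\<Sum>n<N. \<Sum>m<N. (if int h + int m - int n = 0 then 1 else 0) * L2_inner M (u n) (u m))
            / (real N * c)"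
        by (simp only: orth)
      also have "(\<Sum>n<N. \<Sum>m<N. (if int h + int m - int n = 0 then 1 else 0) * L2_inner M (u n) (u m))
          = (\<Sum>n<N. \<Sum>m<N. (if n = m + h then 1 else 0) * L2_inner M (u n) (u m))"
        by (intro sum.cong refl arg_cong2[where f = "(*)"] if_cong) auto
      also have "(\<Sum>n<N. \<Sum>m<N. (if n = m + h then 1 else 0) * L2_inner M (u n) (u m))
          = (\<Sum>m<N. \<Sum>n<N. if n = m + h then L2_inner M (u n) (u m) else 0)"
        by (subst sum.swap) (auto intro!: sum.cong)
      also have "\<dots> = (\<Sum>m<N. if m < N - h then L2_inner M (u h) (u 0) else 0)"
        by (auto intro!: sum.cong simp: L2_inner_shift[where M = M and u = u, OF stat])
      also have "\<dots> = (\<Sum>m<N - h. L2_inner M (u h) (u 0))"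
        by (rule sum.mono_neutral_cong_right) auto
      finally show ?thesis by simp
    qed
    define \<mu> where "\<mu> N = distr (density lebesgue01 (F (Suc N))) borel (\<lambda>t. t)" for N
    have Fm [measurable]: "F N \<in> borel_measurable lebesgue01" for N
      using iF' by auto
    have idm [measurable]: "(\<lambda>t. t) \<in> measurable lebesgue01 borel"
      by (intro borel_measurable_lebesgue01) measurable
    have total: "emeasure (density lebesgue01 (F (Suc N))) {0..1} = 1" for N
    proof -
      have "complex_of_real (\<integral>t. F (Suc N) t \<partial>lebesgue01) = 1"
        using F_hat[of "Suc N" 0] c by (simp add: L2_inner_self c_def del: of_nat_Suc)
      then have "(\<integral>t. F (Suc N) t \<partial>lebesgue01) = 1"
        using of_real_eq_1_iff by blast
      then have "(\<integral>\<^sup>+t. F (Suc N) t \<partial>lebesgue01) = 1"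
        using nn_integral_eq_integral[OF iF'] F_nonneg by simp
      moreover have "emeasure (density lebesgue01 (F (Suc N))) (space lebesgue01)
          = (\<integral>\<^sup>+t. F (Suc N) t \<partial>lebesgue01)"
        by (subst emeasure_density) (auto intro!: nn_integral_cong simp del: space_lebesgue01)
      ultimately show ?thesis by simp
    qed
    have rd: "real_distribution (\<mu> N)" for N
    proof -
      have "prob_space (density lebesgue01 (F (Suc N)))"
        by (rule prob_spaceI) (simp add: total)
      then have "prob_space (\<mu> N)"
        unfolding \<mu>_def by (rule prob_space.prob_space_distr) measurable
      then show ?thesis
        by (simp add: real_distribution_def real_distribution_axioms_def \<mu>_def)
    qed
    have tight: "tight \<mu>"
      unfolding tight_def
    proof (intro conjI allI impI)
      fix e :: real assume "e > 0"
      have "measure (\<mu> n) {-1<..1} = 1" for n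
      proof -
        have "emeasure (\<mu> n) {-1<..1} = emeasure (density lebesgue01 (F (Suc n))) {0..1}"
          unfolding \<mu>_def by (subst emeasure_distr) (auto intro!: arg_cong2[where f = emeasure])
        then show ?thesis
          by (simp add: measure_def total)
      qed
      with \<open>e > 0\<close> show "\<exists>a b. a < b \<and> (\<forall>n. 1 - e < measure (\<mu> n) {a<..b})"
        by (intro exI[of _ "- 1"] exI[of _ 1]) simp
    qed (rule rd)
    then obtain r \<nu>' where r: "strict_mono r" and \<nu>': "real_distribution \<nu>'"
      and conv: "weak_conv_m (\<mu> \<circ> id \<circ> r) \<nu>'"
      using tight_imp_convergent_subsubsequence[OF tight strict_mono_id] by blast
    interpret \<nu>': real_distribution \<nu>' by fact
    have char_\<mu>: "char (\<mu> N) (2 * pi * real h)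
        = of_nat (Suc N - h) * L2_inner M (u h) (u 0) / (real (Suc N) * c)" for N h
    proof -
      have "char (\<mu> N) (2 * pi * real h) = (\<integral>t. circle_of (real h * t) \<partial>\<mu> N)"
        by (simp add: char_def circle_of_def cis_conv_exp mult_ac)
      also have "\<dots> = (\<integral>t. circle_of (real h * t) \<partial>density lebesgue01 (F (Suc N)))"
        unfolding \<mu>_def by (rule integral_distr) measurable
      also have "\<dots> = (\<integral>t. complex_of_real (F (Suc N) t) * circle_of (real h * t) \<partial>lebesgue01)"
        by (subst integral_density) (auto simp: F_nonneg scaleR_conv_of_real)
      finally show ?thesis by (simp only: F_hat)
    qed
    have "(\<lambda>N. real (Suc N - h) / real (Suc N)) \<longlonglongrightarrow> 1" for h
      by real_asymp
    then have "(\<lambda>N. complex_of_real (real (Suc N - h) / real (Suc N)) * (L2_inner M (u h) (u 0) / c))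
        \<longlonglongrightarrow> of_real 1 * (L2_inner M (u h) (u 0) / c)" for h
      by (intro tendsto_mult tendsto_of_real tendsto_const)
    then have "(\<lambda>N. char (\<mu> N) (2 * pi * real h)) \<longlonglongrightarrow> L2_inner M (u h) (u 0) / c" for h
      unfolding char_\<mu> by (simp add: mult_ac)
    then have "(\<lambda>N. char (\<mu> (r N)) (2 * pi * real h)) \<longlonglongrightarrow> L2_inner M (u h) (u 0) / c" for h
      using LIMSEQ_subseq_LIMSEQ[OF _ r] by (auto simp: o_def)
    moreover have "(\<lambda>N. char (\<mu> (r N)) (2 * pi * real h)) \<longlonglongrightarrow> char \<nu>' (2 * pi * real h)" for h
      using levy_continuity1[OF _ \<nu>' conv] rd by (simp add: o_def)
    ultimately have char_\<nu>': "L2_inner M (u h) (u 0) = c * char \<nu>' (2 * pi * real h)" for h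
      using LIMSEQ_unique c by (fastforce simp: field_simps)
    have "has_spectrum M u (density \<nu>' (\<lambda>_. c))"
    proof (rule enough)
      show "finite_measure (density \<nu>' (\<lambda>_. c))"
        by (rule finite_measureI) (simp add: emeasure_density ennreal_mult_eq_top_iff)
      show "sets (density \<nu>' (\<lambda>_. c)) = sets borel" by simp
      show "L2_inner M (u h) (u 0) = (\<integral>t. circle_of (real h * t) \<partial>density \<nu>' (\<lambda>_. c))" for h
        using c unfolding char_\<nu>'
        by (subst integral_density)
          (auto simp: char_def circle_of_def cis_conv_exp mult_ac scaleR_conv_of_real)
    qed
    then show ?thesis ..
  qed
qed

section \<open>Trigonometric polynomials and singular measures\<close>

lemma real_polynomial_on_circle:
  assumes "real_polynomial_function f"
  shows "\<exists>p J. \<forall>t. poly p (circle_of t) = complex_of_real (f (circle_of t)) * circle_of t ^ J"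
  using assms
proof (induction f rule: real_polynomial_function.induct)
  case (linear f)
  interpret bounded_linear f by fact
  define a b where "a = complex_of_real (f 1) / 2" and "b = complex_of_real (f \<i>) / (2 * \<i>)"
  have "poly [:a - b, 0, a + b:] z = complex_of_real (f z) * z ^ 1" if "z * cnj z = 1" for z
  proof -
    have "z = Re z *\<^sub>R 1 + Im z *\<^sub>R \<i>"
      by (simp add: complex_eq_iff)
    then have "f z = f (Re z *\<^sub>R 1 + Im z *\<^sub>R \<i>)"
      by metis
    then have "complex_of_real (f z)
        = complex_of_real (2 * Re z) * a + complex_of_real (2 * Im z) * \<i> * b"
      by (simp add: add scaleR a_def b_def)
    also have "complex_of_real (2 * Re z) = z + cnj z"
      by (simp add: complex_eq_iff)
    also have "complex_of_real (2 * Im z) * \<i> = z - cnj z"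
      by (simp add: complex_eq_iff)
    finally have "complex_of_real (f z) = (z + cnj z) * a + (z - cnj z) * b" .
    then have "complex_of_real (f z) * z = ((z + cnj z) * a + (z - cnj z) * b) * z"
      by simp
    also have "\<dots> = (z * z + z * cnj z) * a + (z * z - z * cnj z) * b"
      by (simp add: algebra_simps)
    finally show ?thesis
      unfolding that by (simp add: algebra_simps)
  qed
  then have "\<forall>t. poly [:a - b, 0, a + b:] (circle_of t)
      = complex_of_real (f (circle_of t)) * circle_of t ^ 1"
    using circle_of_diff[of t t for t] by simp
  then show ?case by blast
next
  case (const c)
  have "\<forall>t. poly [:complex_of_real c:] (circle_of t) = complex_of_real c * circle_of t ^ 0"
    by simp
  then show ?case by blast
next
  case (add f g)
  then obtain p J q L where
    "\<And>t. poly p (circle_of t) = complex_of_real (f (circle_of t)) * circle_of t ^ J"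
    "\<And>t. poly q (circle_of t) = complex_of_real (g (circle_of t)) * circle_of t ^ L"
    by metis
  then have "\<forall>t. poly (monom 1 L * p + monom 1 J * q) (circle_of t)
      = complex_of_real (f (circle_of t) + g (circle_of t)) * circle_of t ^ (J + L)"
    by (simp add: poly_monom algebra_simps power_add)
  then show ?case by blast
next
  case (mult f g)
  then obtain p J q L where
    "\<And>t. poly p (circle_of t) = complex_of_real (f (circle_of t)) * circle_of t ^ J"
    "\<And>t. poly q (circle_of t) = complex_of_real (g (circle_of t)) * circle_of t ^ L"
    by metis
  then have "\<forall>t. poly (p * q) (circle_of t)
      = complex_of_real (f (circle_of t) * g (circle_of t)) * circle_of t ^ (J + L)"
    by (simp add: algebra_simps power_add)
  then show ?case by blast
qed

lemma Parseval_poly: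
  "(\<integral>t. (cmod (poly p (circle_of t)))\<^sup>2 \<partial>lebesgue01) = (\<Sum>j\<le>degree p. (cmod (coeff p j))\<^sup>2)"
proof -
  interpret prob_space lebesgue01 by (rule prob_space_lebesgue01)
  have L2: "(\<lambda>t. circle_of (real n * t)) \<in> L2 lebesgue01" for n
  proof (rule bounded_in_L2[where C = 1])
    show "(\<lambda>t. circle_of (real n * t)) \<in> borel_measurable lebesgue01"
      by (intro borel_measurable_lebesgue01) measurable
  qed (auto intro: finite_measure_axioms)
  have orth: "L2_inner lebesgue01 (\<lambda>t. circle_of (real n * t)) (\<lambda>t. circle_of (real m * t))
      = (if n = m then 1 else 0)" for n m
    using integral_character_lebesgue01[of "int n - int m"] by (simp add: L2_inner_characters)
  have "complex_of_real (\<integral>t. (cmod (poly p (circle_of t)))\<^sup>2 \<partial>lebesgue01)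
      = (\<Sum>n\<le>degree p. \<Sum>m\<le>degree p. coeff p n * cnj (coeff p m) * (if n = m then 1 else 0))"
    unfolding poly_altdef circle_of_power using norm_sum_eq_Gram[OF _ L2, of "{..degree p}" "coeff p"]
    by (simp add: orth)
  also have "\<dots> = (\<Sum>n\<le>degree p. coeff p n * cnj (coeff p n))"
    by (simp add: if_distrib sum.delta cong: if_cong)
  also have "\<dots> = complex_of_real (\<Sum>j\<le>degree p. (cmod (coeff p j))\<^sup>2)"
    unfolding of_real_sum complex_norm_square ..
  finally show ?thesis
    using of_real_eq_iff by blast
qed

lemma AE_lebesgue01_not_in:
  assumes "B \<in> sets borel" "emeasure lborel B = 0"
  shows "AE t in lebesgue01. t \<notin> B"
proof -
  have "AE t in lborel. t \<notin> B"
    using assms by (intro AE_not_in) (auto simp: null_sets_def)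
  then show ?thesis
    unfolding lebesgue01_def by (subst AE_restrict_space_iff) auto
qed

text \<open>A singular measure does not see the difference between \<open>1\<close> and a suitable function that is
  small for Lebesgue measure. Multiplied by a power of \<open>z\<close>, a trigonometric polynomial close to such
  a function has non-negative frequencies only.\<close>

lemma singular_trig_approx:
  assumes \<nu>: "finite_measure \<nu>" "sets \<nu> = sets borel"
    and B: "B \<in> sets borel" "B \<subseteq> {0..1}" "emeasure lborel B = 0" "emeasure \<nu> (- B) = 0"
    and "\<epsilon> > 0"
  obtains p J where
    "(\<integral>t. (cmod (poly p (circle_of t) - circle_of t ^ J))\<^sup>2 \<partial>\<nu>) < \<epsilon>"
    "(\<Sum>j\<le>degree p. (cmod (coeff p j))\<^sup>2) < \<epsilon>"
proof -
  interpret finite_measure \<nu> by fact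
  interpret U: prob_space lebesgue01 by (rule prob_space_lebesgue01)
  have sp: "space \<nu> = UNIV"
    using sets_eq_imp_space_eq[OF \<nu>(2)] by simp
  note m\<nu> = measurable_cong_sets[OF \<nu>(2) refl]
  define \<eta> where "\<eta> = \<epsilon> / 8"
  have \<eta>: "\<eta> > 0" using \<open>\<epsilon> > 0\<close> by (simp add: \<eta>_def)
  obtain K0 where K0: "K0 \<subseteq> B" "compact K0" "measure \<nu> B - \<eta> < measure \<nu> K0"
  proof (cases "measure \<nu> B = 0")
    case True
    then show ?thesis using that[of "{}"] \<eta> by simp
  next
    case False
    then have "measure \<nu> B > 0" using measure_nonneg by (metis less_eq_real_def)
    then have "ennreal (measure \<nu> B - \<eta>) < ennreal (measure \<nu> B)"
      using \<eta> by (intro ennreal_lessI) auto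
    also have "\<dots> = (SUP K \<in> {K. K \<subseteq> B \<and> compact K}. emeasure \<nu> K)"
      unfolding emeasure_eq_measure[symmetric]
      by (rule inner_regular) (use \<nu> B emeasure_finite in auto)
    finally obtain K where K: "K \<subseteq> B" "compact K" "ennreal (measure \<nu> B - \<eta>) < emeasure \<nu> K"
      by (auto simp: less_SUP_iff)
    then have "measure \<nu> B - \<eta> < measure \<nu> K"
      unfolding emeasure_eq_measure by (metis ennreal_leI leD leI)
    with K that show ?thesis by blast
  qed
  have K0b [measurable]: "K0 \<in> sets borel"
    using K0 by (simp add: borel_compact)
  have K0_compl: "measure \<nu> (- K0) < \<eta>"
  proof -
    have "measure \<nu> (- K0) \<le> measure \<nu> (- B \<union> (B - K0))"
      by (rule finite_measure_mono) (use \<nu> B in auto)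
    also have "\<dots> \<le> measure \<nu> (- B) + measure \<nu> (B - K0)"
      by (rule measure_Un_le) (use \<nu> B in auto)
    also have "measure \<nu> (B - K0) = measure \<nu> B - measure \<nu> K0"
      by (rule finite_measure_Diff) (use \<nu> B K0 in auto)
    finally show ?thesis
      using K0(3) B(4) by (simp add: measure_def)
  qed
  \<comment> \<open>The extra point makes the set non-empty, so that \<^const>\<open>infdist\<close> is the distance.\<close>
  define C where "C = circle_of ` insert 0 K0"
  have C: "compact C" "C \<noteq> {}"
    unfolding C_def using K0(2)
    by (intro compact_continuous_image continuous_intros compact_insert) auto
  define \<phi> where "\<phi> n z = max 0 (1 - real n * infdist z C)" for n and z :: complex
  have \<phi>_cont: "continuous_on A (\<phi> n)" for A n
    unfolding \<phi>_def by (intro continuous_intros)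
  have \<phi>_meas [measurable]: "\<phi> n \<in> borel_measurable borel" for n
    by (intro borel_measurable_continuous_onI \<phi>_cont)
  have \<phi>_01: "0 \<le> \<phi> n z" "\<phi> n z \<le> 1" for n z
    using infdist_nonneg[of z C] by (auto simp: \<phi>_def)
  have "(\<lambda>n. \<integral>t. (\<phi> n (circle_of t))\<^sup>2 \<partial>lebesgue01) \<longlonglongrightarrow> (\<integral>t. 0 \<partial>lebesgue01)"
  proof (rule integral_dominated_convergence[where w = "\<lambda>_. 1"])
    show "AE t in lebesgue01. (\<lambda>n. (\<phi> n (circle_of t))\<^sup>2) \<longlonglongrightarrow> 0"
    proof -
      have "AE t in lebesgue01. t \<notin> B \<union> {0, 1}"
      proof (rule AE_lebesgue01_not_in)
        have "B \<union> {0, 1} \<in> null_sets lborel"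
          using B by (intro null_sets.Un[OF _ finite_imp_null_set_lborel]) (auto simp: null_sets_def)
        then show "emeasure lborel (B \<union> {0, 1}) = 0" by auto
      qed (use B in auto)
      moreover have "AE t in lebesgue01. t \<in> {0..1}"
        using AE_space[of lebesgue01] by simp
      ultimately show ?thesis
      proof eventually_elim
        case (elim t)
        have "circle_of t \<notin> C"
        proof
          assume "circle_of t \<in> C"
          then obtain s where s: "s \<in> insert 0 K0" "circle_of t = circle_of s"
            unfolding C_def by blast
          then have "circle_of (t - s) = 1"
            using circle_of_diff[of s s] by (simp add: circle_of_diff)
          then obtain k :: int where k: "t - s = of_int k"
            by (auto simp: circle_of_eq_1_iff Ints_def)
          moreover have "s \<in> {0..1}" using s K0 B by auto
          ultimately have "real_of_int k < 1" "real_of_int k > - 1"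
            using elim by auto
          then have "k = 0" by linarith
          then have "t = s" using k by simp
          then show False using s elim K0 by auto
        qed
        then have "infdist (circle_of t) C > 0"
          using C by (simp add: infdist_pos_not_in_closed compact_imp_closed)
        then obtain n0 where n0: "real n0 * infdist (circle_of t) C > 1"
          using reals_Archimedean3 by blast
        have "\<phi> n (circle_of t) = 0" if "n \<ge> n0" for n
        proof -
          have "real n0 * infdist (circle_of t) C \<le> real n * infdist (circle_of t) C"
            using that by (intro mult_right_mono) (auto simp: infdist_nonneg)
          then show ?thesis using n0 by (simp add: \<phi>_def)
        qed
        then have "eventually (\<lambda>n. (\<phi> n (circle_of t))\<^sup>2 = 0) sequentially"
          unfolding eventually_sequentially by auto
        then show ?case by (rule tendsto_eventually)
      qed
    qed
    show "AE t in lebesgue01. norm ((\<phi> n (circle_of t))\<^sup>2) \<le> 1" for n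
      using \<phi>_01 by (auto simp: power_le_one)
    show "(\<lambda>t. (\<phi> n (circle_of t))\<^sup>2) \<in> borel_measurable lebesgue01" for n
      by (intro borel_measurable_lebesgue01) measurable
  qed auto
  then have "eventually (\<lambda>n. (\<integral>t. (\<phi> n (circle_of t))\<^sup>2 \<partial>lebesgue01) < \<eta>) sequentially"
    using \<eta> by (auto dest: order_tendstoD)
  then obtain n where n: "(\<integral>t. (\<phi> n (circle_of t))\<^sup>2 \<partial>lebesgue01) < \<eta>"
    by (auto simp: eventually_sequentially)
  define V where "V = measure \<nu> UNIV"
  define \<delta> where "\<delta> = sqrt (\<eta> / (1 + V))"
  have V: "V \<ge> 0" by (simp add: V_def)
  have \<delta>: "\<delta> > 0" "\<delta>\<^sup>2 * V \<le> \<eta>" "\<delta>\<^sup>2 \<le> \<eta>"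
    using \<eta> V by (simp_all add: \<delta>_def field_simps)
  obtain g :: "complex \<Rightarrow> real" where g: "real_polynomial_function g" "\<And>z. z \<in> sphere 0 1 \<Longrightarrow> \<bar>\<phi> n z - g z\<bar> < \<delta>"
    using Stone_Weierstrass_real_polynomial_function[OF compact_sphere \<phi>_cont \<delta>(1)] by blast
  obtain p J where pJ: "\<And>t. poly p (circle_of t) = complex_of_real (g (circle_of t)) * circle_of t ^ J"
    using real_polynomial_on_circle[OF g(1)] by blast
  have gmeas [measurable]: "g \<in> borel_measurable borel"
    using g(1) by (intro borel_measurable_continuous_onI continuous_on_polymonial_function)
      (simp add: real_polynomial_function_eq)
  have sq: "(a - c)\<^sup>2 \<le> 2 * \<delta>\<^sup>2 + 2 * (b - c)\<^sup>2" if "\<bar>b - a\<bar> < \<delta>" for a b c :: real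
  proof -
    have "(a - b)\<^sup>2 \<le> \<delta>\<^sup>2"
      using that by (metis abs_minus_commute abs_ge_zero less_imp_le power2_abs power_mono)
    moreover have "(a - c)\<^sup>2 \<le> 2 * (a - b)\<^sup>2 + 2 * (b - c)\<^sup>2"
      using sum_squares_bound[of "a - b" "b - c"] by (simp add: power2_eq_square algebra_simps)
    ultimately show ?thesis by simp
  qed
  have gc: "\<bar>\<phi> n (circle_of t) - g (circle_of t)\<bar> < \<delta>" for t
    using g(2)[of "circle_of t"] by simp
  have g_bd: "\<bar>g (circle_of t)\<bar> \<le> 1 + \<delta>" for t
    using gc[of t] \<phi>_01[of n "circle_of t"] by linarith
  show ?thesis
  proof (rule that)
    have "cmod (poly p (circle_of t) - circle_of t ^ J) = \<bar>g (circle_of t) - 1\<bar>" for t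
    proof -
      have "poly p (circle_of t) - circle_of t ^ J = complex_of_real (g (circle_of t) - 1) * circle_of t ^ J"
        by (simp add: pJ algebra_simps)
      then show ?thesis by (simp only: norm_mult norm_power norm_of_real norm_circle_of) simp
    qed
    then have "(\<integral>t. (cmod (poly p (circle_of t) - circle_of t ^ J))\<^sup>2 \<partial>\<nu>) = (\<integral>t. (g (circle_of t) - 1)\<^sup>2 \<partial>\<nu>)"
      by simp
    also have "\<dots> \<le> (\<integral>t. 2 * \<delta>\<^sup>2 + 2 * indicator (- K0) t \<partial>\<nu>)"
    proof (rule integral_mono)
      show "integrable \<nu> (\<lambda>t. 2 * \<delta>\<^sup>2 + 2 * indicator (- K0) t :: real)"
        using \<nu> by (auto simp: less_top[symmetric])
      show "integrable \<nu> (\<lambda>t. (g (circle_of t) - 1)\<^sup>2)"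
      proof (rule integrable_const_bound[where B = "(2 + \<delta>)\<^sup>2"])
        have "\<bar>g (circle_of t) - 1\<bar> \<le> 2 + \<delta>" for t
          using g_bd[of t] by linarith
        then have "(g (circle_of t) - 1)\<^sup>2 \<le> (2 + \<delta>)\<^sup>2" for t
          by (metis abs_ge_zero power2_abs power_mono)
        then show "AE t in \<nu>. norm ((g (circle_of t) - 1)\<^sup>2) \<le> (2 + \<delta>)\<^sup>2" by simp
        show "(\<lambda>t. (g (circle_of t) - 1)\<^sup>2) \<in> borel_measurable \<nu>"
          unfolding m\<nu> by measurable
      qed
      show "(g (circle_of t) - 1)\<^sup>2 \<le> 2 * \<delta>\<^sup>2 + 2 * indicator (- K0) t" for t
      proof -
        have "(\<phi> n (circle_of t) - 1)\<^sup>2 \<le> indicator (- K0) t"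
        proof (cases "t \<in> K0")
          case True
          then have "\<phi> n (circle_of t) = 1"
            by (simp add: \<phi>_def C_def infdist_zero)
          then show ?thesis by simp
        next
          case False
          have "\<bar>\<phi> n (circle_of t) - 1\<bar> \<le> 1"
            using \<phi>_01[of n "circle_of t"] by linarith
          then show ?thesis using False by (simp add: abs_square_le_1)
        qed
        then show ?thesis using sq[OF gc[of t], of 1] by linarith
      qed
    qed
    also have "\<dots> = 2 * \<delta>\<^sup>2 * V + 2 * measure \<nu> (- K0)"
      using \<nu> by (subst Bochner_Integration.integral_add) (auto simp: V_def sp less_top[symmetric])
    also have "\<dots> < \<epsilon>"
      using \<delta>(2) K0_compl \<open>\<epsilon> > 0\<close> by (simp add: \<eta>_def)
    finally show "(\<integral>t. (cmod (poly p (circle_of t) - circle_of t ^ J))\<^sup>2 \<partial>\<nu>) < \<epsilon>" .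
    have "(\<Sum>j\<le>degree p. (cmod (coeff p j))\<^sup>2) = (\<integral>t. (g (circle_of t))\<^sup>2 \<partial>lebesgue01)"
      unfolding Parseval_poly[symmetric] pJ by (simp add: norm_mult norm_power)
    also have "\<dots> \<le> (\<integral>t. 2 * \<delta>\<^sup>2 + 2 * (\<phi> n (circle_of t))\<^sup>2 \<partial>lebesgue01)"
    proof (rule integral_mono)
      show i: "integrable lebesgue01 (\<lambda>t. 2 * \<delta>\<^sup>2 + 2 * (\<phi> n (circle_of t))\<^sup>2)"
      proof (rule U.integrable_const_bound[where B = "2 * \<delta>\<^sup>2 + 2"])
        show "AE t in lebesgue01. norm (2 * \<delta>\<^sup>2 + 2 * (\<phi> n (circle_of t))\<^sup>2) \<le> 2 * \<delta>\<^sup>2 + 2"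
          using \<phi>_01 by (auto simp: power_le_one)
        show "(\<lambda>t. 2 * \<delta>\<^sup>2 + 2 * (\<phi> n (circle_of t))\<^sup>2) \<in> borel_measurable lebesgue01"
          by (intro borel_measurable_lebesgue01) measurable
      qed
      show le: "(g (circle_of t))\<^sup>2 \<le> 2 * \<delta>\<^sup>2 + 2 * (\<phi> n (circle_of t))\<^sup>2" for t
        using sq[OF gc[of t], of 0] by simp
      show "integrable lebesgue01 (\<lambda>t. (g (circle_of t))\<^sup>2)"
      proof (rule Bochner_Integration.integrable_bound[OF i])
        show "(\<lambda>t. (g (circle_of t))\<^sup>2) \<in> borel_measurable lebesgue01"
          by (intro borel_measurable_lebesgue01) measurable
        show "AE t in lebesgue01. norm ((g (circle_of t))\<^sup>2) \<le> norm (2 * \<delta>\<^sup>2 + 2 * (\<phi> n (circle_of t))\<^sup>2)"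
          using le by simp
      qed
    qed
    also have "\<dots> = 2 * \<delta>\<^sup>2 + 2 * (\<integral>t. (\<phi> n (circle_of t))\<^sup>2 \<partial>lebesgue01)"
    proof -
      have "integrable lebesgue01 (\<lambda>t. (\<phi> n (circle_of t))\<^sup>2)"
      proof (rule U.integrable_const_bound[where B = 1])
        show "AE t in lebesgue01. norm ((\<phi> n (circle_of t))\<^sup>2) \<le> 1"
          using \<phi>_01 by (auto simp: power_le_one)
        show "(\<lambda>t. (\<phi> n (circle_of t))\<^sup>2) \<in> borel_measurable lebesgue01"
          by (intro borel_measurable_lebesgue01) measurable
      qed
      then show ?thesis
        using U.prob_space by simp
    qed
    also have "\<dots> < \<epsilon>"
      using \<delta>(3) n \<open>\<epsilon> > 0\<close> by (simp add: \<eta>_def)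
    finally show "(\<Sum>j\<le>degree p. (cmod (coeff p j))\<^sup>2) < \<epsilon>" .
  qed
qed

section \<open>Singular sequences against uncorrelated sequences\<close>

lemma has_spectrum_shift:
  assumes "has_spectrum M u \<nu>"
  shows "has_spectrum M (\<lambda>i. u (n + i)) \<nu>"
  using assms by (simp add: has_spectrum_def L2_inner_characters)

lemma norm_sum_shift_le:
  fixes x :: "nat \<Rightarrow> 'b::real_normed_vector"
  assumes "\<And>n. norm (x n) \<le> K"
  shows "norm ((\<Sum>n=1..N. x (n + q)) - (\<Sum>n=1..N. x n)) \<le> 2 * real q * K"
proof (induction q)
  case (Suc q)
  have "(\<Sum>n=1..N. x (n + Suc q)) - (\<Sum>n=1..N. x (n + q)) = x (N + Suc q) - x (Suc q)" 
    by (induction N) (simp_all add: algebra_simps)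
  then have "norm ((\<Sum>n=1..N. x (n + Suc q)) - (\<Sum>n=1..N. x (n + q))) \<le> 2 * K"
    using norm_triangle_ineq4[of "x (N + Suc q)" "x (Suc q)"] assms[of "N + Suc q"] assms[of "Suc q"]
    by simp
  with Suc.IH have "norm (((\<Sum>n=1..N. x (n + Suc q)) - (\<Sum>n=1..N. x (n + q)))
      + ((\<Sum>n=1..N. x (n + q)) - (\<Sum>n=1..N. x n))) \<le> 2 * K + 2 * real q * K"
    by (rule norm_triangle_mono[rotated])
  then show ?case
    by (simp add: algebra_simps)
qed simp

lemma average_shift_tendsto_0:
  fixes x :: "nat \<Rightarrow> complex"
  assumes "\<And>n. cmod (x n) \<le> K" "(\<lambda>N. (\<Sum>n=1..N. x n) / of_nat N) \<longlonglongrightarrow> 0"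
  shows "(\<lambda>N. (\<Sum>n=1..N. x (n + q)) / of_nat N) \<longlonglongrightarrow> 0"
proof -
  have "(\<lambda>N. 2 * real q * K / real N) \<longlonglongrightarrow> 0"
    by real_asymp
  then have "(\<lambda>N. ((\<Sum>n=1..N. x (n + q)) - (\<Sum>n=1..N. x n)) / of_nat N) \<longlonglongrightarrow> 0"
    by (rule Lim_null_comparison[rotated])
      (use norm_sum_shift_le[OF assms(1)] in \<open>auto simp: norm_divide intro!: divide_right_mono always_eventually\<close>)
  from tendsto_add[OF this assms(2)] show ?thesis
    by (simp add: diff_divide_distrib)
qed

lemma cmod_sum_squared_le: "(cmod (\<Sum>n=1..N. x n))\<^sup>2 \<le> real N * (\<Sum>n=1..N. (cmod (x n))\<^sup>2)"
proof -
  have "(cmod (\<Sum>n=1..N. x n))\<^sup>2 \<le> (\<Sum>n=1..N. cmod (x n))\<^sup>2"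
    by (intro power_mono norm_sum) auto
  also have "\<dots> \<le> (\<Sum>n=1..N. (cmod (x n))\<^sup>2) * card {1..N}"
    by (rule sum_squared_le_sum_of_squares)
  finally show ?thesis by (simp add: mult.commute)
qed

lemma cmod_add3_squared_le: "(cmod (a + b + c))\<^sup>2 \<le> 3 * (cmod a)\<^sup>2 + 3 * (cmod b)\<^sup>2 + 3 * (cmod c)\<^sup>2"
proof -
  have "(cmod (a + b + c))\<^sup>2 \<le> (cmod a + cmod b + cmod c)\<^sup>2"
    by (intro power_mono norm_triangle_mono norm_triangle_ineq) auto
  also have "\<dots> \<le> 3 * (cmod a)\<^sup>2 + 3 * (cmod b)\<^sup>2 + 3 * (cmod c)\<^sup>2"
    using sum_squares_bound[of "cmod a" "cmod b"] sum_squares_bound[of "cmod b" "cmod c"]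
      sum_squares_bound[of "cmod a" "cmod c"]
    by (simp add: power2_eq_square algebra_simps)
  finally show ?thesis .
qed

lemma L2_inner_bounded:
  assumes "prob_space M" "f \<in> borel_measurable M" "g \<in> borel_measurable M"
    and "\<And>x. x \<in> space M \<Longrightarrow> cmod (f x) \<le> C" "\<And>x. x \<in> space M \<Longrightarrow> cmod (g x) \<le> C"
  shows "cmod (L2_inner M f g) \<le> C * C"
proof -
  interpret prob_space M by fact
  have b: "cmod (f x * cnj (g x)) \<le> C * C" if "x \<in> space M" for x
    unfolding norm_mult complex_mod_cnj
    using assms(4,5)[OF that] order_trans[OF norm_ge_zero] by (intro mult_mono) auto
  have [measurable]: "(\<lambda>x. f x * cnj (g x)) \<in> borel_measurable M"
    using assms by measurable
  have "cmod (L2_inner M f g) \<le> (\<integral>x. cmod (f x * cnj (g x)) \<partial>M)"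
    unfolding L2_inner_def by (rule integral_norm_bound)
  also have "\<dots> \<le> (\<integral>x. C * C \<partial>M)"
  proof (rule integral_mono)
    show "integrable M (\<lambda>x. cmod (f x * cnj (g x)))"
      by (rule integrable_const_bound[where B = "C * C"]) (use b in \<open>auto simp: AE_I2\<close>)
  qed (use b in auto)
  finally show ?thesis by (simp add: prob_space)
qed

text \<open>If \<open>v\<close> has singular spectrum, then \<open>v\<^sub>n\<^sub>+\<^sub>J\<close> is close to \<open>\<Sum>\<^sub>j c\<^sub>j v\<^sub>n\<^sub>+\<^sub>j\<close>, uniformly in
  \<open>n\<close>, for coefficients of small square sum. Moving the shifts from \<open>v\<close> to \<open>w\<close> in the average of the
  products replaces \<open>w\<close> by combinations \<open>\<Sum>\<^sub>j c\<^sub>j w\<^sub>n\<^sub>-\<^sub>j\<close>, up to a common shift, whose squared norms average to about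
  \<open>\<Sum>\<^sub>j \<bar>c\<^sub>j\<bar>\<^sup>2 \<parallel>w\<parallel>\<^sup>2\<close> if \<open>w\<close> is uncorrelated.\<close>

lemma singular_times_uncorrelated:
  fixes v w :: "nat \<Rightarrow> 'a \<Rightarrow> complex"
  assumes "prob_space M"
    and v: "\<And>n. v n \<in> borel_measurable M" "\<And>n x. x \<in> space M \<Longrightarrow> cmod (v n x) \<le> C"
    and w: "\<And>n. w n \<in> borel_measurable M" "\<And>n x. x \<in> space M \<Longrightarrow> cmod (w n x) \<le> C"
    and spec: "has_spectrum M v \<nu>"
    and B: "B \<in> sets borel" "B \<subseteq> {0..1}" "emeasure lborel B = 0" "emeasure \<nu> (- B) = 0"
    and uncorr: "\<And>h. h \<ge> 1 \<Longrightarrow> (\<lambda>N. (\<Sum>n=1..N. L2_inner M (w (n + h)) (w n)) / of_nat N) \<longlonglongrightarrow> 0"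
  shows "(\<lambda>N. \<integral>x. (cmod ((\<Sum>n=1..N. v n x * w n x) / of_nat N))\<^sup>2 \<partial>M) \<longlonglongrightarrow> 0"
proof (rule order_tendstoI)
  fix a :: real assume "a < 0"
  moreover have "0 \<le> (\<integral>x. (cmod ((\<Sum>n=1..N. v n x * w n x) / of_nat N))\<^sup>2 \<partial>M)" for N
    by simp
  ultimately show "eventually (\<lambda>N. a < (\<integral>x. (cmod ((\<Sum>n=1..N. v n x * w n x) / of_nat N))\<^sup>2 \<partial>M)) sequentially"
    by (intro always_eventually allI) (meson less_le_trans)
next
  fix \<epsilon> :: real assume "0 < \<epsilon>"
  interpret prob_space M by fact
  note [measurable] = v(1) w(1)
  have C: "C \<ge> 0"
    using not_empty v(2) norm_ge_zero by (metis all_not_in_conv order_trans)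
  have v_L2: "v n \<in> L2 M" for n
    by (rule bounded_in_L2[where C = C]) (use v finite_measure_axioms in \<open>auto simp: AE_I2\<close>)
  have w_L2: "w n \<in> L2 M" for n
    by (rule bounded_in_L2[where C = C]) (use w finite_measure_axioms in \<open>auto simp: AE_I2\<close>)
  have \<nu>: "finite_measure \<nu>" "sets \<nu> = sets borel"
    using spec by (auto simp: has_spectrum_def)
  have w_inner: "cmod (L2_inner M (w a) (w b)) \<le> C * C" for a b
    by (rule L2_inner_bounded[OF \<open>prob_space M\<close>]) (use w in auto)
  have off: "(\<lambda>N. (\<Sum>m=1..N. L2_inner M (w (m + a)) (w (m + b))) / of_nat N) \<longlonglongrightarrow> 0" if "a \<noteq> b" for a b
  proof -
    have *: "(\<lambda>N. (\<Sum>m=1..N. L2_inner M (w (m + a)) (w (m + b))) / of_nat N) \<longlonglongrightarrow> 0" if "b < a" for a b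
      using average_shift_tendsto_0[OF w_inner uncorr[of "a - b"], of b] that by simp
    show ?thesis
    proof (cases "b < a")
      case False
      then have "(\<lambda>N. cnj ((\<Sum>m=1..N. L2_inner M (w (m + b)) (w (m + a))) / of_nat N)) \<longlonglongrightarrow> cnj 0"
        using that by (intro tendsto_cnj *) auto
      then show ?thesis
        by (simp add: L2_inner_commute[symmetric])
    qed (rule *)
  qed
  define \<eta> where "\<eta> = \<epsilon> / (3 * C\<^sup>2 * (2 + C\<^sup>2) + 4)"
  have den: "3 * C\<^sup>2 * (2 + C\<^sup>2) + 4 > 0"
    by (intro add_nonneg_pos) auto
  then have \<eta>: "\<eta> > 0" "\<eta> * (3 * C\<^sup>2 * (2 + C\<^sup>2) + 4) = \<epsilon>"
    using \<open>\<epsilon> > 0\<close> by (auto simp: \<eta>_def)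
  obtain p J where pJ:
    "(\<integral>t. (cmod (poly p (circle_of t) - circle_of t ^ J))\<^sup>2 \<partial>\<nu>) < \<eta>"
    "(\<Sum>j\<le>degree p. (cmod (coeff p j))\<^sup>2) < \<eta>"
    using singular_trig_approx[OF \<nu> B \<eta>(1)] by blast
  define c where "c = coeff p"
  define D where "D = J + degree p"
  have c_sum: "(\<Sum>j\<le>D. (cmod (c j))\<^sup>2) < \<eta>"
  proof -
    have "(\<Sum>j\<le>D. (cmod (c j))\<^sup>2) = (\<Sum>j\<le>degree p. (cmod (coeff p j))\<^sup>2)"
      unfolding c_def by (rule sum.mono_neutral_right) (auto simp: D_def coeff_eq_0)
    then show ?thesis using pJ(2) by simp
  qed
  \<comment> \<open>\<open>\<alpha> n\<close> is the error of the approximation, \<open>W n\<close> the combination that replaces \<open>w\<close>.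
    Reversing the order of the shifts in \<open>q\<close> keeps them non-negative.\<close>
  define \<alpha> where "\<alpha> n x = v (n + J) x - (\<Sum>j\<le>D. c j * v (n + j) x)" for n x
  define q where "q j = J + (D - j)" for j
  define W where "W n x = (\<Sum>j\<le>D. c j * w (n + q j) x)" for n x
  have \<alpha>_norm: "(\<integral>x. (cmod (\<alpha> n x))\<^sup>2 \<partial>M) < \<eta>" for n
  proof -
    define b where "b i = (if i = J then 1 else 0) - c i" for i
    have b_sum: "(\<Sum>i\<le>D. b i * y i) = y J - (\<Sum>i\<le>D. c i * y i)" for y :: "nat \<Rightarrow> complex"
    proof -
      have "(\<Sum>i\<le>D. b i * y i) = (\<Sum>i\<le>D. (if i = J then y i else 0)) - (\<Sum>i\<le>D. c i * y i)"
        unfolding sum_subtractf[symmetric] by (intro sum.cong) (auto simp: b_def algebra_simps)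
      then show ?thesis by (simp add: D_def)
    qed
    have \<alpha>_b: "\<alpha> n x = (\<Sum>i\<le>D. b i * v (n + i) x)" for x
      using b_sum[of "\<lambda>i. v (n + i) x"] by (simp add: \<alpha>_def)
    have isom: "(\<integral>x. (cmod (\<alpha> n x))\<^sup>2 \<partial>M) = (\<integral>t. (cmod (\<Sum>i\<le>D. b i * circle_of (real i * t)))\<^sup>2 \<partial>\<nu>)"
      unfolding \<alpha>_b
      by (rule has_spectrum_norm_sum[OF has_spectrum_shift[OF spec]]) (use v_L2 in auto)
    have b_poly: "(\<Sum>i\<le>D. b i * circle_of (real i * t)) = - (poly p (circle_of t) - circle_of t ^ J)" for t
    proof -
      have "(\<Sum>i\<le>D. c i * circle_of (real i * t)) = poly p (circle_of t)"
        unfolding poly_altdef circle_of_power c_def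
        by (rule sum.mono_neutral_right) (auto simp: D_def coeff_eq_0)
      then show ?thesis
        unfolding b_sum by (simp add: circle_of_power)
    qed
    show ?thesis using pJ(1) unfolding isom b_poly norm_minus_cancel by simp
  qed
  \<comment> \<open>\<open>E N\<close> collects the correlations of \<open>w\<close> at nonzero lags.\<close>
  define E where "E N = (\<Sum>i\<le>D. \<Sum>j\<le>D. if i = j then 0 else c i * cnj (c j) *
      ((\<Sum>m=1..N. L2_inner M (w (m + q i)) (w (m + q j))) / of_nat N))" for N
  have "E \<longlonglongrightarrow> (\<Sum>i\<le>D. \<Sum>j\<le>D. 0)"
    unfolding E_def
  proof (intro tendsto_sum)
    fix i j assume "i \<in> {..D}" "j \<in> {..D}"
    then have "q i \<noteq> q j" if "i \<noteq> j" using that by (auto simp: q_def)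
    then show "(\<lambda>N. if i = j then 0 else c i * cnj (c j) *
      ((\<Sum>m=1..N. L2_inner M (w (m + q i)) (w (m + q j))) / of_nat N)) \<longlonglongrightarrow> 0"
      using tendsto_mult_right_zero[OF off, of "q i" "q j"] by (cases "i = j") auto
  qed
  then have "(\<lambda>N. cmod (E N)) \<longlonglongrightarrow> 0"
    by (simp add: tendsto_norm_zero)
  then have ev_E: "eventually (\<lambda>N. cmod (E N) < \<eta>) sequentially"
    using \<eta>(1) by (auto dest: order_tendstoD)
  have W_norm: "(\<Sum>m=1..N. \<integral>x. (cmod (W m x))\<^sup>2 \<partial>M) \<le> real N * (C\<^sup>2 * \<eta> + cmod (E N))" if "N \<ge> 1" for N
  proof -
    define H where "H i j = (\<Sum>m=1..N. L2_inner M (w (m + q i)) (w (m + q j)))" for i j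
    have "complex_of_real (\<Sum>m=1..N. \<integral>x. (cmod (W m x))\<^sup>2 \<partial>M)
        = (\<Sum>m=1..N. \<Sum>i\<le>D. \<Sum>j\<le>D. c i * cnj (c j) * L2_inner M (w (m + q i)) (w (m + q j)))"
      unfolding of_real_sum W_def
      by (intro sum.cong refl norm_sum_eq_Gram) (use w_L2 in auto)
    also have "\<dots> = (\<Sum>i\<le>D. \<Sum>j\<le>D. c i * cnj (c j) * H i j)"
      unfolding H_def sum_distrib_left
      by (rule trans[OF sum.swap]) (intro sum.cong refl sum.swap)
    also have "\<dots> = (\<Sum>i\<le>D. \<Sum>j\<le>D. (if i = j then c i * cnj (c j) * H i j else 0)
        + of_nat N * (if i = j then 0 else c i * cnj (c j) * (H i j / of_nat N)))"
      using that by (intro sum.cong refl) auto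
    also have "\<dots> = (\<Sum>i\<le>D. c i * cnj (c i) * H i i) + of_nat N * E N"
      unfolding sum.distrib E_def H_def[symmetric] sum_distrib_left by (simp add: sum.delta)
    finally have eq: "complex_of_real (\<Sum>m=1..N. \<integral>x. (cmod (W m x))\<^sup>2 \<partial>M)
        = (\<Sum>i\<le>D. c i * cnj (c i) * H i i) + of_nat N * E N" .
    have H_le: "cmod (H i i) \<le> real N * (C * C)" for i
      unfolding H_def 
      using sum_norm_bound[of "{1..N}" "\<lambda>m. L2_inner M (w (m + q i)) (w (m + q i))" "C * C", OF w_inner]
      by simp
    have "cmod (\<Sum>i\<le>D. c i * cnj (c i) * H i i) \<le> (\<Sum>i\<le>D. (cmod (c i))\<^sup>2 * (real N * (C * C)))"
      by (rule sum_norm_le)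
        (use H_le in \<open>auto simp: norm_mult power2_eq_square intro!: mult_left_mono\<close>)
    also have "\<dots> \<le> \<eta> * (real N * (C * C))"
      unfolding sum_distrib_right[symmetric] using c_sum by (intro mult_right_mono) auto
    finally have 1: "cmod (\<Sum>i\<le>D. c i * cnj (c i) * H i i) \<le> \<eta> * (real N * (C * C))" .
    have "\<bar>\<Sum>m=1..N. \<integral>x. (cmod (W m x))\<^sup>2 \<partial>M\<bar> = cmod ((\<Sum>i\<le>D. c i * cnj (c i) * H i i) + of_nat N * E N)"
      unfolding eq[symmetric] norm_of_real ..
    also have "\<dots> \<le> \<eta> * (real N * (C * C)) + real N * cmod (E N)"
      using 1 by (intro norm_triangle_mono) (auto simp: norm_mult)
    finally show ?thesis
      by (simp add: algebra_simps power2_eq_square)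
  qed
  \<comment> \<open>\<open>R\<close> bounds the boundary terms that arise from shifting the summation index.\<close>
  define R where "R = 2 * real J * (C * C) + (\<Sum>j\<le>D. cmod (c j) * (2 * real D * (C * C)))"
  have R: "R \<ge> 0" using C by (auto simp: R_def intro!: add_nonneg_nonneg sum_nonneg)
  have vw: "cmod (v a x * w b x) \<le> C * C" if "x \<in> space M" for a b x
    unfolding norm_mult using v(2) w(2) that C by (intro mult_mono) auto
  have split: "cmod ((\<Sum>n=1..N. v n x * w n x) - (\<Sum>n=1..N. \<alpha> n x * w (n + J) x)
      - (\<Sum>n=1..N. v (n + D) x * W n x)) \<le> R" if x: "x \<in> space M" for N x
  proof -
    define y where "y j n = v (n + j) x * w (n + J) x" for j n
    have 1: "cmod ((\<Sum>n=1..N. v (n + J) x * w (n + J) x) - (\<Sum>n=1..N. v n x * w n x)) \<le> 2 * real J * (C * C)"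
      by (rule norm_sum_shift_le) (rule vw[OF x])
    have 2: "cmod ((\<Sum>n=1..N. y j (n + (D - j))) - (\<Sum>n=1..N. y j n)) \<le> 2 * real D * (C * C)" for j
    proof -
      have "cmod ((\<Sum>n=1..N. y j (n + (D - j))) - (\<Sum>n=1..N. y j n)) \<le> 2 * real (D - j) * (C * C)"
        by (rule norm_sum_shift_le) (simp add: y_def vw[OF x])
      also have "\<dots> \<le> 2 * real D * (C * C)"
        by (intro mult_right_mono) auto
      finally show ?thesis .
    qed
    have "(\<Sum>n=1..N. v (n + D) x * W n x) = (\<Sum>n=1..N. \<Sum>j\<le>D. c j * y j (n + (D - j)))"
      unfolding W_def sum_distrib_left y_def q_def by (intro sum.cong refl) (simp add: ac_simps)
    also have "\<dots> = (\<Sum>j\<le>D. c j * (\<Sum>n=1..N. y j (n + (D - j))))"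
      unfolding sum_distrib_left by (rule sum.swap)
    finally have Weq: "(\<Sum>n=1..N. v (n + D) x * W n x) = (\<Sum>j\<le>D. c j * (\<Sum>n=1..N. y j (n + (D - j))))" .
    have "(\<Sum>n=1..N. \<alpha> n x * w (n + J) x)
        = (\<Sum>n=1..N. v (n + J) x * w (n + J) x) - (\<Sum>n=1..N. \<Sum>j\<le>D. c j * y j n)"
      unfolding sum_subtractf[symmetric] \<alpha>_def y_def
      by (intro sum.cong refl) (simp add: algebra_simps sum_distrib_left)
    also have "(\<Sum>n=1..N. \<Sum>j\<le>D. c j * y j n) = (\<Sum>j\<le>D. c j * (\<Sum>n=1..N. y j n))"
      unfolding sum_distrib_left by (rule sum.swap)
    finally have "(\<Sum>n=1..N. v n x * w n x) - (\<Sum>n=1..N. \<alpha> n x * w (n + J) x)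
      - (\<Sum>n=1..N. v (n + D) x * W n x)
      = - ((\<Sum>n=1..N. v (n + J) x * w (n + J) x) - (\<Sum>n=1..N. v n x * w n x))
        - (\<Sum>j\<le>D. c j * ((\<Sum>n=1..N. y j (n + (D - j))) - (\<Sum>n=1..N. y j n)))"
      unfolding Weq by (simp add: right_diff_distrib sum_subtractf)
    also have "cmod \<dots> \<le> R"
      unfolding R_def
    proof (intro order_trans[OF norm_triangle_ineq4] add_mono)
      show "cmod (\<Sum>j\<le>D. c j * ((\<Sum>n=1..N. y j (n + (D - j))) - (\<Sum>n=1..N. y j n)))
          \<le> (\<Sum>j\<le>D. cmod (c j) * (2 * real D * (C * C)))"
        by (rule sum_norm_le, unfold norm_mult) (intro mult_left_mono 2 norm_ge_zero)
    qed (use 1 in \<open>simp add: norm_minus_commute\<close>)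
    finally show ?thesis .
  qed
  have bdd_int: "integrable M f" if "f \<in> borel_measurable M" "\<And>x. x \<in> space M \<Longrightarrow> \<bar>f x\<bar> \<le> K" for f :: "'a \<Rightarrow> real" and K
    by (rule integrable_const_bound[where B = K]) (use that in \<open>auto simp: AE_I2\<close>)
  have \<alpha>_m [measurable]: "\<alpha> n \<in> borel_measurable M" for n
    unfolding \<alpha>_def by measurable
  have W_m [measurable]: "W n \<in> borel_measurable M" for n
    unfolding W_def by measurable
  have \<alpha>_int: "integrable M (\<lambda>x. (cmod (\<alpha> n x))\<^sup>2)" for n
  proof (rule bdd_int[of _ "(C + (\<Sum>j\<le>D. cmod (c j) * C))\<^sup>2"])
    fix x assume x: "x \<in> space M"
    have "cmod (\<alpha> n x) \<le> C + (\<Sum>j\<le>D. cmod (c j) * C)"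
      unfolding \<alpha>_def using v(2)[OF x]
      by (intro order_trans[OF norm_triangle_ineq4] add_mono sum_norm_le)
        (auto simp: norm_mult intro!: mult_left_mono)
    then show "\<bar>(cmod (\<alpha> n x))\<^sup>2\<bar> \<le> (C + (\<Sum>j\<le>D. cmod (c j) * C))\<^sup>2"
      by (simp add: power_mono)
  qed simp
  have W_int: "integrable M (\<lambda>x. (cmod (W n x))\<^sup>2)" for n
  proof (rule bdd_int[of _ "(\<Sum>j\<le>D. cmod (c j) * C)\<^sup>2"])
    fix x assume x: "x \<in> space M"
    have "cmod (W n x) \<le> (\<Sum>j\<le>D. cmod (c j) * C)"
      unfolding W_def using w(2)[OF x]
      by (intro sum_norm_le) (auto simp: norm_mult intro!: mult_left_mono)
    then show "\<bar>(cmod (W n x))\<^sup>2\<bar> \<le> (\<Sum>j\<le>D. cmod (c j) * C)\<^sup>2"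
      by (simp add: power_mono)
  qed simp
  have bound: "(\<integral>x. (cmod ((\<Sum>n=1..N. v n x * w n x) / of_nat N))\<^sup>2 \<partial>M)
      \<le> 3 * C\<^sup>2 * \<eta> + 3 * C\<^sup>2 * (C\<^sup>2 * \<eta> + cmod (E N)) + 3 * R\<^sup>2 / (real N)\<^sup>2" if N: "N \<ge> 1" for N
  proof -
    have pw: "(cmod (\<Sum>n=1..N. v n x * w n x))\<^sup>2 \<le> 3 * (real N * (C\<^sup>2 * (\<Sum>n=1..N. (cmod (\<alpha> n x))\<^sup>2)))
        + 3 * (real N * (C\<^sup>2 * (\<Sum>n=1..N. (cmod (W n x))\<^sup>2))) + 3 * R\<^sup>2" if x: "x \<in> space M" for x
    proof -
      define a where "a = (\<Sum>n=1..N. \<alpha> n x * w (n + J) x)"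
      define b where "b = (\<Sum>n=1..N. v (n + D) x * W n x)"
      have "(cmod a)\<^sup>2 \<le> real N * (\<Sum>n=1..N. (cmod (\<alpha> n x * w (n + J) x))\<^sup>2)"
        unfolding a_def by (rule cmod_sum_squared_le)
      also have "\<dots> \<le> real N * (\<Sum>n=1..N. C\<^sup>2 * (cmod (\<alpha> n x))\<^sup>2)"
      proof (intro mult_left_mono sum_mono)
        show "(cmod (\<alpha> n x * w (n + J) x))\<^sup>2 \<le> C\<^sup>2 * (cmod (\<alpha> n x))\<^sup>2" for n
          unfolding norm_mult power_mult_distrib mult.commute[of "C\<^sup>2"]
          using w(2)[OF x] by (intro mult_left_mono power_mono) auto
      qed simp
      finally have 1: "(cmod a)\<^sup>2 \<le> real N * (C\<^sup>2 * (\<Sum>n=1..N. (cmod (\<alpha> n x))\<^sup>2))"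
        by (simp add: sum_distrib_left)
      have "(cmod b)\<^sup>2 \<le> real N * (\<Sum>n=1..N. (cmod (v (n + D) x * W n x))\<^sup>2)"
        unfolding b_def by (rule cmod_sum_squared_le)
      also have "\<dots> \<le> real N * (\<Sum>n=1..N. C\<^sup>2 * (cmod (W n x))\<^sup>2)"
      proof (intro mult_left_mono sum_mono)
        show "(cmod (v (n + D) x * W n x))\<^sup>2 \<le> C\<^sup>2 * (cmod (W n x))\<^sup>2" for n
          unfolding norm_mult power_mult_distrib
          using v(2)[OF x] by (intro mult_right_mono power_mono) auto
      qed simp
      finally have 2: "(cmod b)\<^sup>2 \<le> real N * (C\<^sup>2 * (\<Sum>n=1..N. (cmod (W n x))\<^sup>2))"
        by (simp add: sum_distrib_left)
      have 3: "(cmod ((\<Sum>n=1..N. v n x * w n x) - a - b))\<^sup>2 \<le> R\<^sup>2"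
        using split[OF x, of N] by (intro power_mono) (auto simp: a_def b_def)
      have "(\<Sum>n=1..N. v n x * w n x) = a + b + ((\<Sum>n=1..N. v n x * w n x) - a - b)"
        by simp
      then have "(cmod (\<Sum>n=1..N. v n x * w n x))\<^sup>2
          \<le> 3 * (cmod a)\<^sup>2 + 3 * (cmod b)\<^sup>2 + 3 * (cmod ((\<Sum>n=1..N. v n x * w n x) - a - b))\<^sup>2"
        using cmod_add3_squared_le by metis
      with 1 2 3 show ?thesis by linarith
    qed
    have "(\<integral>x. (cmod (\<Sum>n=1..N. v n x * w n x))\<^sup>2 \<partial>M)
        \<le> (\<integral>x. 3 * (real N * (C\<^sup>2 * (\<Sum>n=1..N. (cmod (\<alpha> n x))\<^sup>2)))
        + 3 * (real N * (C\<^sup>2 * (\<Sum>n=1..N. (cmod (W n x))\<^sup>2))) + 3 * R\<^sup>2 \<partial>M)"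
    proof (rule integral_mono)
      show "integrable M (\<lambda>x. (cmod (\<Sum>n=1..N. v n x * w n x))\<^sup>2)"
      proof (rule bdd_int[of _ "(\<Sum>n=1..N. C * C)\<^sup>2"])
        fix x assume "x \<in> space M"
        then have "cmod (\<Sum>n=1..N. v n x * w n x) \<le> (\<Sum>n=1..N. C * C)"
          by (intro sum_norm_le vw)
        then show "\<bar>(cmod (\<Sum>n=1..N. v n x * w n x))\<^sup>2\<bar> \<le> (\<Sum>n=1..N. C * C)\<^sup>2"
          unfolding abs_power2 by (intro power_mono) auto
      qed simp
      show "integrable M (\<lambda>x. 3 * (real N * (C\<^sup>2 * (\<Sum>n=1..N. (cmod (\<alpha> n x))\<^sup>2)))
        + 3 * (real N * (C\<^sup>2 * (\<Sum>n=1..N. (cmod (W n x))\<^sup>2))) + 3 * R\<^sup>2)"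
        using \<alpha>_int W_int by (intro Bochner_Integration.integrable_add integrable_mult_right
            Bochner_Integration.integrable_sum integrable_const)
    qed (rule pw)
    also have "\<dots> = 3 * (real N * (C\<^sup>2 * (\<Sum>n=1..N. \<integral>x. (cmod (\<alpha> n x))\<^sup>2 \<partial>M)))
        + 3 * (real N * (C\<^sup>2 * (\<Sum>n=1..N. \<integral>x. (cmod (W n x))\<^sup>2 \<partial>M))) + 3 * R\<^sup>2"
      using \<alpha>_int W_int by (simp add: prob_space)
    also have "\<dots> \<le> 3 * (real N * (C\<^sup>2 * (real N * \<eta>)))
        + 3 * (real N * (C\<^sup>2 * (real N * (C\<^sup>2 * \<eta> + cmod (E N))))) + 3 * R\<^sup>2"
    proof (intro add_mono mult_left_mono order_refl W_norm[OF N])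
      show "(\<Sum>n=1..N. \<integral>x. (cmod (\<alpha> n x))\<^sup>2 \<partial>M) \<le> real N * \<eta>"
        using sum_bounded_above[of "{1..N}" _ \<eta>] \<alpha>_norm by (simp add: less_imp_le)
    qed auto
    finally have "(\<integral>x. (cmod (\<Sum>n=1..N. v n x * w n x))\<^sup>2 \<partial>M) / (real N)\<^sup>2
        \<le> (3 * (real N * (C\<^sup>2 * (real N * \<eta>)))
        + 3 * (real N * (C\<^sup>2 * (real N * (C\<^sup>2 * \<eta> + cmod (E N))))) + 3 * R\<^sup>2) / (real N)\<^sup>2"
      by (rule divide_right_mono) simp
    also have "\<dots> = 3 * C\<^sup>2 * \<eta> + 3 * C\<^sup>2 * (C\<^sup>2 * \<eta> + cmod (E N)) + 3 * R\<^sup>2 / (real N)\<^sup>2"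
      using N by (simp add: field_simps power2_eq_square)
    finally show ?thesis
      by (simp add: norm_divide power_divide)
  qed
  have "(\<lambda>N. 3 * R\<^sup>2 / (real N)\<^sup>2) \<longlonglongrightarrow> 0"
    by real_asymp
  then have "eventually (\<lambda>N. 3 * R\<^sup>2 / (real N)\<^sup>2 < \<eta>) sequentially"
    using \<eta>(1) by (rule order_tendstoD)
  with ev_E eventually_ge_at_top[of 1]
  show "eventually (\<lambda>N. (\<integral>x. (cmod ((\<Sum>n=1..N. v n x * w n x) / of_nat N))\<^sup>2 \<partial>M) < \<epsilon>) sequentially"
  proof eventually_elim
    case (elim N)
    have "3 * C\<^sup>2 * (C\<^sup>2 * \<eta> + cmod (E N)) \<le> 3 * C\<^sup>2 * (C\<^sup>2 * \<eta> + \<eta>)"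
      using elim by (intro mult_left_mono) auto
    then have "(\<integral>x. (cmod ((\<Sum>n=1..N. v n x * w n x) / of_nat N))\<^sup>2 \<partial>M)
        < 3 * C\<^sup>2 * \<eta> + 3 * C\<^sup>2 * (C\<^sup>2 * \<eta> + \<eta>) + \<eta>"
      using bound[of N] elim by linarith
    also have "\<dots> \<le> \<eta> * (3 * C\<^sup>2 * (2 + C\<^sup>2) + 4)"
      using \<eta>(1) by (simp add: algebra_simps)
    finally show ?case by (simp add: \<eta>(2))
  qed
qed

section \<open>Eigenfunctions and atoms of the spectral measure\<close>

lemma mp_automorphism_measurable: "mp_automorphism M R \<Longrightarrow> R \<in> measurable M M"
  by (simp add: mp_automorphism_def)

lemma mp_automorphism_distr:
  assumes "mp_automorphism M R"
  shows "distr M M R = M"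
proof (rule measure_eqI)
  fix A assume "A \<in> sets (distr M M R)"
  then show "emeasure (distr M M R) A = emeasure M A"
    using assms by (simp add: emeasure_distr mp_automorphism_def)
qed simp

lemma measurable_funpow [measurable]: "R \<in> measurable M M \<Longrightarrow> R ^^ n \<in> measurable M M"
  by (induction n) (auto intro: measurable_comp)

lemma funpow_distr:
  assumes "mp_automorphism M R"
  shows "distr M M (R ^^ n) = M"
proof (induction n)
  case 0
  show ?case by (simp add: id_def)
next
  case (Suc n)
  have [measurable]: "R \<in> measurable M M"
    by (rule mp_automorphism_measurable[OF assms])
  have "distr M M (R ^^ Suc n) = distr (distr M M (R ^^ n)) M R"
    by (subst distr_distr) auto
  then show ?case
    by (simp add: Suc mp_automorphism_distr[OF assms] comp_def)
qed

lemma integral_funpow: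
  fixes h :: "'a \<Rightarrow> 'b::{banach, second_countable_topology}"
  assumes "mp_automorphism M R" "h \<in> borel_measurable M"
  shows "(\<integral>x. h ((R ^^ n) x) \<partial>M) = (\<integral>x. h x \<partial>M)"
  using integral_distr[OF measurable_funpow[OF mp_automorphism_measurable[OF assms(1)]] assms(2)]
  by (simp add: funpow_distr[OF assms(1)])

lemma AE_funpow:
  assumes "mp_automorphism M R" "AE x in M. P x"
  shows "AE x in M. P ((R ^^ n) x)"
proof -
  have m: "R ^^ n \<in> measurable M M"
    by (rule measurable_funpow[OF mp_automorphism_measurable[OF assms(1)]])
  have "AE x in distr M M (R ^^ n). P x"
    unfolding funpow_distr[OF assms(1)] by fact
  then show ?thesis
    by (rule AE_distrD[OF m])
qed

lemma L2_funpow: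
  assumes "mp_automorphism M R" "g \<in> L2 M"
  shows "(\<lambda>x. g ((R ^^ n) x)) \<in> L2 M"
proof -
  have m: "R ^^ n \<in> measurable M M"
    by (rule measurable_funpow[OF mp_automorphism_measurable[OF assms(1)]])
  have "integrable (distr M M (R ^^ n)) (\<lambda>x. (cmod (g x))\<^sup>2)"
    using assms by (simp add: funpow_distr L2_def)
  then have "integrable M (\<lambda>x. (cmod (g ((R ^^ n) x)))\<^sup>2)"
    by (rule integrable_distr[OF m])
  then show ?thesis
    using measurable_compose[OF m L2_measurable[OF assms(2)]] by (simp add: L2_def)
qed

lemma L2_inner_orbit_Suc:
  assumes "mp_automorphism M R" "g \<in> L2 M"
  shows "L2_inner M (\<lambda>x. g ((R ^^ Suc a) x)) (\<lambda>x. g ((R ^^ Suc b) x))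
    = L2_inner M (\<lambda>x. g ((R ^^ a) x)) (\<lambda>x. g ((R ^^ b) x))"
proof -
  note [measurable] = L2_measurable[OF L2_funpow[OF assms]]
  show ?thesis
    unfolding L2_inner_def funpow_Suc_right comp_def
    using integral_funpow[OF assms(1), of "\<lambda>x. g ((R ^^ a) x) * cnj (g ((R ^^ b) x))" 1] by simp
qed

lemma orbit_has_spectrum:
  assumes "mp_automorphism M R" "g \<in> L2 M"
  shows "\<exists>\<nu>. has_spectrum M (\<lambda>n x. g ((R ^^ n) x)) \<nu>"
  by (rule has_spectrum_exists) (use assms L2_funpow L2_inner_orbit_Suc in blast)+

lemma funpow_in_space:
  assumes "mp_automorphism M R" "x \<in> space M"
  shows "(R ^^ n) x \<in> space M"
  using measurable_space[OF measurable_funpow[OF mp_automorphism_measurable[OF assms(1)]] assms(2)] .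

text \<open>The averages of the characters at \<open>s\<close> are normalised Dirichlet kernels; they converge boundedly to
  the indicator function of the integers.\<close>

lemma cesaro_character_bound: "cmod ((\<Sum>n<N. circle_of (real n * s)) / of_nat N) \<le> 1"
proof (cases "N = 0")
  case False
  have "cmod (\<Sum>n<N. circle_of (real n * s)) \<le> real N"
    using sum_norm_bound[of "{..<N}" "\<lambda>n. circle_of (real n * s)" 1] by simp
  then show ?thesis
    using False by (simp add: norm_divide)
qed simp

lemma cesaro_character_tendsto:
  "(\<lambda>N. (\<Sum>n<N. circle_of (real n * s)) / of_nat N) \<longlonglongrightarrow> (if s \<in> \<int> then 1 else 0)"
proof (cases "s \<in> \<int>")
  case True
  then have "circle_of (real n * s) = 1" for n
    by (simp add: circle_of_eq_1_iff)
  then have "eventually (\<lambda>N. (\<Sum>n<N. circle_of (real n * s)) / of_nat N = 1) sequentially"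
    by (intro eventually_mono[OF eventually_gt_at_top[of 0]]) simp
  then show ?thesis
    using True by (simp add: tendsto_eventually)
next
  case False
  define z where "z = circle_of s"
  have z: "z \<noteq> 1"
    using False by (simp add: z_def circle_of_eq_1_iff)
  have bd: "cmod ((\<Sum>n<N. circle_of (real n * s)) / of_nat N) \<le> 2 / cmod (z - 1) / real N" for N
  proof -
    have "(\<Sum>n<N. circle_of (real n * s)) = (z ^ N - 1) / (z - 1)"
      unfolding circle_of_power[symmetric] z_def[symmetric] using z by (rule geometric_sum)
    moreover have "cmod (z ^ N - 1) \<le> 2"
      using norm_triangle_ineq4[of "z ^ N" 1] by (simp add: z_def norm_power)
    ultimately show ?thesis
      by (simp only: norm_divide norm_of_nat) (intro divide_right_mono; simp)
  qed
  have "(\<lambda>N. 2 / cmod (z - 1) / real N) \<longlonglongrightarrow> 0"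
    by real_asymp
  then have "(\<lambda>N. (\<Sum>n<N. circle_of (real n * s)) / of_nat N) \<longlonglongrightarrow> 0"
    by (rule Lim_null_comparison[OF always_eventually[OF allI[OF bd]]])
  then show ?thesis using False by simp
qed

lemma sets_translated_Ints: "{t. t - \<alpha> \<in> \<int>} \<in> sets (borel :: real measure)"
proof -
  have "{t. t - \<alpha> \<in> \<int>} = (\<Union>k::int. {\<alpha> + of_int k})"
    by (auto simp: Ints_def algebra_simps)
  then show ?thesis by simp
qed

text \<open>The twisted averages \<open>A N\<close> form a Cauchy sequence in \<open>L\<^sup>2\<close>, because their images under the
  spectral isometry converge boundedly. Along a fast subsequence they converge almost everywhere,
  and the limit is an eigenfunction; its inner product with \<open>g\<close> is the mass of \<open>\<alpha> + \<int>\<close>.\<close>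

lemma eigenfunction_of_atom:
  fixes g :: "'a \<Rightarrow> complex"
  assumes "prob_space M" "mp_automorphism M R"
    and g: "g \<in> borel_measurable M" "\<And>x. x \<in> space M \<Longrightarrow> cmod (g x) \<le> C"
    and spec: "has_spectrum M (\<lambda>n x. g ((R ^^ n) x)) \<nu>"
  obtains \<phi> where "\<phi> \<in> borel_measurable M" "\<And>x. x \<in> space M \<Longrightarrow> cmod (\<phi> x) \<le> C"
    "\<And>x. x \<in> space M \<Longrightarrow> \<phi> (R x) = circle_of \<alpha> * \<phi> x"
    "L2_inner M \<phi> g = complex_of_real (measure \<nu> {t. t - \<alpha> \<in> \<int>})"
proof -
  interpret prob_space M by fact
  have \<nu>: "finite_measure \<nu>" "sets \<nu> = sets borel"
    using spec by (auto simp: has_spectrum_def)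
  interpret N: finite_measure \<nu> by fact
  note m\<nu> = measurable_cong_sets[OF \<nu>(2) refl]
  note [measurable] = g(1) mp_automorphism_measurable[OF assms(2)]
  have C: "C \<ge> 0"
    using not_empty g(2) norm_ge_zero by (metis all_not_in_conv order_trans)
  have g_L2: "g \<in> L2 M"
    by (rule bounded_in_L2[where C = C]) (use g finite_measure_axioms in \<open>auto simp: AE_I2\<close>)
  define a where "a n x = circle_of (- (real n * \<alpha>)) * g ((R ^^ n) x)" for n x
  define A where "A N x = (\<Sum>n<N. a n x) / of_nat N" for N x
  define Dk where "Dk N t = (\<Sum>n<N. circle_of (real n * (t - \<alpha>))) / of_nat N" for N t
  define I :: "real \<Rightarrow> complex" where "I t = (if t - \<alpha> \<in> \<int> then 1 else 0)" for t
  have a_le: "cmod (a n x) \<le> C" if "x \<in> space M" for n x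
    using g(2)[OF funpow_in_space[OF assms(2) that]] by (simp add: a_def norm_mult)
  have A_le: "cmod (A N x) \<le> C" if "x \<in> space M" for N x
  proof (cases "N = 0")
    case False
    have "cmod (\<Sum>n<N. a n x) \<le> real N * C"
      using sum_norm_bound[of "{..<N}" "\<lambda>n. a n x" C] a_le[OF that] by simp
    then show ?thesis
      using False by (simp add: A_def norm_divide field_simps)
  qed (simp add: A_def C)
  have a_m [measurable]: "a n \<in> borel_measurable M" for n
    unfolding a_def by measurable
  have A_m [measurable]: "A N \<in> borel_measurable M" for N
    unfolding A_def by measurable
  have Dk_m: "Dk N \<in> borel_measurable \<nu>" for N
    unfolding m\<nu> Dk_def by measurable
  have I_eq: "I = indicator {t. t - \<alpha> \<in> \<int>}"
    by (auto simp: I_def indicator_def)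
  have I_m: "I \<in> borel_measurable \<nu>"
    unfolding m\<nu> I_eq using sets_translated_Ints by (rule borel_measurable_indicator)
  have Dk_lim: "(\<lambda>N. Dk N t) \<longlonglongrightarrow> I t" for t
    unfolding Dk_def I_def by (rule cesaro_character_tendsto)
  have Dk_le: "cmod (Dk N t) \<le> 1" for N t
    unfolding Dk_def by (rule cesaro_character_bound)
  have I_le: "cmod (I t) \<le> 1" for t by (simp add: I_def)
  have DI_le: "(cmod (Dk N t - I t))\<^sup>2 \<le> 4" for N t
  proof -
    have "cmod (Dk N t - I t) \<le> 2"
      using norm_triangle_ineq4[of "Dk N t" "I t"] Dk_le[of N t] I_le[of t] by linarith
    then have "(cmod (Dk N t - I t))\<^sup>2 \<le> 2\<^sup>2"
      by (intro power_mono) auto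
    then show ?thesis by simp
  qed
  have DI_lim: "(\<lambda>N. \<integral>t. (cmod (Dk N t - I t))\<^sup>2 \<partial>\<nu>) \<longlonglongrightarrow> (\<integral>t. 0 \<partial>\<nu>)"
  proof (rule integral_dominated_convergence[where w = "\<lambda>_. 4"])
    show "AE t in \<nu>. (\<lambda>N. (cmod (Dk N t - I t))\<^sup>2) \<longlonglongrightarrow> 0"
      using Dk_lim by (auto intro!: AE_I2 tendsto_eq_intros simp: tendsto_norm_zero_iff Lim_null[symmetric])
  qed (use Dk_m I_m DI_le in auto)
  have DI_int: "integrable \<nu> (\<lambda>t. (cmod (Dk N t - I t))\<^sup>2)" for N
    by (rule N.integrable_const_bound[where B = 4]) (use Dk_m I_m DI_le in auto)
  have isom: "(\<integral>x. (cmod (A N x - A L x))\<^sup>2 \<partial>M) = (\<integral>t. (cmod (Dk N t - Dk L t))\<^sup>2 \<partial>\<nu>)" for N L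
  proof -
    define b :: "nat \<Rightarrow> complex" where "b n = circle_of (- (real n * \<alpha>)) *
      ((if n < N then 1 / of_nat N else 0) - (if n < L then 1 / of_nat L else 0))" for n
    have b_sum: "(\<Sum>n<N + L. b n * y n) = (\<Sum>n<N. circle_of (- (real n * \<alpha>)) * y n) / of_nat N
        - (\<Sum>n<L. circle_of (- (real n * \<alpha>)) * y n) / of_nat L" for y
    proof -
      have *: "(\<Sum>n<K. circle_of (- (real n * \<alpha>)) * y n) / of_nat K
          = (\<Sum>n<N + L. circle_of (- (real n * \<alpha>)) * y n * (if n < K then 1 / of_nat K else 0))"
        if "K \<le> N + L" for K
        unfolding sum_divide_distrib using that by (intro sum.mono_neutral_cong_left) auto
      show ?thesis
        unfolding *[of N, simplified] *[of L, simplified] sum_subtractf[symmetric] b_def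
        by (intro sum.cong) (auto simp: algebra_simps)
    qed
    have "A N x - A L x = (\<Sum>n<N + L. b n * g ((R ^^ n) x))" for x
      unfolding b_sum A_def a_def ..
    moreover have "Dk N t - Dk L t = (\<Sum>n<N + L. b n * circle_of (real n * t))" for t
      unfolding b_sum Dk_def circle_of_add[symmetric] by (simp add: algebra_simps)
    ultimately show ?thesis
      using has_spectrum_norm_sum[OF spec, of "{..<N + L}" b] L2_funpow[OF assms(2) g_L2] by simp
  qed
  have "\<exists>K. \<forall>N\<ge>K. \<forall>L\<ge>K. (\<integral>x. (cmod (A N x - A L x))\<^sup>2 \<partial>M) \<le> ((1/2) ^ j)\<^sup>2" for j
  proof -
    have "((1/2) ^ j)\<^sup>2 / 4 > (0::real)" by simp
    then have "eventually (\<lambda>N. (\<integral>t. (cmod (Dk N t - I t))\<^sup>2 \<partial>\<nu>) < ((1/2) ^ j)\<^sup>2 / 4) sequentially"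
      by (intro order_tendstoD(2)[OF DI_lim]) simp
    then obtain K where K: "\<And>N. N \<ge> K \<Longrightarrow> (\<integral>t. (cmod (Dk N t - I t))\<^sup>2 \<partial>\<nu>) < ((1/2) ^ j)\<^sup>2 / 4"
      by (auto simp: eventually_sequentially)
    have "(\<integral>x. (cmod (A N x - A L x))\<^sup>2 \<partial>M) \<le> ((1/2) ^ j)\<^sup>2" if "N \<ge> K" "L \<ge> K" for N L
    proof -
      have pw: "(cmod (Dk N t - Dk L t))\<^sup>2 \<le> 2 * (cmod (Dk N t - I t))\<^sup>2 + 2 * (cmod (Dk L t - I t))\<^sup>2" for t
      proof -
        have "cmod (Dk N t - Dk L t) \<le> cmod (Dk N t - I t) + cmod (Dk L t - I t)"
          using norm_triangle_ineq4[of "Dk N t - I t" "Dk L t - I t"] by simp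
        then have "(cmod (Dk N t - Dk L t))\<^sup>2 \<le> (cmod (Dk N t - I t) + cmod (Dk L t - I t))\<^sup>2"
          by (intro power_mono) auto
        then show ?thesis
          using sum_squares_bound[of "cmod (Dk N t - I t)" "cmod (Dk L t - I t)"]
          by (simp add: power2_sum)
      qed
      have "(\<integral>t. (cmod (Dk N t - Dk L t))\<^sup>2 \<partial>\<nu>)
          \<le> (\<integral>t. 2 * (cmod (Dk N t - I t))\<^sup>2 + 2 * (cmod (Dk L t - I t))\<^sup>2 \<partial>\<nu>)"
      proof (rule integral_mono)
        show i: "integrable \<nu> (\<lambda>t. 2 * (cmod (Dk N t - I t))\<^sup>2 + 2 * (cmod (Dk L t - I t))\<^sup>2)"
          using DI_int by simp
        show "integrable \<nu> (\<lambda>t. (cmod (Dk N t - Dk L t))\<^sup>2)"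
          by (rule Bochner_Integration.integrable_bound[OF i]) (use pw Dk_m in auto)
      qed (rule pw)
      also have "\<dots> = 2 * (\<integral>t. (cmod (Dk N t - I t))\<^sup>2 \<partial>\<nu>) + 2 * (\<integral>t. (cmod (Dk L t - I t))\<^sup>2 \<partial>\<nu>)"
        using DI_int by simp
      also have "\<dots> \<le> ((1/2) ^ j)\<^sup>2"
        using K[OF that(1)] K[OF that(2)] by linarith
      finally show ?thesis unfolding isom .
    qed
    then show ?thesis by blast
  qed
  then obtain K where K: "\<And>j N L. N \<ge> K j \<Longrightarrow> L \<ge> K j \<Longrightarrow>
      (\<integral>x. (cmod (A N x - A L x))\<^sup>2 \<partial>M) \<le> ((1/2) ^ j)\<^sup>2"
    by metis
  \<comment> \<open>Summing the \<open>K i\<close> makes \<open>r\<close> monotone; adding \<open>j\<close> makes it unbounded.\<close>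
  define r where "r j = (\<Sum>i\<le>j. K i) + j" for j
  have r_ge: "K j \<le> r j" "r j \<le> r (Suc j)" for j
    by (auto simp: r_def member_le_sum intro: trans_le_add1)
  have r_at_top: "filterlim r at_top sequentially"
    by (rule filterlim_at_top_mono[OF filterlim_ident]) (simp add: r_def)
  have L1: "(\<integral>x. cmod (A (r (Suc j)) x - A (r j) x) \<partial>M) \<le> (1/2) ^ j" for j
  proof -
    \<comment> \<open>A bound for the mean from one for the mean square, through \<open>2 \<delta> F \<le> \<delta>\<^sup>2 + F\<^sup>2\<close>.\<close>
    define \<delta> :: real where "\<delta> = (1/2) ^ j"
    define F where "F x = cmod (A (r (Suc j)) x - A (r j) x)" for x
    have \<delta>: "\<delta> > 0" by (simp add: \<delta>_def)
    have [measurable]: "F \<in> borel_measurable M" unfolding F_def by measurable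
    have F_le: "F x \<le> 2 * C" if "x \<in> space M" for x
      unfolding F_def using norm_triangle_ineq4[of "A (r (Suc j)) x" "A (r j) x"] A_le[OF that, of "r j"]
        A_le[OF that, of "r (Suc j)"] by linarith
    have F0: "F x \<ge> 0" for x by (simp add: F_def)
    have i1: "integrable M F"
      by (rule integrable_const_bound[where B = "2 * C"]) (use F_le F0 in \<open>auto simp: AE_I2\<close>)
    have i2: "integrable M (\<lambda>x. (F x)\<^sup>2)"
    proof (rule integrable_const_bound[where B = "(2 * C)\<^sup>2"])
      show "AE x in M. norm ((F x)\<^sup>2) \<le> (2 * C)\<^sup>2"
        unfolding real_norm_def abs_power2 by (intro AE_I2 power_mono F_le F0)
    qed simp
    have "F x \<le> \<delta> / 2 + (F x)\<^sup>2 / (2 * \<delta>)" for x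
    proof -
      have "2 * \<delta> * F x \<le> \<delta>\<^sup>2 + (F x)\<^sup>2"
        using sum_squares_bound[of \<delta> "F x"] by simp
      then show ?thesis using \<delta> by (simp add: field_simps power2_eq_square)
    qed
    then have "(\<integral>x. F x \<partial>M) \<le> (\<integral>x. \<delta> / 2 + (F x)\<^sup>2 / (2 * \<delta>) \<partial>M)"
      by (intro integral_mono) (use i1 i2 in auto)
    also have "\<dots> = \<delta> / 2 + (\<integral>x. (F x)\<^sup>2 \<partial>M) / (2 * \<delta>)"
      using i2 by (simp add: prob_space)
    also have "(\<integral>x. (F x)\<^sup>2 \<partial>M) \<le> \<delta>\<^sup>2"
      unfolding F_def \<delta>_def by (rule K) (use r_ge[of j] in auto)
    then have "\<delta> / 2 + (\<integral>x. (F x)\<^sup>2 \<partial>M) / (2 * \<delta>) \<le> \<delta> / 2 + \<delta>\<^sup>2 / (2 * \<delta>)"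
      using \<delta> by (intro add_left_mono divide_right_mono) auto
    also have "\<dots> = \<delta>"
      using \<delta> by (simp add: power2_eq_square)
    finally show ?thesis by (simp add: F_def \<delta>_def)
  qed
  have AE_conv: "AE x in M. convergent (\<lambda>j. A (r j) x)"
  proof -
    have "(\<integral>\<^sup>+x. (\<Sum>j. ennreal (cmod (A (r (Suc j)) x - A (r j) x))) \<partial>M)
        = (\<Sum>j. \<integral>\<^sup>+x. ennreal (cmod (A (r (Suc j)) x - A (r j) x)) \<partial>M)"
      by (rule nn_integral_suminf) measurable
    also have "\<dots> \<le> (\<Sum>j. ennreal ((1/2) ^ j))"
    proof (rule suminf_le)
      fix j
      have "(\<integral>\<^sup>+x. ennreal (cmod (A (r (Suc j)) x - A (r j) x)) \<partial>M)
          = ennreal (\<integral>x. cmod (A (r (Suc j)) x - A (r j) x) \<partial>M)"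
      proof (rule nn_integral_eq_integral)
        show "integrable M (\<lambda>x. cmod (A (r (Suc j)) x - A (r j) x))"
        proof (rule integrable_const_bound[where B = "C + C"])
          show "AE x in M. norm (cmod (A (r (Suc j)) x - A (r j) x)) \<le> C + C"
            unfolding real_norm_def abs_norm_cancel
            by (intro AE_I2 order_trans[OF norm_triangle_ineq4] add_mono A_le)
        qed measurable
      qed simp
      then show "(\<integral>\<^sup>+x. ennreal (cmod (A (r (Suc j)) x - A (r j) x)) \<partial>M) \<le> ennreal ((1/2) ^ j)"
        using L1[of j] by (simp add: ennreal_leI)
    qed auto
    also have "\<dots> = ennreal (\<Sum>j. (1/2) ^ j)"
      by (rule suminf_ennreal2) (auto intro: summable_geometric)
    also have "\<dots> < \<infinity>" by simp
    finally have "(\<integral>\<^sup>+x. (\<Sum>j. ennreal (cmod (A (r (Suc j)) x - A (r j) x))) \<partial>M) \<noteq> \<infinity>"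
      by simp
    then have "AE x in M. (\<Sum>j. ennreal (cmod (A (r (Suc j)) x - A (r j) x))) \<noteq> \<infinity>"
      by (intro nn_integral_noteq_infinite) measurable
    then show ?thesis
    proof eventually_elim
      case (elim x)
      then have "summable (\<lambda>j. cmod (A (r (Suc j)) x - A (r j) x))"
        by (intro summable_suminf_not_top) auto
      then have "summable (\<lambda>j. A (r (Suc j)) x - A (r j) x)"
        by (rule summable_norm_cancel)
      then have "convergent (\<lambda>n. (\<Sum>j<n. A (r (Suc j)) x - A (r j) x) + A (r 0) x)"
        unfolding summable_iff_convergent by (intro convergent_add convergent_const)
      then show ?case
        by (subst (asm) sum_lessThan_telescope) simp
    qed
  qed
  \<comment> \<open>The set of convergence is invariant under \<open>R\<close>, so with the value \<open>0\<close> off this set the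
    eigenvalue equation holds everywhere.\<close>
  define \<phi> where "\<phi> x = (if convergent (\<lambda>j. A (r j) x) then lim (\<lambda>j. A (r j) x) else 0)" for x
  have \<phi>_lim: "(\<lambda>j. A (r j) x) \<longlonglongrightarrow> \<phi> x" if "convergent (\<lambda>j. A (r j) x)" for x
    using that by (simp add: \<phi>_def convergent_LIMSEQ_iff)
  have \<phi>_m [measurable]: "\<phi> \<in> borel_measurable M"
    unfolding \<phi>_def Cauchy_convergent_iff[symmetric] by measurable
  have \<phi>_le: "cmod (\<phi> x) \<le> C" if x: "x \<in> space M" for x
  proof (cases "convergent (\<lambda>j. A (r j) x)")
    case True
    show ?thesis
      by (rule LIMSEQ_le_const2[OF tendsto_norm[OF \<phi>_lim[OF True]]]) (use A_le[OF x] in auto)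
  qed (simp add: \<phi>_def C)
  have \<phi>_eigen: "\<phi> (R x) = circle_of \<alpha> * \<phi> x" if x: "x \<in> space M" for x
  proof -
    have step: "A N (R x) = circle_of \<alpha> * A N x + circle_of \<alpha> * (a N x - a 0 x) / of_nat N" for N
    proof -
      have "a n (R x) = circle_of \<alpha> * a (Suc n) x" for n
      proof -
        have "circle_of (- (real n * \<alpha>)) = circle_of \<alpha> * circle_of (- (real (Suc n) * \<alpha>))"
          unfolding circle_of_add[symmetric] by (simp add: algebra_simps)
        then show ?thesis
          unfolding a_def funpow_Suc_right comp_def by simp
      qed
      then have "(\<Sum>n<N. a n (R x)) = circle_of \<alpha> * (\<Sum>n<N. a (Suc n) x)"
        by (simp add: sum_distrib_left)
      also have "(\<Sum>n<N. a (Suc n) x) = (\<Sum>n<N. a n x) + (a N x - a 0 x)"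
        by (induction N) simp_all
      finally have s: "(\<Sum>n<N. a n (R x)) = circle_of \<alpha> * ((\<Sum>n<N. a n x) + (a N x - a 0 x))" .
      show ?thesis
        unfolding A_def s by (simp add: ring_distribs add_divide_distrib)
    qed
    have "(\<lambda>N. circle_of \<alpha> * (a N x - a 0 x) / of_nat N) \<longlonglongrightarrow> 0"
    proof (rule Lim_null_comparison[OF always_eventually])
      show "\<forall>N. norm (circle_of \<alpha> * (a N x - a 0 x) / of_nat N) \<le> (C + C) / real N"
        unfolding norm_divide norm_mult norm_of_nat norm_circle_of mult_1
        by (intro allI divide_right_mono order_trans[OF norm_triangle_ineq4] add_mono a_le[OF x]) simp
      show "(\<lambda>N. (C + C) / real N) \<longlonglongrightarrow> 0" by real_asymp
    qed
    then have err: "(\<lambda>j. circle_of \<alpha> * (a (r j) x - a 0 x) / of_nat (r j)) \<longlonglongrightarrow> 0"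
      using filterlim_compose[OF _ r_at_top] by blast
    have fwd: "(\<lambda>j. A (r j) (R x)) \<longlonglongrightarrow> circle_of \<alpha> * L" if "(\<lambda>j. A (r j) x) \<longlonglongrightarrow> L" for L
      unfolding step using tendsto_add[OF tendsto_mult_left[OF that, of "circle_of \<alpha>"] err] by simp
    have bwd: "convergent (\<lambda>j. A (r j) x)" if cR: "convergent (\<lambda>j. A (r j) (R x))"
    proof -
      obtain L where "(\<lambda>j. A (r j) (R x)) \<longlonglongrightarrow> L"
        using cR by (auto simp: convergent_def)
      from tendsto_mult_left[OF tendsto_diff[OF this err], of "circle_of (- \<alpha>)"]
      have "(\<lambda>j. circle_of (- \<alpha>) * (circle_of \<alpha> * A (r j) x)) \<longlonglongrightarrow> circle_of (- \<alpha>) * (L - 0)"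
        unfolding step by simp
      moreover have "circle_of (- \<alpha>) * (circle_of \<alpha> * z) = z" for z
        unfolding mult.assoc[symmetric] circle_of_add[symmetric] by simp
      ultimately show ?thesis
        by (auto simp: convergent_def)
    qed
    show ?thesis
    proof (cases "convergent (\<lambda>j. A (r j) x)")
      case True
      from fwd[OF \<phi>_lim[OF True]] have l: "(\<lambda>j. A (r j) (R x)) \<longlonglongrightarrow> circle_of \<alpha> * \<phi> x" .
      then have "convergent (\<lambda>j. A (r j) (R x))" by (auto simp: convergent_def)
      from LIMSEQ_unique[OF \<phi>_lim[OF this] l] show ?thesis .
    next
      case False
      then show ?thesis using bwd by (auto simp: \<phi>_def)
    qed
  qed
  have "(\<lambda>j. L2_inner M (A (r j)) g) \<longlonglongrightarrow> L2_inner M \<phi> g"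
    unfolding L2_inner_def
  proof (rule integral_dominated_convergence[where w = "\<lambda>_. C * C"])
    show "AE x in M. (\<lambda>j. A (r j) x * cnj (g x)) \<longlonglongrightarrow> \<phi> x * cnj (g x)"
      using AE_conv by eventually_elim (intro tendsto_mult_right \<phi>_lim)
    show "AE x in M. norm (A (r j) x * cnj (g x)) \<le> C * C" for j
      using A_le g(2) C by (auto intro!: AE_I2 mult_mono simp: norm_mult)
  qed auto
  moreover have "L2_inner M (A N) g = (\<integral>t. Dk N t \<partial>\<nu>)" for N
  proof -
    have 1: "L2_inner M (\<lambda>x. g ((R ^^ n) x)) g = (\<integral>t. circle_of (real n * t) \<partial>\<nu>)" for n
    proof -
      have "L2_inner M (\<lambda>x. g ((R ^^ n) x)) (\<lambda>x. g ((R ^^ 0) x))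
        = L2_inner \<nu> (\<lambda>t. circle_of (real n * t)) (\<lambda>t. circle_of (real 0 * t))"
        using spec unfolding has_spectrum_def by blast
      then show ?thesis by (simp add: L2_inner_def)
    qed
    have "L2_inner M (A N) g
        = (\<integral>x. (\<Sum>n<N. circle_of (- (real n * \<alpha>)) * (g ((R ^^ n) x) * cnj (g x))) / of_nat N \<partial>M)"
      by (simp add: L2_inner_def A_def a_def sum_distrib_right mult.assoc)
    also have "\<dots> = (\<Sum>n<N. circle_of (- (real n * \<alpha>)) * L2_inner M (\<lambda>x. g ((R ^^ n) x)) g) / of_nat N"
      using L2_mult_cnj_integrable[OF L2_funpow[OF assms(2) g_L2] g_L2]
      by (simp add: L2_inner_def)
    also have "\<dots> = (\<Sum>n<N. circle_of (- (real n * \<alpha>)) * (\<integral>t. circle_of (real n * t) \<partial>\<nu>)) / of_nat N"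
      by (simp only: 1)
    also have "\<dots> = (\<integral>t. (\<Sum>n<N. circle_of (- (real n * \<alpha>)) * circle_of (real n * t)) / of_nat N \<partial>\<nu>)"
    proof -
      have "integrable \<nu> (\<lambda>t. circle_of (real n * t))" for n
        by (rule N.integrable_const_bound[where B = 1])
          (use L2_measurable[OF character_in_L2[OF \<nu>]] in auto)
      then show ?thesis by simp
    qed
    also have "\<dots> = (\<integral>t. Dk N t \<partial>\<nu>)"
      unfolding Dk_def circle_of_add[symmetric] by (simp add: algebra_simps)
    finally show ?thesis .
  qed
  moreover have "(\<lambda>j. \<integral>t. Dk (r j) t \<partial>\<nu>) \<longlonglongrightarrow> (\<integral>t. I t \<partial>\<nu>)"
  proof (rule integral_dominated_convergence[where w = "\<lambda>_. 1"])
    show "AE t in \<nu>. (\<lambda>j. Dk (r j) t) \<longlonglongrightarrow> I t"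
      using filterlim_compose[OF Dk_lim r_at_top] by simp
  qed (use Dk_m I_m Dk_le in auto)
  ultimately have "L2_inner M \<phi> g = (\<integral>t. I t \<partial>\<nu>)"
    using LIMSEQ_unique by simp
  also have "\<dots> = complex_of_real (measure \<nu> {t. t - \<alpha> \<in> \<int>})"
  proof -
    have "I t = complex_of_real (indicator {t. t - \<alpha> \<in> \<int>} t)" for t
      by (simp add: I_def)
    then show ?thesis
      by (simp add: sets_eq_imp_space_eq[OF \<nu>(2)])
  qed
  finally show ?thesis
    using that \<phi>_m \<phi>_le \<phi>_eigen by blast
qed

section \<open>Correlations along a sequence of times\<close>

lemma atom_null:
  assumes "prob_space M" "mp_automorphism M R"
    and g: "g \<in> borel_measurable M" "\<And>x. x \<in> space M \<Longrightarrow> cmod (g x) \<le> C"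
    and spec: "has_spectrum M (\<lambda>n x. g ((R ^^ n) x)) \<nu>"
    and orth: "\<And>\<phi>. \<phi> \<in> borel_measurable M \<Longrightarrow> (\<And>x. x \<in> space M \<Longrightarrow> cmod (\<phi> x) \<le> C) \<Longrightarrow>
      (\<And>x. x \<in> space M \<Longrightarrow> \<phi> (R x) = circle_of \<alpha> * \<phi> x) \<Longrightarrow> L2_inner M \<phi> g = 0"
  shows "{t. t - \<alpha> \<in> \<int>} \<in> null_sets \<nu>"
proof -
  obtain \<phi> where \<phi>: "\<phi> \<in> borel_measurable M" "\<And>x. x \<in> space M \<Longrightarrow> cmod (\<phi> x) \<le> C"
    "\<And>x. x \<in> space M \<Longrightarrow> \<phi> (R x) = circle_of \<alpha> * \<phi> x"
    "L2_inner M \<phi> g = complex_of_real (measure \<nu> {t. t - \<alpha> \<in> \<int>})"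
    using eigenfunction_of_atom[OF assms(1,2) g spec, of \<alpha>] by blast
  have "measure \<nu> {t. t - \<alpha> \<in> \<int>} = 0"
    using orth[OF \<phi>(1-3)] \<phi>(4) by simp
  moreover have "finite_measure \<nu>" "sets \<nu> = sets borel"
    using spec by (auto simp: has_spectrum_def)
  ultimately show ?thesis
    using sets_translated_Ints by (simp add: null_sets_def finite_measure.emeasure_eq_measure)
qed

text \<open>The average of the correlations is the integral, against the spectral measure of \<open>g\<close>, of the
  averages of the characters with frequencies \<open>k (n + h) - k n\<close>. These vanish in the limit off \<open>Z\<close>,
  and \<open>Z\<close> is a null set because \<open>g\<close> is orthogonal to the corresponding eigenfunctions.\<close>

lemma orbit_uncorrelated:
  fixes k :: "nat \<Rightarrow> nat"
  assumes "prob_space M" "mp_automorphism M R"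
    and g: "g \<in> borel_measurable M" "\<And>x. x \<in> space M \<Longrightarrow> cmod (g x) \<le> C"
    and Z: "countable Z"
    and avg: "\<And>t. t \<notin> Z \<Longrightarrow>
      (\<lambda>N. (\<Sum>n=1..N. circle_of ((real (k (n + h)) - real (k n)) * t)) / of_nat N) \<longlonglongrightarrow> 0"
    and orth: "\<And>\<alpha> \<phi>. \<alpha> \<in> Z \<Longrightarrow> \<phi> \<in> borel_measurable M \<Longrightarrow> (\<And>x. x \<in> space M \<Longrightarrow> cmod (\<phi> x) \<le> C) \<Longrightarrow>
      (\<And>x. x \<in> space M \<Longrightarrow> \<phi> (R x) = circle_of \<alpha> * \<phi> x) \<Longrightarrow> L2_inner M \<phi> g = 0"
  shows "(\<lambda>N. (\<Sum>n=1..N. L2_inner M (\<lambda>x. g ((R ^^ k (n + h)) x)) (\<lambda>x. g ((R ^^ k n) x))) / of_nat N) \<longlonglongrightarrow> 0"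
proof -
  interpret prob_space M by fact
  have g_L2: "g \<in> L2 M"
    by (rule bounded_in_L2[where C = C]) (use g finite_measure_axioms in \<open>auto simp: AE_I2\<close>)
  obtain \<nu> where spec: "has_spectrum M (\<lambda>n x. g ((R ^^ n) x)) \<nu>"
    using orbit_has_spectrum[OF assms(2) g_L2] by blast
  then have \<nu>: "finite_measure \<nu>" "sets \<nu> = sets borel"
    by (auto simp: has_spectrum_def)
  interpret N: finite_measure \<nu> by fact
  note m\<nu> = measurable_cong_sets[OF \<nu>(2) refl]
  have "{\<alpha>} \<in> null_sets \<nu>" if "\<alpha> \<in> Z" for \<alpha>
    by (rule null_sets_subset[OF atom_null[OF assms(1,2) g spec orth[OF that]]]) (use \<nu> in auto)
  then have "(\<Union>\<alpha>\<in>Z. {\<alpha>}) \<in> null_sets \<nu>"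
    using Z by (intro null_sets_UN')
  then have AE_Z: "AE t in \<nu>. t \<notin> Z"
    by (intro AE_not_in) simp
  define D where "D N t = (\<Sum>n=1..N. circle_of ((real (k (n + h)) - real (k n)) * t)) / of_nat N" for N t
  have int: "integrable \<nu> (\<lambda>t. circle_of (c * t))" for c
    by (rule N.integrable_const_bound[where B = 1])
      (use L2_measurable[OF character_in_L2[OF \<nu>]] in auto)
  have D_m: "D N \<in> borel_measurable \<nu>" for N
    unfolding m\<nu> D_def by measurable
  have D_le: "cmod (D N t) \<le> 1" for N t
  proof (cases "N = 0")
    case False
    have "cmod (\<Sum>n=1..N. circle_of ((real (k (n + h)) - real (k n)) * t)) \<le> real N"
      using sum_norm_bound[of "{1..N}" "\<lambda>n. circle_of ((real (k (n + h)) - real (k n)) * t)" 1] by simp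
    then show ?thesis
      using False by (simp add: D_def norm_divide)
  qed (simp add: D_def)
  have "(\<lambda>N. \<integral>t. D N t \<partial>\<nu>) \<longlonglongrightarrow> (\<integral>t. 0 \<partial>\<nu>)"
  proof (rule integral_dominated_convergence[where w = "\<lambda>_. 1"])
    show "AE t in \<nu>. (\<lambda>N. D N t) \<longlonglongrightarrow> 0"
      using AE_Z by eventually_elim (unfold D_def, rule avg)
  qed (use D_m D_le in auto)
  moreover have "(\<integral>t. D N t \<partial>\<nu>)
      = (\<Sum>n=1..N. L2_inner M (\<lambda>x. g ((R ^^ k (n + h)) x)) (\<lambda>x. g ((R ^^ k n) x))) / of_nat N" for N
  proof -
    have "L2_inner M (\<lambda>x. g ((R ^^ k (n + h)) x)) (\<lambda>x. g ((R ^^ k n) x))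
        = (\<integral>t. circle_of ((real (k (n + h)) - real (k n)) * t) \<partial>\<nu>)" for n
      using spec unfolding has_spectrum_def L2_inner_characters by blast
    then show ?thesis
      unfolding D_def using int by simp
  qed
  ultimately show ?thesis by simp
qed

text \<open>The mean ergodic theorem for functions that are orthogonal to the invariant ones.\<close>

lemma mean_ergodic_0:
  assumes "prob_space M" "mp_automorphism M R"
    and g: "g \<in> borel_measurable M" "\<And>x. x \<in> space M \<Longrightarrow> cmod (g x) \<le> C"
    and orth: "\<And>\<phi>. \<phi> \<in> borel_measurable M \<Longrightarrow> (\<And>x. x \<in> space M \<Longrightarrow> cmod (\<phi> x) \<le> C) \<Longrightarrow>
      (\<And>x. x \<in> space M \<Longrightarrow> \<phi> (R x) = \<phi> x) \<Longrightarrow> L2_inner M \<phi> g = 0"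
  shows "(\<lambda>N. \<integral>x. (cmod ((\<Sum>n=1..N. g ((R ^^ n) x)) / of_nat N))\<^sup>2 \<partial>M) \<longlonglongrightarrow> 0"
proof -
  interpret prob_space M by fact
  have g_L2: "g \<in> L2 M"
    by (rule bounded_in_L2[where C = C]) (use g finite_measure_axioms in \<open>auto simp: AE_I2\<close>)
  obtain \<nu> where spec: "has_spectrum M (\<lambda>n x. g ((R ^^ n) x)) \<nu>"
    using orbit_has_spectrum[OF assms(2) g_L2] by blast
  then have \<nu>: "finite_measure \<nu>" "sets \<nu> = sets borel"
    by (auto simp: has_spectrum_def)
  interpret N: finite_measure \<nu> by fact
  note m\<nu> = measurable_cong_sets[OF \<nu>(2) refl]
  have "{t. t - 0 \<in> \<int>} \<in> null_sets \<nu>"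
    by (rule atom_null[OF assms(1,2) g spec]) (use orth in simp_all)
  then have AE_Z: "AE t in \<nu>. t \<notin> \<int>"
    by (auto dest: AE_not_in)
  define D where "D N t = (\<Sum>n<N. circle_of (real n * t)) / of_nat N" for N t
  have D_m: "D N \<in> borel_measurable \<nu>" for N
    unfolding m\<nu> D_def by measurable
  have D_le: "cmod (D N t) \<le> 1" for N t
    unfolding D_def by (rule cesaro_character_bound)
  have eq: "(\<integral>x. (cmod ((\<Sum>n=1..N. g ((R ^^ n) x)) / of_nat N))\<^sup>2 \<partial>M) = (\<integral>t. (cmod (D N t))\<^sup>2 \<partial>\<nu>)" for N
  proof -
    have "(\<integral>x. (cmod ((\<Sum>n=1..N. g ((R ^^ n) x)) / of_nat N))\<^sup>2 \<partial>M)
        = (\<integral>x. (cmod (\<Sum>n=1..N. (1 / of_nat N) * g ((R ^^ n) x)))\<^sup>2 \<partial>M)"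
      unfolding sum_distrib_left[symmetric] by simp
    also have "\<dots> = (\<integral>t. (cmod (\<Sum>n=1..N. (1 / of_nat N) * circle_of (real n * t)))\<^sup>2 \<partial>\<nu>)"
      by (rule has_spectrum_norm_sum[OF spec]) (use L2_funpow[OF assms(2) g_L2] in auto)
    also have "\<dots> = (\<integral>t. (cmod (D N t))\<^sup>2 \<partial>\<nu>)"
    proof -
      have "(\<Sum>n=1..N. (1 / of_nat N) * circle_of (real n * t)) = circle_of t * D N t" for t
      proof -
        have "(\<Sum>n=1..N. circle_of (real n * t)) = (\<Sum>n<N. circle_of (real (Suc n) * t))"
          by (rule sum.reindex_bij_witness[of _ Suc "\<lambda>n. n - 1"]) auto
        also have "\<dots> = circle_of t * (\<Sum>n<N. circle_of (real n * t))"
          unfolding sum_distrib_left circle_of_add[symmetric] by (simp add: algebra_simps)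
        finally show ?thesis
          unfolding sum_distrib_left[symmetric] by (simp add: D_def)
      qed
      then show ?thesis by (simp add: norm_mult)
    qed
    finally show ?thesis .
  qed
  have "(\<lambda>N. \<integral>t. (cmod (D N t))\<^sup>2 \<partial>\<nu>) \<longlonglongrightarrow> (\<integral>t. 0 \<partial>\<nu>)"
  proof (rule integral_dominated_convergence[where w = "\<lambda>_. 1"])
    show "AE t in \<nu>. (\<lambda>N. (cmod (D N t))\<^sup>2) \<longlonglongrightarrow> 0"
      using AE_Z
    proof eventually_elim
      case (elim t)
      then have "(\<lambda>N. D N t) \<longlonglongrightarrow> 0"
        using cesaro_character_tendsto[of t] by (simp add: D_def)
      then show ?case
        by (auto intro!: tendsto_eq_intros)
    qed
  qed (use D_m D_le in \<open>auto simp: power_le_one\<close>)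
  then show ?thesis
    unfolding eq by simp
qed

section \<open>Conditional expectations of bounded functions\<close>

lemma complex_cond_exp_measurable:
  "complex_cond_exp M F f \<in> borel_measurable F"
  by (simp add: borel_measurable_complex_iff complex_cond_exp_def)

lemma invariant_algebra_measurable_invariant:
  fixes \<phi> :: "'a \<Rightarrow> complex"
  assumes "R \<in> measurable M M" "\<phi> \<in> borel_measurable (invariant_algebra M R)" "x \<in> space M"
  shows "\<phi> (R x) = \<phi> x"
proof -
  have sp: "space (invariant_algebra M R) = space M"
    using subalgebra_invariant_algebra[of M R] by (simp add: subalgebra_def)
  have "\<phi> -` {\<phi> x} \<inter> space M \<in> sets (invariant_algebra M R)"
    using measurable_sets[OF assms(2), of "{\<phi> x}"] by (simp add: sp)
  then have "R -` (\<phi> -` {\<phi> x} \<inter> space M) \<inter> space M = \<phi> -` {\<phi> x} \<inter> space M"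
    by (simp add: sets_invariant_algebra[OF assms(1)])
  then have "x \<in> R -` (\<phi> -` {\<phi> x} \<inter> space M)"
    using assms(3) by blast
  then show ?thesis by simp
qed

lemma invariant_imp_invariant_algebra_measurable:
  fixes \<phi> :: "'a \<Rightarrow> complex"
  assumes "R \<in> measurable M M" "\<phi> \<in> borel_measurable M" "\<And>x. x \<in> space M \<Longrightarrow> \<phi> (R x) = \<phi> x"
  shows "\<phi> \<in> borel_measurable (invariant_algebra M R)"
proof (rule measurableI)
  have sp: "space (invariant_algebra M R) = space M"
    using subalgebra_invariant_algebra[of M R] by (simp add: subalgebra_def)
  fix B :: "complex set" assume "B \<in> sets borel"
  then have "\<phi> -` B \<inter> space M \<in> sets M"
    by (rule measurable_sets[OF assms(2)])
  moreover have "R -` (\<phi> -` B \<inter> space M) \<inter> space M = \<phi> -` B \<inter> space M"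
    using assms(3) measurable_space[OF assms(1)] by auto
  ultimately show "\<phi> -` B \<inter> space (invariant_algebra M R) \<in> sets (invariant_algebra M R)"
    by (simp add: sp sets_invariant_algebra[OF assms(1)])
qed auto

lemma orthogonal_to_measurable:
  assumes "prob_space M" "subalgebra M F" "f \<in> L2 M"
    and \<phi>: "\<phi> \<in> borel_measurable F" "\<And>x. x \<in> space M \<Longrightarrow> cmod (\<phi> x) \<le> C"
  shows "L2_inner M (\<lambda>x. f x - complex_cond_exp M F f x) \<phi> = 0"
proof (rule complex_cond_exp_orthogonal[OF assms(1-3)])
  interpret prob_space M by fact
  have "\<phi> \<in> L2 M"
    by (rule bounded_in_L2[where C = C])
      (use \<phi> measurable_from_subalg[OF assms(2)] finite_measure_axioms in \<open>auto simp: AE_I2\<close>)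
  then have "integrable M (\<lambda>x. (cmod (\<phi> x))\<^sup>2)"
    by (simp add: L2_def)
  then have "integrable (restr_to_subalg M F) (\<lambda>x. (cmod (\<phi> x))\<^sup>2)"
    by (intro integrable_in_subalg[OF assms(2)]) (use \<phi>(1) in measurable)
  then show "\<phi> \<in> L2 (restr_to_subalg M F)"
    using measurable_in_subalg[OF assms(2) \<phi>(1)] by (simp add: L2_def)
qed

lemma complex_cond_exp_bounded:
  assumes "prob_space M" "subalgebra M F" "f \<in> borel_measurable M" "AE x in M. cmod (f x) \<le> C"
  shows "AE x in M. cmod (complex_cond_exp M F f x) \<le> 2 * C"
proof -
  interpret prob_space M by fact
  interpret finite_measure_subalgebra M F
    by unfold_locales fact
  have *: "AE x in M. \<bar>real_cond_exp M F g x\<bar> \<le> C"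
    if g: "g \<in> borel_measurable M" "AE x in M. \<bar>g x\<bar> \<le> C" for g
  proof -
    have i: "integrable M g"
      by (rule integrable_const_bound[where B = C]) (use g in auto)
    have "AE x in M. g x \<le> C" "AE x in M. g x \<ge> - C"
      using g(2) by (auto elim: eventually_mono)
    then have "AE x in M. real_cond_exp M F g x \<le> C" "AE x in M. real_cond_exp M F g x \<ge> - C"
      using real_cond_exp_le_c[OF i] real_cond_exp_ge_c[OF i] by blast+
    then show ?thesis by eventually_elim auto
  qed
  have "AE x in M. \<bar>real_cond_exp M F (\<lambda>x. Re (f x)) x\<bar> \<le> C"
    using assms(3,4) by (intro *) (auto elim!: eventually_mono intro: order_trans[OF abs_Re_le_cmod])
  moreover have "AE x in M. \<bar>real_cond_exp M F (\<lambda>x. Im (f x)) x\<bar> \<le> C"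
    using assms(3,4) by (intro *) (auto elim!: eventually_mono intro: order_trans[OF abs_Im_le_cmod])
  ultimately show ?thesis
  proof eventually_elim
    case (elim x)
    then show ?case
      using cmod_le[of "complex_cond_exp M F f x"] by (simp add: complex_cond_exp_def)
  qed
qed

lemma Linfty_in_L2:
  assumes "prob_space M" "f \<in> Linfty M"
  shows "f \<in> L2 M"
proof -
  interpret prob_space M by fact
  show ?thesis
    using assms(2) bounded_in_L2[OF finite_measure_axioms] by (auto simp: Linfty_def)
qed

text \<open>Representatives that are bounded and invariant everywhere, not only almost everywhere. Truncation
  acts on the values only, so it preserves invariance.\<close>

lemma bounded_representatives:
  assumes "prob_space M" "mp_automorphism M R" "f \<in> Linfty M"
  obtains C f0 F0 where "C \<ge> 0"
    "f0 \<in> borel_measurable M" "\<And>x. cmod (f0 x) \<le> C" "AE x in M. f x = f0 x"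
    "F0 \<in> borel_measurable M" "\<And>x. cmod (F0 x) \<le> C"
    "AE x in M. complex_cond_exp M (invariant_algebra M R) f x = F0 x"
    "\<And>x. x \<in> space M \<Longrightarrow> F0 (R x) = F0 x"
proof -
  let ?E = "complex_cond_exp M (invariant_algebra M R) f"
  obtain C0 where C0: "f \<in> borel_measurable M" "AE x in M. cmod (f x) \<le> C0"
    using assms(3) by (auto simp: Linfty_def)
  define C where "C = 2 * \<bar>C0\<bar>"
  define trunc where "trunc z = (if cmod z \<le> C then z else 0)" for z
  have [measurable]: "f \<in> borel_measurable M" by fact
  have E_I: "?E \<in> borel_measurable (invariant_algebra M R)"
    by (rule complex_cond_exp_measurable)
  then have [measurable]: "?E \<in> borel_measurable M"
    by (rule measurable_from_subalg[OF subalgebra_invariant_algebra])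
  show ?thesis
  proof (rule that)
    show "C \<ge> 0" by (simp add: C_def)
    then show "cmod (trunc (f x)) \<le> C" "cmod (trunc (?E x)) \<le> C" for x
      by (auto simp: trunc_def)
    show "AE x in M. f x = trunc (f x)"
      using C0(2) by eventually_elim (auto simp: trunc_def C_def)
    show "AE x in M. ?E x = trunc (?E x)"
      using complex_cond_exp_bounded[OF assms(1) subalgebra_invariant_algebra C0, of R]
      by eventually_elim (auto simp: trunc_def C_def)
    show "(\<lambda>x. trunc (f x)) \<in> borel_measurable M" "(\<lambda>x. trunc (?E x)) \<in> borel_measurable M"
      unfolding trunc_def by measurable
    show "trunc (?E (R x)) = trunc (?E x)" if "x \<in> space M" for x
      using invariant_algebra_measurable_invariant[OF mp_automorphism_measurable[OF assms(2)] E_I that]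
      by simp
  qed
qed

lemma L2_inner_cong_AE:
  assumes "f \<in> borel_measurable M" "f' \<in> borel_measurable M" "g \<in> borel_measurable M" "g' \<in> borel_measurable M"
    and "AE x in M. f x = f' x" "AE x in M. g x = g' x"
  shows "L2_inner M f g = L2_inner M f' g'"
  unfolding L2_inner_def
proof (rule integral_cong_AE)
  show "AE x in M. f x * cnj (g x) = f' x * cnj (g' x)"
    using assms(5,6) by eventually_elim simp
qed (use assms in measurable)

text \<open>A singular spectral measure on \<open>[0, 1]\<close> is carried over to the line; \<open>B\<close> is a Lebesgue null set
  outside of which it has no mass. Only the coefficients with \<open>n \<ge> 0\<close> are needed.\<close>

lemma spectral_measure_has_spectrum:
  assumes "mp_automorphism M R" "f \<in> L2 M" "is_spectral_measure M R f \<nu>" "mutually_singular \<nu> lebesgue01"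
  obtains \<nu>' B where "has_spectrum M (\<lambda>n x. f ((R ^^ n) x)) \<nu>'"
    "B \<in> sets borel" "B \<subseteq> {0..1}" "emeasure lborel B = 0" "emeasure \<nu>' (- B) = 0"
proof -
  have fin: "finite_measure \<nu>" and sets: "sets \<nu> = sets (restrict_space borel {0..1})"
    and hat: "\<And>n::int. (\<integral>x. cis (2 * pi * of_int n * x) \<partial>\<nu>) = L2_inner M (\<lambda>x. f (int_iterate M R n x)) f"
    using assms(3) by (auto simp: is_spectral_measure_def)
  interpret finite_measure \<nu> by fact
  have sp: "space \<nu> = {0..1}"
    using sets_eq_imp_space_eq[OF sets] by (simp add: space_restrict_space)
  have id: "(\<lambda>t. t) \<in> measurable \<nu> borel"
    unfolding measurable_cong_sets[OF sets refl] by (intro measurable_restrict_space1) measurable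
  define \<nu>' where "\<nu>' = distr \<nu> borel (\<lambda>t. t)"
  have "has_spectrum M (\<lambda>n x. f ((R ^^ n) x)) \<nu>'"
  proof (rule has_spectrumI)
    show "finite_measure \<nu>'"
      unfolding \<nu>'_def by (rule finite_measure_distr[OF id])
    show "sets \<nu>' = sets borel" by (simp add: \<nu>'_def)
    show "L2_inner M (\<lambda>x. f ((R ^^ h) x)) (\<lambda>x. f ((R ^^ 0) x)) = (\<integral>t. circle_of (real h * t) \<partial>\<nu>')" for h
    proof -
      have "(\<integral>t. circle_of (real h * t) \<partial>\<nu>') = (\<integral>t. circle_of (real h * t) \<partial>\<nu>)"
        unfolding \<nu>'_def by (rule integral_distr[OF id]) measurable
      then show ?thesis
        using hat[of "int h"] by (simp add: int_iterate_def circle_of_def mult.assoc)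
    qed
  qed (rule L2_inner_orbit_Suc[OF assms(1,2)])
  moreover obtain A where A: "A \<in> sets \<nu>" "emeasure \<nu> A = 0" "emeasure lebesgue01 ({0..1} - A) = 0"
    using assms(4) by (auto simp: mutually_singular_def)
  have A01: "A \<subseteq> {0..1}"
    using sets.sets_into_space[OF A(1)] by (simp add: sp)
  have "A \<in> sets borel"
    using A(1) by (auto simp: sets sets_restrict_space)
  then have "{0..1} - A \<in> sets borel" by auto
  moreover have "emeasure lborel ({0..1} - A) = 0"
    using A(3) unfolding lebesgue01_def by (subst (asm) emeasure_restrict_space) auto
  moreover have "emeasure \<nu>' (- ({0..1} - A)) = 0"
  proof -
    have "(\<lambda>t. t) -` (- ({0..1} - A)) \<inter> space \<nu> = A"
      using A01 by (auto simp: sp)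
    then show ?thesis
      unfolding \<nu>'_def using id A(2) \<open>A \<in> sets borel\<close> by (subst emeasure_distr) auto
  qed
  ultimately show ?thesis
    using that[of \<nu>' "{0..1} - A"] by blast
qed

section \<open>Convergence of the averages of products\<close>

text \<open>Up to null sets, the deviation from the limit is \<open>P N + G0 \<cdot> Q N\<close>. In \<open>P N\<close> the second factor is
  \<open>g - E[g|I\<^sub>S]\<close> along the orbit, which is uncorrelated; \<open>G0\<close> represents \<open>E[g|I\<^sub>S]\<close>, which is constant
  along orbits; and \<open>Q N\<close> is the ergodic average of \<open>f - E[f|I\<^sub>T]\<close>.\<close>

lemma product_averages_converge:
  fixes k :: "nat \<Rightarrow> nat"
  assumes prob: "prob_space M" and T: "mp_automorphism M T" and S: "mp_automorphism M S"
    and f: "f \<in> Linfty M" and g: "g \<in> Linfty M"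
    and sing: "is_spectral_measure M T f \<nu>" "mutually_singular \<nu> lebesgue01"
    and Z: "countable Z"
    and avg: "\<And>t h. t \<notin> Z \<Longrightarrow> h \<ge> 1 \<Longrightarrow>
      (\<lambda>N. (\<Sum>n=1..N. circle_of ((real (k (n + h)) - real (k n)) * t)) / of_nat N) \<longlonglongrightarrow> 0"
    and orth: "\<And>\<alpha> \<phi> C. \<alpha> \<in> Z \<Longrightarrow> \<phi> \<in> borel_measurable M \<Longrightarrow> (\<And>x. x \<in> space M \<Longrightarrow> cmod (\<phi> x) \<le> C) \<Longrightarrow>
      (\<And>x. x \<in> space M \<Longrightarrow> \<phi> (S x) = circle_of \<alpha> * \<phi> x) \<Longrightarrow>
      L2_inner M (\<lambda>x. g x - complex_cond_exp M (invariant_algebra M S) g x) \<phi> = 0"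
  shows "L2_converges M
     (\<lambda>N x. (\<Sum>n=1..N. f ((T ^^ n) x) * g ((S ^^ k n) x)) / of_nat N)
     (\<lambda>x. complex_cond_exp M (invariant_algebra M T) f x *
          complex_cond_exp M (invariant_algebra M S) g x)"
proof -
  interpret prob_space M by fact
  let ?Ef = "complex_cond_exp M (invariant_algebra M T) f"
  let ?Eg = "complex_cond_exp M (invariant_algebra M S) g"
  obtain C1 f0 F0 where f0: "C1 \<ge> 0"
    "f0 \<in> borel_measurable M" "\<And>x. cmod (f0 x) \<le> C1" "AE x in M. f x = f0 x"
    "F0 \<in> borel_measurable M" "\<And>x. cmod (F0 x) \<le> C1" "AE x in M. ?Ef x = F0 x"
    "\<And>x. x \<in> space M \<Longrightarrow> F0 (T x) = F0 x"
    by (rule bounded_representatives[OF prob T f]) (rule that)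
  obtain C2 g0 G0 where g0: "C2 \<ge> 0"
    "g0 \<in> borel_measurable M" "\<And>x. cmod (g0 x) \<le> C2" "AE x in M. g x = g0 x"
    "G0 \<in> borel_measurable M" "\<And>x. cmod (G0 x) \<le> C2" "AE x in M. ?Eg x = G0 x"
    "\<And>x. x \<in> space M \<Longrightarrow> G0 (S x) = G0 x"
    by (rule bounded_representatives[OF prob S g]) (rule that)
  define C where "C = 2 * (C1 + C2)"
  have C: "C \<ge> 0" "C1 \<le> C" "C2 \<le> C" "C1 + C1 \<le> C" "C2 + C2 \<le> C"
    using f0(1) g0(1) by (auto simp: C_def)
  have [measurable]: "f \<in> borel_measurable M" "g \<in> borel_measurable M"
    using f g by (auto simp: Linfty_def)
  note [measurable] = f0(2,5) g0(2,5) mp_automorphism_measurable[OF T] mp_automorphism_measurable[OF S]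
  have [measurable]: "?Ef \<in> borel_measurable M" "?Eg \<in> borel_measurable M"
    by (rule measurable_from_subalg[OF subalgebra_invariant_algebra complex_cond_exp_measurable])+
  define f1 where "f1 x = f0 x - F0 x" for x
  define g1 where "g1 x = g0 x - G0 x" for x
  have f1_m [measurable]: "f1 \<in> borel_measurable M" and g1_m [measurable]: "g1 \<in> borel_measurable M"
    unfolding f1_def g1_def by measurable
  have f1_le: "cmod (f1 x) \<le> C" for x
    unfolding f1_def using f0(3)[of x] f0(6)[of x] C norm_triangle_ineq4[of "f0 x" "F0 x"] by linarith
  have g1_le: "cmod (g1 x) \<le> C" for x
    unfolding g1_def using g0(3)[of x] g0(6)[of x] C norm_triangle_ineq4[of "g0 x" "G0 x"] by linarith
  have f0_le: "cmod (f0 x) \<le> C" and G0_le: "cmod (G0 x) \<le> C" for x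
    using f0(3)[of x] g0(6)[of x] C by auto
  have F0_inv: "F0 ((T ^^ n) x) = F0 x" if "x \<in> space M" for n x
    by (induction n) (use that f0(8) funpow_in_space[OF T that] in auto)
  have G0_inv: "G0 ((S ^^ n) x) = G0 x" if "x \<in> space M" for n x
    by (induction n) (use that g0(8) funpow_in_space[OF S that] in auto)
  have orth_g1: "L2_inner M \<phi> g1 = 0" if "\<alpha> \<in> Z" "\<phi> \<in> borel_measurable M"
    "\<And>x. x \<in> space M \<Longrightarrow> cmod (\<phi> x) \<le> C" "\<And>x. x \<in> space M \<Longrightarrow> \<phi> (S x) = circle_of \<alpha> * \<phi> x" for \<alpha> \<phi>
  proof -
    have "L2_inner M g1 \<phi> = L2_inner M (\<lambda>x. g x - ?Eg x) \<phi>"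
    proof (rule L2_inner_cong_AE)
      show "AE x in M. g1 x = g x - ?Eg x"
        using g0(4,7) by eventually_elim (simp add: g1_def)
    qed (use that(2) in auto)
    also have "\<dots> = 0" by (rule orth[OF that])
    finally show ?thesis
      using L2_inner_commute[of M \<phi> g1] by simp
  qed
  have orth_f1: "L2_inner M \<phi> f1 = 0" if "\<phi> \<in> borel_measurable M"
    "\<And>x. x \<in> space M \<Longrightarrow> cmod (\<phi> x) \<le> C" "\<And>x. x \<in> space M \<Longrightarrow> \<phi> (T x) = \<phi> x" for \<phi>
  proof -
    have "L2_inner M f1 \<phi> = L2_inner M (\<lambda>x. f x - ?Ef x) \<phi>"
    proof (rule L2_inner_cong_AE)
      show "AE x in M. f1 x = f x - ?Ef x"
        using f0(4,7) by eventually_elim (simp add: f1_def)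
    qed (use that(1) in auto)
    also have "\<dots> = 0"
      by (rule orthogonal_to_measurable[OF prob subalgebra_invariant_algebra Linfty_in_L2[OF prob f]
            invariant_imp_invariant_algebra_measurable[OF mp_automorphism_measurable[OF T] that(1,3)] that(2)])
    finally show ?thesis
      using L2_inner_commute[of M \<phi> f1] by simp
  qed
  obtain \<nu>' B where spec_f: "has_spectrum M (\<lambda>n x. f ((T ^^ n) x)) \<nu>'"
    and B: "B \<in> sets borel" "B \<subseteq> {0..1}" "emeasure lborel B = 0" "emeasure \<nu>' (- B) = 0"
    using spectral_measure_has_spectrum[OF T Linfty_in_L2[OF prob f] sing] by blast
  have "L2_inner M (\<lambda>x. f0 ((T ^^ a) x)) (\<lambda>x. f0 ((T ^^ b) x))
      = L2_inner M (\<lambda>x. f ((T ^^ a) x)) (\<lambda>x. f ((T ^^ b) x))" for a b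
    by (rule L2_inner_cong_AE) (use AE_funpow[OF T f0(4)] in \<open>auto simp: eq_commute\<close>)
  then have spec: "has_spectrum M (\<lambda>n x. f0 ((T ^^ n) x)) \<nu>'"
    using spec_f by (simp add: has_spectrum_def)
  define P where "P N x = (\<Sum>n=1..N. f0 ((T ^^ n) x) * g1 ((S ^^ k n) x)) / of_nat N" for N x
  define Q where "Q N x = (\<Sum>n=1..N. f1 ((T ^^ n) x)) / of_nat N" for N x
  have P_lim: "(\<lambda>N. \<integral>x. (cmod (P N x))\<^sup>2 \<partial>M) \<longlonglongrightarrow> 0"
    unfolding P_def
  proof (rule singular_times_uncorrelated[OF prob _ _ _ _ spec B])
    show "(\<lambda>N. (\<Sum>n=1..N. L2_inner M (\<lambda>x. g1 ((S ^^ k (n + h)) x)) (\<lambda>x. g1 ((S ^^ k n) x))) / of_nat N)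
        \<longlonglongrightarrow> 0" if "h \<ge> 1" for h
      by (rule orbit_uncorrelated[OF prob S g1_m g1_le Z avg[OF _ that] orth_g1])
  qed (use f0_le g1_le in auto)
  have Q_lim: "(\<lambda>N. \<integral>x. (cmod (Q N x))\<^sup>2 \<partial>M) \<longlonglongrightarrow> 0"
    unfolding Q_def by (rule mean_ergodic_0[OF prob T f1_m f1_le orth_f1])
  have [measurable]: "P N \<in> borel_measurable M" "Q N \<in> borel_measurable M" for N
    unfolding P_def Q_def by measurable
  have avg_le: "cmod ((\<Sum>n=1..N. y n) / of_nat N) \<le> K" if "\<And>n. cmod (y n) \<le> K" for y :: "nat \<Rightarrow> complex" and K N
  proof (cases "N = 0")
    case True
    then show ?thesis using order_trans[OF norm_ge_zero that[of 0]] by simp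
  next
    case False
    then show ?thesis
      using sum_norm_bound[of "{1..N}" y K] that by (simp add: norm_divide field_simps)
  qed
  have P_le: "cmod (P N x) \<le> C * C" for N x
    unfolding P_def using f0_le g1_le C(1) by (intro avg_le) (auto simp: norm_mult intro!: mult_mono)
  have Q_le: "cmod (Q N x) \<le> C" for N x
    unfolding Q_def using f1_le by (intro avg_le) auto
  have PQ_int: "integrable M (\<lambda>x. (cmod (P N x))\<^sup>2)" "integrable M (\<lambda>x. (cmod (Q N x))\<^sup>2)" for N
    using bounded_in_L2[OF finite_measure_axioms _ AE_I2[OF P_le]]
      bounded_in_L2[OF finite_measure_axioms _ AE_I2[OF Q_le]] by (auto simp: L2_def)
  define H where "H N x = (\<Sum>n=1..N. f ((T ^^ n) x) * g ((S ^^ k n) x)) / of_nat N - ?Ef x * ?Eg x" for N x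
  have all_AE: "AE x in M. x \<in> space M \<and> (\<forall>n. f ((T ^^ n) x) = f0 ((T ^^ n) x))
      \<and> (\<forall>n. g ((S ^^ k n) x) = g0 ((S ^^ k n) x)) \<and> ?Ef x = F0 x \<and> ?Eg x = G0 x"
    using AE_funpow[OF T f0(4)] AE_funpow[OF S g0(4)] f0(7) g0(7)
    by (auto simp: AE_all_countable AE_conj_iff)
  have H_eq: "AE x in M. H N x = P N x + G0 x * Q N x" if "N \<ge> 1" for N
    using all_AE
  proof eventually_elim
    case (elim x)
    then have x: "x \<in> space M" by simp
    have "(\<Sum>n=1..N. f ((T ^^ n) x) * g ((S ^^ k n) x))
        = (\<Sum>n=1..N. f0 ((T ^^ n) x) * g1 ((S ^^ k n) x) + G0 x * (f1 ((T ^^ n) x) + F0 x))"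
      using elim by (intro sum.cong) (auto simp: g1_def f1_def F0_inv[OF x] G0_inv[OF x] algebra_simps)
    also have "\<dots> = (\<Sum>n=1..N. f0 ((T ^^ n) x) * g1 ((S ^^ k n) x))
        + G0 x * ((\<Sum>n=1..N. f1 ((T ^^ n) x)) + of_nat N * F0 x)"
      by (simp only: sum.distrib sum_distrib_left[symmetric]) simp
    finally have "(\<Sum>n=1..N. f ((T ^^ n) x) * g ((S ^^ k n) x))
        = (\<Sum>n=1..N. f0 ((T ^^ n) x) * g1 ((S ^^ k n) x))
        + G0 x * ((\<Sum>n=1..N. f1 ((T ^^ n) x)) + of_nat N * F0 x)" .
    then show ?case
      using that elim by (simp add: H_def P_def Q_def field_simps)
  qed
  have "(\<lambda>N. \<integral>\<^sup>+x. ennreal ((cmod (H N x))\<^sup>2) \<partial>M) \<longlonglongrightarrow> 0"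
  proof (rule tendsto_sandwich[where f = "\<lambda>_. 0"])
    show "(\<lambda>N. ennreal (2 * (\<integral>x. (cmod (P N x))\<^sup>2 \<partial>M) + 2 * C\<^sup>2 * (\<integral>x. (cmod (Q N x))\<^sup>2 \<partial>M))) \<longlonglongrightarrow> 0"
    proof -
      have "(\<lambda>N. 2 * (\<integral>x. (cmod (P N x))\<^sup>2 \<partial>M) + 2 * C\<^sup>2 * (\<integral>x. (cmod (Q N x))\<^sup>2 \<partial>M))
          \<longlonglongrightarrow> 2 * 0 + 2 * C\<^sup>2 * 0"
        by (intro tendsto_add tendsto_mult_left P_lim Q_lim)
      from tendsto_ennrealI[OF this] show ?thesis by simp
    qed
    show "\<forall>\<^sub>F N in sequentially. (\<integral>\<^sup>+x. ennreal ((cmod (H N x))\<^sup>2) \<partial>M)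
        \<le> ennreal (2 * (\<integral>x. (cmod (P N x))\<^sup>2 \<partial>M) + 2 * C\<^sup>2 * (\<integral>x. (cmod (Q N x))\<^sup>2 \<partial>M))"
      using eventually_ge_at_top[of 1]
    proof eventually_elim
      case (elim N)
      have "(\<integral>\<^sup>+x. ennreal ((cmod (H N x))\<^sup>2) \<partial>M)
          \<le> (\<integral>\<^sup>+x. ennreal (2 * (cmod (P N x))\<^sup>2 + 2 * C\<^sup>2 * (cmod (Q N x))\<^sup>2) \<partial>M)"
      proof (rule nn_integral_mono_AE)
        show "AE x in M. ennreal ((cmod (H N x))\<^sup>2) \<le> ennreal (2 * (cmod (P N x))\<^sup>2 + 2 * C\<^sup>2 * (cmod (Q N x))\<^sup>2)"
          using H_eq[OF elim]
        proof eventually_elim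
          case (elim x)
          have "cmod (G0 x * Q N x) \<le> C * cmod (Q N x)"
            unfolding norm_mult using G0_le by (intro mult_right_mono) auto
          then have "cmod (H N x) \<le> cmod (P N x) + C * cmod (Q N x)"
            unfolding elim by (rule norm_triangle_mono[OF order_refl])
          then have "(cmod (H N x))\<^sup>2 \<le> (cmod (P N x) + C * cmod (Q N x))\<^sup>2"
            by (rule power_mono) simp
          also have "\<dots> \<le> 2 * (cmod (P N x))\<^sup>2 + 2 * (C * cmod (Q N x))\<^sup>2"
            using sum_squares_bound[of "cmod (P N x)" "C * cmod (Q N x)"] by (simp add: power2_sum)
          finally show ?case
            by (intro ennreal_leI) (simp add: power_mult_distrib)
        qed
      qed
      also have "\<dots> = ennreal (\<integral>x. 2 * (cmod (P N x))\<^sup>2 + 2 * C\<^sup>2 * (cmod (Q N x))\<^sup>2 \<partial>M)"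
        by (rule nn_integral_eq_integral) (use PQ_int in auto)
      also have "\<dots> = ennreal (2 * (\<integral>x. (cmod (P N x))\<^sup>2 \<partial>M) + 2 * C\<^sup>2 * (\<integral>x. (cmod (Q N x))\<^sup>2 \<partial>M))"
        using PQ_int by simp
      finally show ?case .
    qed
  qed auto
  moreover have "(\<lambda>x. (\<Sum>n=1..N. f ((T ^^ n) x) * g ((S ^^ k n) x)) / of_nat N) \<in> L2 M" for N
  proof (rule bounded_in_L2[where C = "C * C"])
    show "AE x in M. cmod ((\<Sum>n=1..N. f ((T ^^ n) x) * g ((S ^^ k n) x)) / of_nat N) \<le> C * C"
      using all_AE
    proof eventually_elim
      case (elim x)
      have "cmod (g0 y) \<le> C" for y using g0(3)[of y] C by simp
      with elim f0_le C(1) show ?case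
        by (intro avg_le) (auto simp: norm_mult intro!: mult_mono)
    qed
  qed (use finite_measure_axioms in auto)
  moreover have "(\<lambda>x. ?Ef x * ?Eg x) \<in> L2 M"
  proof (rule bounded_in_L2[where C = "C * C"])
    show "AE x in M. cmod (?Ef x * ?Eg x) \<le> C * C"
      using all_AE
    proof eventually_elim
      case (elim x)
      have "cmod (F0 x) \<le> C" using f0(6)[of x] C by simp
      with elim G0_le C(1) show ?case
        by (auto simp: norm_mult intro!: mult_mono)
    qed
  qed (use finite_measure_axioms in auto)
  ultimately show ?thesis
    unfolding L2_converges_def H_def by blast
qed

section \<open>Exponential averages of uniformly distributed sequences\<close>

text \<open>The integral of the identity character over the orbit closure is multiplied by \<open>e(\<alpha>) \<noteq> 1\<close> under
  translation by \<open>e(\<alpha>)\<close>, so it vanishes by invariance of Haar measure.\<close>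

lemma uniformly_distributed_in_orbit_closure_average:
  assumes ud: "uniformly_distributed_in (orbit_closure \<alpha>) x" and \<alpha>: "\<alpha> \<notin> \<int>"
  shows "(\<lambda>N. (\<Sum>n=1..N. circle_of (x n)) / of_nat N) \<longlonglongrightarrow> 0"
proof -
  define H where "H = orbit_closure \<alpha>"
  define z where "z = circle_of \<alpha>"
  obtain m where m: "is_haar_prob H m" and lim: "\<And>\<phi> :: complex \<Rightarrow> complex. continuous_on H \<phi> \<Longrightarrow>
      (\<lambda>N. (\<Sum>n=1..N. \<phi> (circle_of (x n))) / of_nat N) \<longlonglongrightarrow> (\<integral>w. \<phi> w \<partial>m)"
    using ud by (auto simp: uniformly_distributed_in_def H_def)
  have sets: "sets m = sets (restrict_space borel H)" and inv: "\<And>z. z \<in> H \<Longrightarrow> distr m m (\<lambda>w. z * w) = m"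
    using m by (auto simp: is_haar_prob_def)
  have sp: "space m = H"
    using sets_eq_imp_space_eq[OF sets] by (simp add: space_restrict_space)
  let ?O = "(\<lambda>n::nat. circle_of (real n * \<alpha>)) ` {1..}"
  have zO: "z \<in> H"
  proof -
    have "z \<in> ?O" by (rule image_eqI[where x = 1]) (simp_all add: z_def)
    then show ?thesis
      unfolding H_def orbit_closure_def by (rule subsetD[OF closure_subset])
  qed
  have "(\<lambda>w. z * w) ` closure ?O \<subseteq> closure ?O"
  proof (rule image_closure_subset)
    show "continuous_on (closure ?O) (\<lambda>w. z * w)" by (intro continuous_intros)
    have "z * circle_of (real n * \<alpha>) = circle_of (real (Suc n) * \<alpha>)" for n
      unfolding z_def circle_of_add[symmetric] by (simp add: algebra_simps)
    then have "(\<lambda>w. z * w) ` ?O \<subseteq> ?O" by fastforce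
    then show "(\<lambda>w. z * w) ` ?O \<subseteq> closure ?O" by (rule order_trans[OF _ closure_subset])
  qed simp
  then have zH: "z * w \<in> H" if "w \<in> H" for w
    using that unfolding H_def orbit_closure_def image_subset_iff by (rule bspec)
  have id: "(\<lambda>w. w) \<in> borel_measurable m"
    unfolding measurable_cong_sets[OF sets refl] by (intro measurable_restrict_space1) measurable
  have mult: "(\<lambda>w. z * w) \<in> measurable m m"
    unfolding measurable_cong_sets[OF sets sets]
    by (intro measurable_restrict_space2 measurable_restrict_space1)
      (use zH in \<open>auto simp: space_restrict_space\<close>)
  have "(\<integral>w. w \<partial>m) = (\<integral>w. w \<partial>distr m m (\<lambda>w. z * w))"
    by (simp only: inv[OF zO])
  also have "\<dots> = (\<integral>w. z * w \<partial>m)"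
    by (rule integral_distr[OF mult id])
  also have "\<dots> = z * (\<integral>w. w \<partial>m)"
    by simp
  finally have "(1 - z) * (\<integral>w. w \<partial>m) = 0"
    by (simp add: algebra_simps)
  moreover have "z \<noteq> 1"
    using \<alpha> by (simp add: z_def circle_of_eq_1_iff)
  ultimately have "(\<integral>w. w \<partial>m) = 0" by simp
  then show ?thesis
    using lim[of "\<lambda>w. w"] by (simp add: continuous_on_id)
qed

lemma circle_of_Lipschitz: "cmod (circle_of s - circle_of t) \<le> 2 * pi * \<bar>s - t\<bar>"
proof -
  have "circle_of s - circle_of t = circle_of t * (circle_of (s - t) - 1)"
    using circle_of_add[of t "s - t"] by (simp add: algebra_simps)
  then have "cmod (circle_of s - circle_of t) = cmod (circle_of (s - t) - 1)"
    by (simp add: norm_mult)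
  also have "\<dots> = cmod (exp (\<i> * (2 * pi * (s - t))) - 1)"
    by (simp add: circle_of_def cis_conv_exp)
  also have "\<dots> \<le> \<bar>2 * pi * (s - t)\<bar>"
    using iexp_approx1[of "2 * pi * (s - t)" 0] by simp
  finally show ?thesis by (simp add: abs_mult)
qed

text \<open>Weyl's criterion for the first character, by comparison with a step function on \<open>m\<close> intervals
  of equal length.\<close>

lemma uniformly_distributed_mod1_average:
  assumes ud: "uniformly_distributed_mod1 x"
  shows "(\<lambda>N. (\<Sum>n=1..N. circle_of (x n)) / of_nat N) \<longlonglongrightarrow> 0"
proof (rule LIMSEQ_I)
  fix \<epsilon> :: real assume \<epsilon>: "\<epsilon> > 0"
  obtain m0 :: nat where m0: "4 * pi / \<epsilon> < real m0"
    using reals_Archimedean2 by blast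
  define m where "m = max 2 m0"
  have m: "m \<ge> 2" "2 * pi / real m < \<epsilon> / 2"
  proof -
    show "m \<ge> 2" by (simp add: m_def)
    have "4 * pi / \<epsilon> < real m" using m0 by (simp add: m_def)
    then show "2 * pi / real m < \<epsilon> / 2"
      using \<epsilon> \<open>m \<ge> 2\<close> by (simp add: field_simps)
  qed
  define cnt where "cnt j N = card {n \<in> {1..N}. real j / real m \<le> frac (x n) \<and> frac (x n) < real (Suc j) / real m}" for j N
  define St where "St N = (\<Sum>j<m. circle_of (real j / real m) * complex_of_real (real (cnt j N) / real N))" for N
  have cnt_lim: "(\<lambda>N. real (cnt j N) / real N) \<longlonglongrightarrow> 1 / real m" if "j < m" for j
  proof -
    have "0 \<le> real j / real m" "real j / real m < real (Suc j) / real m" "real (Suc j) / real m \<le> 1"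
      using that by (auto simp: field_simps)
    then have "(\<lambda>N. real (cnt j N) / real N) \<longlonglongrightarrow> real (Suc j) / real m - real j / real m"
      using ud unfolding uniformly_distributed_mod1_def cnt_def by blast
    then show ?thesis by (simp add: diff_divide_distrib[symmetric])
  qed
  have "St \<longlonglongrightarrow> (\<Sum>j<m. circle_of (real j / real m) * complex_of_real (1 / real m))"
    unfolding St_def by (intro tendsto_sum tendsto_mult_left tendsto_of_real cnt_lim) simp
  also have "(\<Sum>j<m. circle_of (real j / real m) * complex_of_real (1 / real m)) = 0"
  proof -
    define z where "z = circle_of (1 / real m)"
    have "z \<noteq> 1"
      unfolding z_def circle_of_eq_1_iff using m(1) Ints_nonzero_abs_less1[of "1 / real m"] by auto
    moreover have "z ^ m = 1"
      using m(1) by (simp add: z_def circle_of_power circle_of_eq_1_iff)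
    ultimately have "(\<Sum>j<m. z ^ j) = 0"
      by (simp add: geometric_sum)
    then show ?thesis
      unfolding sum_distrib_right[symmetric] by (simp add: z_def circle_of_power)
  qed
  finally have "eventually (\<lambda>N. cmod (St N) < \<epsilon> / 2) sequentially"
    using \<epsilon> by (intro order_tendstoD(2)[OF tendsto_norm_zero]) auto
  then obtain N0 where N0: "\<And>N. N \<ge> N0 \<Longrightarrow> cmod (St N) < \<epsilon> / 2"
    by (auto simp: eventually_sequentially)
  have "cmod ((\<Sum>n=1..N. circle_of (x n)) / of_nat N - 0) < \<epsilon>" if N: "N \<ge> max 1 N0" for N
  proof -
    define J where "J n = nat \<lfloor>real m * frac (x n)\<rfloor>" for n
    have J: "real (J n) \<le> real m * frac (x n)" "real m * frac (x n) < real (J n) + 1" "J n < m" for n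
    proof -
      have "0 \<le> real m * frac (x n)" by simp
      then show *: "real (J n) \<le> real m * frac (x n)" "real m * frac (x n) < real (J n) + 1"
        unfolding J_def by (simp_all add: of_nat_nat)
      have "real m * frac (x n) < real m * 1"
        using m(1) frac_lt_1[of "x n"] by (intro mult_strict_left_mono) auto
      then show "J n < m" using * by linarith
    qed
    have J_iff: "J n = j \<longleftrightarrow> real j / real m \<le> frac (x n) \<and> frac (x n) < real (Suc j) / real m" for n j
    proof
      assume "J n = j"
      then show "real j / real m \<le> frac (x n) \<and> frac (x n) < real (Suc j) / real m"
        using J[of n] m(1) by (simp add: field_simps)
    next
      assume "real j / real m \<le> frac (x n) \<and> frac (x n) < real (Suc j) / real m"
      then have "real j \<le> real m * frac (x n)" "real m * frac (x n) < real j + 1"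
        using m(1) by (simp_all add: field_simps)
      then have "real j < real (J n) + 1" "real (J n) < real j + 1"
        using J[of n] by linarith+
      then show "J n = j" by linarith
    qed
    have "(\<Sum>n=1..N. circle_of (real (J n) / real m)) = (\<Sum>n=1..N. \<Sum>j<m. if J n = j then circle_of (real j / real m) else 0)"
      using J(3) by (intro sum.cong) auto
    also have "\<dots> = (\<Sum>j<m. \<Sum>n=1..N. if J n = j then circle_of (real j / real m) else 0)"
      by (rule sum.swap)
    also have "\<dots> = (\<Sum>j<m. circle_of (real j / real m) * of_nat (cnt j N))"
    proof (rule sum.cong[OF refl])
      fix j
      have "(\<Sum>n=1..N. if J n = j then circle_of (real j / real m) else 0)
          = (\<Sum>n\<in>{n\<in>{1..N}. J n = j}. circle_of (real j / real m))"
        by (rule sum.inter_filter[symmetric]) simp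
      also have "\<dots> = circle_of (real j / real m) * of_nat (cnt j N)"
        by (simp add: cnt_def J_iff mult.commute)
      finally show "(\<Sum>n=1..N. if J n = j then circle_of (real j / real m) else 0)
          = circle_of (real j / real m) * of_nat (cnt j N)" .
    qed
    finally have St_eq: "St N = (\<Sum>n=1..N. circle_of (real (J n) / real m)) / of_nat N"
      by (simp add: St_def sum_divide_distrib)
    have close: "cmod (circle_of (x n) - circle_of (real (J n) / real m)) \<le> 2 * pi / real m" for n
    proof -
      have "circle_of (x n) = circle_of (of_int \<lfloor>x n\<rfloor> + frac (x n))"
        by (simp add: frac_def)
      also have "\<dots> = circle_of (frac (x n))"
        unfolding circle_of_add using circle_of_eq_1_iff[of "of_int \<lfloor>x n\<rfloor>"] by simp
      finally have "cmod (circle_of (x n) - circle_of (real (J n) / real m))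
          \<le> 2 * pi * \<bar>frac (x n) - real (J n) / real m\<bar>"
        using circle_of_Lipschitz by simp
      also have "\<dots> \<le> 2 * pi * (1 / real m)"
      proof (intro mult_left_mono)
        have "0 \<le> frac (x n) - real (J n) / real m" "frac (x n) - real (J n) / real m \<le> 1 / real m"
        proof -
          show "0 \<le> frac (x n) - real (J n) / real m"
            using J(1)[of n] m(1) by (simp add: field_simps)
          have "frac (x n) \<le> (real (J n) + 1) / real m"
            using J(2)[of n] m(1) by (simp add: field_simps)
          then show "frac (x n) - real (J n) / real m \<le> 1 / real m"
            by (simp add: add_divide_distrib)
        qed
        then show "\<bar>frac (x n) - real (J n) / real m\<bar> \<le> 1 / real m" by simp
      qed simp
      finally show ?thesis by simp
    qed
    have "cmod ((\<Sum>n=1..N. circle_of (x n)) - (\<Sum>n=1..N. circle_of (real (J n) / real m)))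
        \<le> real N * (2 * pi / real m)"
      unfolding sum_subtractf[symmetric]
      using sum_norm_bound[of "{1..N}" "\<lambda>n. circle_of (x n) - circle_of (real (J n) / real m)", OF close]
      by simp
    then have "cmod ((\<Sum>n=1..N. circle_of (x n)) / of_nat N - St N) \<le> 2 * pi / real m"
      using N unfolding St_eq diff_divide_distrib[symmetric] norm_divide
      by (simp add: divide_le_eq mult.commute)
    then show ?thesis
      using N0[of N] N m(2) norm_triangle_sub[of "(\<Sum>n=1..N. circle_of (x n)) / of_nat N" "St N"] by simp
  qed
  then show "\<exists>no. \<forall>N\<ge>no. cmod ((\<Sum>n=1..N. circle_of (x n)) / of_nat N - 0) < \<epsilon>"
    by blast
qed

section \<open>Lower bound for products of conditional expectations\<close>

lemma AM_GM_3:
  fixes u v a :: real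
  assumes "u > 0" "v > 0" "a \<ge> 0"
  shows "a\<^sup>2 * (3 - a / u - a / v) \<le> u * v"
proof -
  have *: "3 * (p * q * r) \<le> p ^ 3 + q ^ 3 + r ^ 3" if "p \<ge> 0" "q \<ge> 0" "r \<ge> 0" for p q r :: real
  proof -
    have "p ^ 3 + q ^ 3 + r ^ 3 - 3 * (p * q * r) = (p + q + r) * ((p - q)\<^sup>2 + (q - r)\<^sup>2 + (r - p)\<^sup>2) / 2"
      by (simp add: power2_eq_square power3_eq_cube field_simps)
    moreover have "0 \<le> (p + q + r) * ((p - q)\<^sup>2 + (q - r)\<^sup>2 + (r - p)\<^sup>2) / 2"
      using that by (intro divide_nonneg_nonneg mult_nonneg_nonneg add_nonneg_nonneg) auto
    ultimately show ?thesis by linarith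
  qed
  define p q where "p = root 3 u" and "q = root 3 v"
  have pq: "p > 0" "q > 0" "p ^ 3 = u" "q ^ 3 = v"
    using assms by (auto simp: p_def q_def)
  \<comment> \<open>After multiplication by \<open>uv\<close>, the three terms are the cubes of \<open>(pq)\<^sup>2\<close>, \<open>ap\<close> and \<open>aq\<close>.\<close>
  have "3 * ((p * q)\<^sup>2 * (a * p) * (a * q)) \<le> ((p * q)\<^sup>2) ^ 3 + (a * p) ^ 3 + (a * q) ^ 3"
    using pq(1,2) assms(3) by (intro *) auto
  also have "((p * q)\<^sup>2) ^ 3 = (p ^ 3 * q ^ 3)\<^sup>2"
    by (simp add: power_mult_distrib flip: power_mult)
  also have "(p * q)\<^sup>2 * (a * p) * (a * q) = a\<^sup>2 * (p ^ 3 * q ^ 3)"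
    by (simp add: power2_eq_square power3_eq_cube)
  finally have "3 * (a\<^sup>2 * (u * v)) \<le> (u * v)\<^sup>2 + a ^ 3 * u + a ^ 3 * v"
    by (simp add: power_mult_distrib pq)
  then show ?thesis
    using assms by (simp add: field_simps power2_eq_square power3_eq_cube)
qed

text \<open>For \<open>f\<close> with mean \<open>a\<close> and conditional expectations \<open>u\<close>, \<open>v\<close>, the inequality of arithmetic and
  geometric means gives \<open>uv \<ge> a\<^sup>2 (3 - a/u - a/v)\<close>, and \<open>f/u\<close>, \<open>f/v\<close> have mean at most one. The
  additional \<open>\<epsilon>\<close> avoids divisions by zero.\<close>

lemma product_cond_exp_lower_bound:
  assumes "prob_space M" "subalgebra M F" "subalgebra M G"
    and f: "f \<in> borel_measurable M" "\<And>x. 0 \<le> f x" "\<And>x. f x \<le> 1"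
  shows "(\<integral>x. f x \<partial>M) ^ 3 \<le> (\<integral>x. f x * real_cond_exp M F f x * real_cond_exp M G f x \<partial>M)"
proof -
  interpret prob_space M by fact
  define a where "a = (\<integral>x. f x \<partial>M)"
  have a: "a \<ge> 0" unfolding a_def by (rule integral_nonneg_AE) (use f in auto)
  have fi: "integrable M f"
    by (rule integrable_const_bound[where B = 1]) (use f in auto)
  have cond: "AE x in M. 0 \<le> real_cond_exp M E f x \<and> real_cond_exp M E f x \<le> 1"
    "real_cond_exp M E f \<in> borel_measurable M"
    "\<epsilon> > 0 \<Longrightarrow> (\<integral>x. f x / (max 0 (real_cond_exp M E f x) + \<epsilon>) \<partial>M) \<le> 1"
    if E: "subalgebra M E" for E and \<epsilon> :: real
  proof -
    interpret finite_measure_subalgebra M E by unfold_locales fact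
    let ?u = "real_cond_exp M E f"
    show um: "?u \<in> borel_measurable M" by simp
    have 0: "AE x in M. 0 \<le> ?u x" "AE x in M. ?u x \<le> 1"
      using real_cond_exp_ge_c[OF fi, of 0] real_cond_exp_le_c[OF fi, of 1] f by auto
    then show "AE x in M. 0 \<le> ?u x \<and> ?u x \<le> 1" by eventually_elim simp
    assume \<epsilon>: "\<epsilon> > 0"
    define w where "w x = 1 / (max 0 (?u x) + \<epsilon>)" for x
    have wE: "w \<in> borel_measurable E" unfolding w_def by measurable
    have wM: "w \<in> borel_measurable M" by (rule measurable_from_subalg[OF E wE])
    have w: "0 \<le> w x" "w x \<le> 1 / \<epsilon>" for x
      using \<epsilon> by (auto simp: w_def intro!: divide_left_mono divide_nonneg_nonneg mult_pos_pos add_nonneg_pos)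
    have i: "integrable M (\<lambda>x. w x * f x)"
    proof (rule integrable_const_bound[where B = "1 / \<epsilon>"])
      show "AE x in M. norm (w x * f x) \<le> 1 / \<epsilon>"
        using mult_mono[OF w(2) f(3)] w(1) f(2) \<epsilon> by (auto simp: abs_mult)
    qed (use wM f in measurable)
    have "(\<integral>x. w x * f x \<partial>M) = (\<integral>x. w x * ?u x \<partial>M)" "integrable M (\<lambda>x. w x * ?u x)"
      using real_cond_exp_intg[OF i wE f(1)] by auto
    moreover have "(\<integral>x. w x * ?u x \<partial>M) \<le> (\<integral>x. 1 \<partial>M)"
    proof (rule integral_mono_AE)
      show "AE x in M. w x * ?u x \<le> 1"
        using \<epsilon> by (auto simp: w_def field_simps)
    qed (use calculation in auto)
    ultimately show "(\<integral>x. f x / (max 0 (?u x) + \<epsilon>) \<partial>M) \<le> 1"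
      by (simp add: w_def prob_space)
  qed
  define u where "u x = max 0 (real_cond_exp M F f x)" for x
  define v where "v x = max 0 (real_cond_exp M G f x)" for x
  have uv_m [measurable]: "u \<in> borel_measurable M" "v \<in> borel_measurable M" "f \<in> borel_measurable M"
    unfolding u_def v_def using cond(2)[OF assms(2)] cond(2)[OF assms(3)] f(1) by measurable
  have uv: "AE x in M. 0 \<le> u x \<and> u x \<le> 1 \<and> 0 \<le> v x \<and> v x \<le> 1"
    using cond(1)[OF assms(2)] cond(1)[OF assms(3)] by eventually_elim (auto simp: u_def v_def)
  have fuv_i: "integrable M (\<lambda>x. f x * u x * v x)"
  proof (rule integrable_const_bound[where B = 1])
    show "AE x in M. norm (f x * u x * v x) \<le> 1"
      using uv by eventually_elim (use f in \<open>auto simp: abs_mult intro!: mult_le_one\<close>)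
  qed measurable
  have step: "a ^ 3 \<le> (\<integral>x. f x * u x * v x \<partial>M) + 3 * \<epsilon>" if \<epsilon>: "0 < \<epsilon>" "\<epsilon> \<le> 1" for \<epsilon>
  proof -
    have div_i: "integrable M (\<lambda>x. f x / (max 0 (real_cond_exp M E f x) + \<epsilon>))" if "subalgebra M E" for E
    proof (rule integrable_const_bound[where B = "1 / \<epsilon>"])
      show "AE x in M. norm (f x / (max 0 (real_cond_exp M E f x) + \<epsilon>)) \<le> 1 / \<epsilon>"
        using f \<epsilon> by (auto intro!: frac_le simp: add_nonneg_pos)
    qed (use cond(2)[OF that] f(1) in measurable)
    have iu: "integrable M (\<lambda>x. f x / (u x + \<epsilon>))" and iv: "integrable M (\<lambda>x. f x / (v x + \<epsilon>))"
      unfolding u_def v_def by (intro div_i assms)+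
    have lin: "(\<integral>x. a\<^sup>2 * (3 * f x - a * U x - a * V x) \<partial>M) = a\<^sup>2 * (3 * a - a * (\<integral>x. U x \<partial>M) - a * (\<integral>x. V x \<partial>M))"
      if "integrable M U" "integrable M V" for U V
      using that fi by (simp add: a_def[symmetric])
    have "a\<^sup>2 * (3 * a - a * 1 - a * 1)
        \<le> a\<^sup>2 * (3 * a - a * (\<integral>x. f x / (u x + \<epsilon>) \<partial>M) - a * (\<integral>x. f x / (v x + \<epsilon>) \<partial>M))"
      unfolding u_def v_def using a cond(3)[OF assms(2) \<epsilon>(1)] cond(3)[OF assms(3) \<epsilon>(1)]
      by (intro mult_left_mono diff_mono) auto
    also have "\<dots> = (\<integral>x. a\<^sup>2 * (3 * f x - a * (f x / (u x + \<epsilon>)) - a * (f x / (v x + \<epsilon>))) \<partial>M)"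
      by (rule lin[OF iu iv, symmetric])
    also have "\<dots> \<le> (\<integral>x. f x * u x * v x + 3 * \<epsilon> \<partial>M)"
    proof (rule integral_mono_AE)
      show "AE x in M. a\<^sup>2 * (3 * f x - a * (f x / (u x + \<epsilon>)) - a * (f x / (v x + \<epsilon>))) \<le> f x * u x * v x + 3 * \<epsilon>"
        using uv
      proof eventually_elim
        case (elim x)
        have "f x * (a\<^sup>2 * (3 - a / (u x + \<epsilon>) - a / (v x + \<epsilon>))) \<le> f x * ((u x + \<epsilon>) * (v x + \<epsilon>))"
          using elim \<epsilon> a f(2) by (intro mult_left_mono AM_GM_3) auto
        also have "\<dots> = f x * u x * v x + f x * (\<epsilon> * u x + \<epsilon> * v x + \<epsilon> * \<epsilon>)"
          by (simp add: algebra_simps)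
        also have "f x * (\<epsilon> * u x + \<epsilon> * v x + \<epsilon> * \<epsilon>) \<le> 1 * (\<epsilon> * 1 + \<epsilon> * 1 + \<epsilon> * 1)"
          using elim \<epsilon> f by (intro mult_mono add_mono) auto
        finally show ?case by (simp add: algebra_simps)
      qed
      show "integrable M (\<lambda>x. a\<^sup>2 * (3 * f x - a * (f x / (u x + \<epsilon>)) - a * (f x / (v x + \<epsilon>))))"
        by (intro integrable_mult_right Bochner_Integration.integrable_diff fi iu iv)
    qed (use fuv_i in auto)
    also have "\<dots> = (\<integral>x. f x * u x * v x \<partial>M) + 3 * \<epsilon>"
      using fuv_i by (simp add: prob_space)
    finally show ?thesis
      by (simp add: power2_eq_square power3_eq_cube algebra_simps)
  qed
  have "a ^ 3 \<le> (\<integral>x. f x * u x * v x \<partial>M)"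
  proof (rule field_le_epsilon)
    fix e :: real assume "e > 0"
    then have "a ^ 3 \<le> (\<integral>x. f x * u x * v x \<partial>M) + 3 * min 1 (e / 3)"
      by (intro step) auto
    then show "a ^ 3 \<le> (\<integral>x. f x * u x * v x \<partial>M) + e" by linarith
  qed
  also have "\<dots> = (\<integral>x. f x * real_cond_exp M F f x * real_cond_exp M G f x \<partial>M)"
  proof (rule integral_cong_AE)
    show "AE x in M. f x * u x * v x = f x * real_cond_exp M F f x * real_cond_exp M G f x"
      using cond(1)[OF assms(2)] cond(1)[OF assms(3)] by eventually_elim (auto simp: u_def v_def)
  qed (use cond(2)[OF assms(2)] cond(2)[OF assms(3)] in measurable)
  finally show ?thesis by (simp add: a_def)
qed

section \<open>Multiple recurrence\<close>

lemma L2_diff: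
  assumes "f \<in> L2 M" "g \<in> L2 M"
  shows "(\<lambda>x. f x - g x) \<in> L2 M"
proof -
  note [measurable] = assms[THEN L2_measurable]
  have "integrable M (\<lambda>x. (cmod (f x - g x))\<^sup>2)"
  proof (rule Bochner_Integration.integrable_bound)
    show "integrable M (\<lambda>x. 2 * (cmod (f x))\<^sup>2 + 2 * (cmod (g x))\<^sup>2)"
      using assms by (simp add: L2_def)
    have "(cmod (f x - g x))\<^sup>2 \<le> 2 * (cmod (f x))\<^sup>2 + 2 * (cmod (g x))\<^sup>2" for x
    proof -
      have "(cmod (f x - g x))\<^sup>2 \<le> (cmod (f x) + cmod (g x))\<^sup>2"
        by (intro power_mono norm_triangle_ineq4) simp
      then show ?thesis
        using sum_squares_bound[of "cmod (f x)" "cmod (g x)"] by (simp add: power2_sum)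
    qed
    then show "AE x in M. norm ((cmod (f x - g x))\<^sup>2) \<le> norm (2 * (cmod (f x))\<^sup>2 + 2 * (cmod (g x))\<^sup>2)"
      by simp
  qed measurable
  then show ?thesis by (simp add: L2_def)
qed

lemma complex_cond_exp_indicator:
  assumes "prob_space M" "subalgebra M F" "A \<in> sets M"
  shows "AE x in M. complex_cond_exp M F (indicator A) x = complex_of_real (real_cond_exp M F (indicator A) x)"
proof -
  interpret prob_space M by fact
  interpret finite_measure_subalgebra M F by unfold_locales fact
  have "AE x in M. real_cond_exp M F (\<lambda>x. 0) x = 0"
    by (rule real_cond_exp_F_meas) auto
  moreover have "(\<lambda>x. Im (indicator A x)) = (\<lambda>x. 0)" "(\<lambda>x. Re (indicator A x)) = indicator A"
    by (auto simp: indicator_def fun_eq_iff)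
  ultimately show ?thesis
    by (auto simp: complex_cond_exp_def complex_eq_iff)
qed

text \<open>Convergence of the averages in \<open>L\<^sup>2\<close> allows integration over \<open>A\<close>.\<close>

lemma triple_recurrence:
  fixes k :: "nat \<Rightarrow> nat"
  assumes prob: "prob_space M" and T: "mp_automorphism M T" and S: "mp_automorphism M S"
    and A: "A \<in> sets M"
    and conv: "L2_converges M
      (\<lambda>N x. (\<Sum>n=1..N. indicator A ((T ^^ n) x) * indicator A ((S ^^ k n) x)) / of_nat N)
      (\<lambda>x. complex_cond_exp M (invariant_algebra M T) (indicator A) x *
          complex_cond_exp M (invariant_algebra M S) (indicator A) x)"
  shows "\<exists>L::real. (\<lambda>N. (\<Sum>n=1..N. measure M (A \<inter> (T ^^ n) -` A \<inter> (S ^^ k n) -` A)) / real N) \<longlonglongrightarrow> L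
    \<and> L \<ge> measure M A ^ 3"
proof -
  interpret prob_space M by fact
  note [measurable] = A mp_automorphism_measurable[OF T] mp_automorphism_measurable[OF S]
  define u where "u = real_cond_exp M (invariant_algebra M T) (indicator A)"
  define v where "v = real_cond_exp M (invariant_algebra M S) (indicator A)"
  define p where "p N x = (\<Sum>n=1..N. indicator A ((T ^^ n) x) * indicator A ((S ^^ k n) x)) / real N" for N x
  have uv_m [measurable]: "u \<in> borel_measurable M" "v \<in> borel_measurable M"
    unfolding u_def v_def by (rule borel_measurable_cond_exp2)+
  have p_m [measurable]: "p N \<in> borel_measurable M" for N
    unfolding p_def by measurable
  define H where "H N x = (\<Sum>n=1..N. indicator A ((T ^^ n) x) * indicator A ((S ^^ k n) x)) / of_nat N
     - complex_cond_exp M (invariant_algebra M T) (indicator A) x *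
       complex_cond_exp M (invariant_algebra M S) (indicator A) x" for N x
  have H_L2: "H N \<in> L2 M" for N
    using conv unfolding H_def by (auto simp: L2_converges_def intro!: L2_diff)
  have H_m [measurable]: "H N \<in> borel_measurable M" for N
    by (rule L2_measurable[OF H_L2])
  have H_sq: "integrable M (\<lambda>x. (cmod (H N x))\<^sup>2)" for N
    using H_L2[of N] by (simp add: L2_def)
  have H_eq: "AE x in M. cmod (H N x) = \<bar>p N x - u x * v x\<bar>" for N
    using complex_cond_exp_indicator[OF prob subalgebra_invariant_algebra A, of T]
      complex_cond_exp_indicator[OF prob subalgebra_invariant_algebra A, of S]
  proof eventually_elim
    case (elim x)
    have sum_eq: "(\<Sum>n=1..N. indicator A ((T ^^ n) x) * indicator A ((S ^^ k n) x) :: complex)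
        = complex_of_real (\<Sum>n=1..N. indicator A ((T ^^ n) x) * indicator A ((S ^^ k n) x))"
      unfolding of_real_sum by (intro sum.cong refl) (simp add: indicator_def)
    have "H N x = complex_of_real (p N x - u x * v x)"
      unfolding H_def elim p_def sum_eq u_def v_def
      by (simp only: of_real_diff of_real_divide of_real_mult of_real_of_nat_eq)
    then show ?case by (simp only: norm_of_real)
  qed
  have p_int: "integrable M (\<lambda>x. indicator A x * p N x)" for N
    unfolding p_def sum_distrib_left times_divide_eq_right
  proof (intro integrable_divide Bochner_Integration.integrable_sum)
    show "integrable M (\<lambda>x. indicator A x * (indicator A ((T ^^ n) x) * indicator A ((S ^^ k n) x)) :: real)" for n
      by (rule integrable_const_bound[where B = 1]) (auto simp: indicator_def)
  qed
  have H_int: "integrable M (\<lambda>x. cmod (H N x))" for N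
    by (rule square_integrable_imp_integrable[OF _ H_sq]) measurable
  have d_int: "integrable M (\<lambda>x. indicator A x * (p N x - u x * v x))" for N
  proof (rule Bochner_Integration.integrable_bound[OF H_int])
    show "AE x in M. norm (indicator A x * (p N x - u x * v x)) \<le> norm (cmod (H N x))"
      using H_eq[of N] by eventually_elim (auto simp: indicator_def)
  qed measurable
  define L where "L = (\<integral>x. indicator A x * u x * v x \<partial>M)"
  have L_int: "integrable M (\<lambda>x. indicator A x * u x * v x)"
    using Bochner_Integration.integrable_diff[OF p_int[of 0] d_int[of 0]] by (simp add: algebra_simps)
  have "(\<lambda>N. \<integral>\<^sup>+x. ennreal ((cmod (H N x))\<^sup>2) \<partial>M) \<longlonglongrightarrow> 0"
    using conv by (simp add: L2_converges_def H_def)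
  then have "(\<lambda>N. ennreal (\<integral>x. (cmod (H N x))\<^sup>2 \<partial>M)) \<longlonglongrightarrow> ennreal 0"
    by (simp add: nn_integral_eq_integral[OF H_sq])
  then have H_lim: "(\<lambda>N. \<integral>x. (cmod (H N x))\<^sup>2 \<partial>M) \<longlonglongrightarrow> 0"
    by (subst (asm) tendsto_ennreal_iff) auto
  have "(\<lambda>N. \<integral>x. indicator A x * p N x \<partial>M) \<longlonglongrightarrow> L"
  proof (rule LIMSEQ_I)
    fix \<epsilon> :: real assume \<epsilon>: "\<epsilon> > 0"
    then have "eventually (\<lambda>N. (\<integral>x. (cmod (H N x))\<^sup>2 \<partial>M) < \<epsilon>\<^sup>2) sequentially"
      by (intro order_tendstoD(2)[OF H_lim]) simp
    then obtain N0 where N0: "\<And>N. N \<ge> N0 \<Longrightarrow> (\<integral>x. (cmod (H N x))\<^sup>2 \<partial>M) < \<epsilon>\<^sup>2"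
      by (auto simp: eventually_sequentially)
    have "norm ((\<integral>x. indicator A x * p N x \<partial>M) - L) < \<epsilon>" if "N \<ge> N0" for N
    proof -
      have "(\<integral>x. indicator A x * p N x \<partial>M) - L = (\<integral>x. indicator A x * (p N x - u x * v x) \<partial>M)"
        unfolding L_def Bochner_Integration.integral_diff[OF p_int L_int, symmetric]
        by (simp add: algebra_simps)
      also have "norm \<dots> \<le> (\<integral>x. \<epsilon> / 2 + (cmod (H N x))\<^sup>2 / (2 * \<epsilon>) \<partial>M)"
      proof (rule order_trans[OF integral_norm_bound], rule integral_mono_AE)
        show "AE x in M. norm (indicator A x * (p N x - u x * v x)) \<le> \<epsilon> / 2 + (cmod (H N x))\<^sup>2 / (2 * \<epsilon>)"
          using H_eq[of N]
        proof eventually_elim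
          case (elim x)
          have "norm (indicator A x * (p N x - u x * v x)) \<le> cmod (H N x)"
            unfolding elim by (auto simp: indicator_def)
          moreover have "2 * \<epsilon> * cmod (H N x) \<le> \<epsilon>\<^sup>2 + (cmod (H N x))\<^sup>2"
            using sum_squares_bound[of \<epsilon> "cmod (H N x)"] by simp
          then have "cmod (H N x) \<le> \<epsilon> / 2 + (cmod (H N x))\<^sup>2 / (2 * \<epsilon>)"
            using \<epsilon> by (simp add: field_simps power2_eq_square)
          ultimately show ?case by linarith
        qed
      qed (use d_int[of N] H_sq[of N] in auto)
      also have "\<dots> = \<epsilon> / 2 + (\<integral>x. (cmod (H N x))\<^sup>2 \<partial>M) / (2 * \<epsilon>)"
        using H_sq[of N] by (simp add: prob_space)
      also have "\<dots> < \<epsilon> / 2 + \<epsilon>\<^sup>2 / (2 * \<epsilon>)"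
        using N0[OF that] \<epsilon> by (intro add_strict_left_mono divide_strict_right_mono) auto
      also have "\<dots> = \<epsilon>"
        using \<epsilon> by (simp add: power2_eq_square)
      finally show ?thesis .
    qed
    then show "\<exists>no. \<forall>N\<ge>no. norm ((\<integral>x. indicator A x * p N x \<partial>M) - L) < \<epsilon>"
      by blast
  qed
  moreover have "(\<integral>x. indicator A x * p N x \<partial>M)
      = (\<Sum>n=1..N. measure M (A \<inter> (T ^^ n) -` A \<inter> (S ^^ k n) -` A)) / real N" for N
  proof -
    define I where "I n = A \<inter> (T ^^ n) -` A \<inter> (S ^^ k n) -` A" for n
    have I_sets: "I n \<in> sets M" for n
    proof -
      have "I n = A \<inter> ((T ^^ n) -` A \<inter> space M) \<inter> ((S ^^ k n) -` A \<inter> space M)"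
        using sets.sets_into_space[OF A] by (auto simp: I_def)
      then show ?thesis
        using measurable_sets[of "T ^^ n" M M A] measurable_sets[of "S ^^ k n" M M A] by simp
    qed
    have "indicator A x * p N x = (\<Sum>n=1..N. indicator (I n) x) / real N" for x
      unfolding p_def times_divide_eq_right sum_distrib_left
      by (intro arg_cong2[where f = "(/)"] sum.cong refl) (auto simp: I_def indicator_def)
    moreover have "integrable M (indicator (I n) :: 'a \<Rightarrow> real)" for n
      using I_sets by (auto simp: less_top[symmetric])
    ultimately show ?thesis
      using I_sets sets.sets_into_space[OF I_sets] by (simp add: I_def[symmetric] Int_absorb2)
  qed
  ultimately have "(\<lambda>N. (\<Sum>n=1..N. measure M (A \<inter> (T ^^ n) -` A \<inter> (S ^^ k n) -` A)) / real N) \<longlonglongrightarrow> L"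
    by simp
  moreover have "measure M A ^ 3 \<le> L"
  proof -
    have "(\<integral>x. indicator A x \<partial>M) ^ 3 \<le> L"
      unfolding L_def u_def v_def
      by (rule product_cond_exp_lower_bound[OF prob subalgebra_invariant_algebra subalgebra_invariant_algebra])
        (auto simp: indicator_def)
    then show ?thesis
      using sets.sets_into_space[OF A] by (simp add: Int_absorb2)
  qed
  ultimately show ?thesis by blast
qed

lemma indicator_Linfty: "A \<in> sets M \<Longrightarrow> indicator A \<in> Linfty M"
  by (auto simp: Linfty_def indicator_def intro!: exI[of _ 1])

section \<open>Averages along sequences with uniformly distributed differences\<close>

lemma converges_if_uniformly_distributed_in_orbit_closures:
  fixes k :: "nat \<Rightarrow> nat"
  assumes prob: "prob_space M" and T: "mp_automorphism M T" and S: "mp_automorphism M S"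
    and ud: "\<forall>\<alpha>::real. \<forall>h::nat. h \<ge> 1 \<longrightarrow>
      uniformly_distributed_in (orbit_closure \<alpha>) (\<lambda>n. (real (k (n + h)) - real (k n)) * \<alpha>)"
    and f: "f \<in> Linfty M" and g: "g \<in> Linfty M"
    and sing: "\<exists>\<nu>. is_spectral_measure M T f \<nu> \<and> mutually_singular \<nu> lebesgue01"
  shows "L2_converges M
     (\<lambda>N x. (\<Sum>n=1..N. f ((T ^^ n) x) * g ((S ^^ k n) x)) / of_nat N)
     (\<lambda>x. complex_cond_exp M (invariant_algebra M T) f x *
          complex_cond_exp M (invariant_algebra M S) g x)"
proof -
  obtain \<nu> where \<nu>: "is_spectral_measure M T f \<nu>" "mutually_singular \<nu> lebesgue01"
    using sing by blast
  show ?thesis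
  proof (rule product_averages_converge[OF prob T S f g \<nu>])
    show "countable (\<int> :: real set)"
      by (simp add: Ints_def)
    show "(\<lambda>N. (\<Sum>n=1..N. circle_of ((real (k (n + h)) - real (k n)) * t)) / of_nat N) \<longlonglongrightarrow> 0"
      if "t \<notin> \<int>" "h \<ge> 1" for t h
      using ud that by (intro uniformly_distributed_in_orbit_closure_average[of t]) auto
    fix \<alpha> :: real and \<phi> and C :: real
    assume \<phi>: "\<phi> \<in> borel_measurable M" "\<And>x. x \<in> space M \<Longrightarrow> cmod (\<phi> x) \<le> C"
    assume "\<alpha> \<in> \<int>" "\<And>x. x \<in> space M \<Longrightarrow> \<phi> (S x) = circle_of \<alpha> * \<phi> x"
    then have "\<And>x. x \<in> space M \<Longrightarrow> \<phi> (S x) = \<phi> x"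
      using circle_of_eq_1_iff[of \<alpha>] by simp
    from invariant_imp_invariant_algebra_measurable[OF mp_automorphism_measurable[OF S] \<phi>(1) this]
    show "L2_inner M (\<lambda>x. g x - complex_cond_exp M (invariant_algebra M S) g x) \<phi> = 0"
      by (rule orthogonal_to_measurable[OF prob subalgebra_invariant_algebra Linfty_in_L2[OF prob g] _ \<phi>(2)])
  qed
qed

lemma eigenfunction_K_rat_measurable:
  assumes "\<phi> \<in> rational_eigenfunctions M R"
  shows "\<phi> \<in> borel_measurable (K_rat M R)"
proof (rule measurableI)
  let ?G = "\<Union>\<phi>\<in>rational_eigenfunctions M R. {\<phi> -` B \<inter> space M | B. B \<in> sets borel}"
  have G: "?G \<subseteq> Pow (space M)" by auto
  have sets_K: "sets (K_rat M R) = sigma_sets (space M) ?G"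
    unfolding K_rat_def by (rule sets_measure_of[OF G])
  have sp: "space (K_rat M R) = space M"
    using subalgebra_K_rat[of M R] by (simp add: subalgebra_def)
  fix B :: "complex set" assume "B \<in> sets borel"
  then have "\<phi> -` B \<inter> space M \<in> ?G"
    using assms by blast
  then show "\<phi> -` B \<inter> space (K_rat M R) \<in> sets (K_rat M R)"
    unfolding sp sets_K by (rule sigma_sets.Basic)
qed auto

lemma converges_if_uniformly_distributed_mod1:
  fixes k :: "nat \<Rightarrow> nat"
  assumes prob: "prob_space M" and T: "mp_automorphism M T" and S: "mp_automorphism M S"
    and ud: "\<forall>\<alpha>::real. \<forall>h::nat. \<alpha> \<notin> \<rat> \<and> h \<ge> 1 \<longrightarrow>
      uniformly_distributed_mod1 (\<lambda>n. (real (k (n + h)) - real (k n)) * \<alpha>)"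
    and f: "f \<in> Linfty M" and g: "g \<in> Linfty M"
    and sing: "\<exists>\<nu>. is_spectral_measure M T f \<nu> \<and> mutually_singular \<nu> lebesgue01"
    and K: "AE x in M. complex_cond_exp M (K_rat M S) g x = complex_cond_exp M (invariant_algebra M S) g x"
  shows "L2_converges M
     (\<lambda>N x. (\<Sum>n=1..N. f ((T ^^ n) x) * g ((S ^^ k n) x)) / of_nat N)
     (\<lambda>x. complex_cond_exp M (invariant_algebra M T) f x *
          complex_cond_exp M (invariant_algebra M S) g x)"
proof -
  interpret prob_space M by fact
  obtain \<nu> where \<nu>: "is_spectral_measure M T f \<nu>" "mutually_singular \<nu> lebesgue01"
    using sing by blast
  show ?thesis
  proof (rule product_averages_converge[OF prob T S f g \<nu>])
    show "countable (\<rat> :: real set)"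
      by (rule countable_rat)
    show "(\<lambda>N. (\<Sum>n=1..N. circle_of ((real (k (n + h)) - real (k n)) * t)) / of_nat N) \<longlonglongrightarrow> 0"
      if "t \<notin> \<rat>" "h \<ge> 1" for t h
      using ud that by (intro uniformly_distributed_mod1_average) auto
    fix \<alpha> :: real and \<phi> and C :: real
    assume \<phi>: "\<phi> \<in> borel_measurable M" "\<And>x. x \<in> space M \<Longrightarrow> cmod (\<phi> x) \<le> C"
    assume \<alpha>: "\<alpha> \<in> \<rat>" and eig: "\<And>x. x \<in> space M \<Longrightarrow> \<phi> (S x) = circle_of \<alpha> * \<phi> x"
    have "\<phi> \<in> L2 M"
      by (rule bounded_in_L2[where C = C]) (use \<phi> finite_measure_axioms in \<open>auto simp: AE_I2\<close>)
    moreover have "AE x in M. \<phi> (S x) = cis (2 * pi * \<alpha>) * \<phi> x"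
      using eig by (intro AE_I2) (simp add: circle_of_def)
    ultimately have "\<phi> \<in> rational_eigenfunctions M S"
      using \<alpha> by (auto simp: rational_eigenfunctions_def)
    then have \<phi>K: "\<phi> \<in> borel_measurable (K_rat M S)"
      by (rule eigenfunction_K_rat_measurable)
    have [measurable]: "g \<in> borel_measurable M"
      using g by (simp add: Linfty_def)
    have [measurable]: "complex_cond_exp M (K_rat M S) g \<in> borel_measurable M"
      "complex_cond_exp M (invariant_algebra M S) g \<in> borel_measurable M"
      by (rule measurable_from_subalg[OF _ complex_cond_exp_measurable],
          rule subalgebra_K_rat subalgebra_invariant_algebra)+
    have "L2_inner M (\<lambda>x. g x - complex_cond_exp M (invariant_algebra M S) g x) \<phi>
        = L2_inner M (\<lambda>x. g x - complex_cond_exp M (K_rat M S) g x) \<phi>"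
    proof (rule L2_inner_cong_AE)
      show "AE x in M. g x - complex_cond_exp M (invariant_algebra M S) g x = g x - complex_cond_exp M (K_rat M S) g x"
        using K by eventually_elim simp
    qed (use \<phi>(1) in auto)
    also have "\<dots> = 0"
      by (rule orthogonal_to_measurable[OF prob subalgebra_K_rat Linfty_in_L2[OF prob g] \<phi>K \<phi>(2)])
    finally show "L2_inner M (\<lambda>x. g x - complex_cond_exp M (invariant_algebra M S) g x) \<phi> = 0" .
  qed
qed

theorem theorem3p5:
  fixes M :: "'a measure" and T S :: "'a \<Rightarrow> 'a" and k :: "nat \<Rightarrow> nat"
  assumes "prob_space M"
    and "mp_automorphism M T"
    and "mp_automorphism M S"
    and "\<forall>n\<ge>1. k n \<ge> 1"
  shows
    "((\<forall>\<alpha>::real. \<forall>h::nat. h \<ge> 1 \<longrightarrow>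
         uniformly_distributed_in (orbit_closure \<alpha>) (\<lambda>n. (real (k (n + h)) - real (k n)) * \<alpha>))
      \<longrightarrow>
      (\<forall>f g. f \<in> Linfty M \<and> g \<in> Linfty M \<and>
         (\<exists>\<nu>. is_spectral_measure M T f \<nu> \<and> mutually_singular \<nu> lebesgue01) \<longrightarrow>
         L2_converges M
           (\<lambda>N x. (\<Sum>n=1..N. f ((T ^^ n) x) * g ((S ^^ k n) x)) / of_nat N)
           (\<lambda>x. complex_cond_exp M (invariant_algebra M T) f x *
                complex_cond_exp M (invariant_algebra M S) g x)) \<and>
      (\<forall>A\<in>sets M.
         (\<exists>\<nu>. is_spectral_measure M T (indicator A) \<nu> \<and> mutually_singular \<nu> lebesgue01) \<longrightarrow>
         (\<exists>L::real.
            (\<lambda>N. (\<Sum>n=1..N. measure M (A \<inter> (T ^^ n) -` A \<inter> (S ^^ k n) -` A)) / real N)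
              \<longlonglongrightarrow> L \<and>
            L \<ge> (measure M A) ^ 3)))
     \<and>
     ((\<forall>\<alpha>::real. \<forall>h::nat. \<alpha> \<notin> \<rat> \<and> h \<ge> 1 \<longrightarrow>
         uniformly_distributed_mod1 (\<lambda>n. (real (k (n + h)) - real (k n)) * \<alpha>))
      \<longrightarrow>
      (\<forall>f g. f \<in> Linfty M \<and> g \<in> Linfty M \<and>
         (\<exists>\<nu>. is_spectral_measure M T f \<nu> \<and> mutually_singular \<nu> lebesgue01) \<and>
         (AE x in M. complex_cond_exp M (K_rat M S) g x =
                     complex_cond_exp M (invariant_algebra M S) g x) \<longrightarrow>
         L2_converges M
           (\<lambda>N x. (\<Sum>n=1..N. f ((T ^^ n) x) * g ((S ^^ k n) x)) / of_nat N)
           (\<lambda>x. complex_cond_exp M (invariant_algebra M T) f x *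
                complex_cond_exp M (invariant_algebra M S) g x)) \<and>
      (\<forall>A\<in>sets M.
         (\<exists>\<nu>. is_spectral_measure M T (indicator A) \<nu> \<and> mutually_singular \<nu> lebesgue01) \<and>
         (AE x in M. complex_cond_exp M (K_rat M S) (indicator A) x =
                     complex_cond_exp M (invariant_algebra M S) (indicator A) x) \<longrightarrow>
         (\<exists>L::real.
            (\<lambda>N. (\<Sum>n=1..N. measure M (A \<inter> (T ^^ n) -` A \<inter> (S ^^ k n) -` A)) / real N)
              \<longlonglongrightarrow> L \<and>
            L \<ge> (measure M A) ^ 3)))"
proof (intro conjI impI)
  note mp = assms(1-3)
  show "\<forall>f g. f \<in> Linfty M \<and> g \<in> Linfty M \<and>
         (\<exists>\<nu>. is_spectral_measure M T f \<nu> \<and> mutually_singular \<nu> lebesgue01) \<longrightarrow>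
         L2_converges M
           (\<lambda>N x. (\<Sum>n=1..N. f ((T ^^ n) x) * g ((S ^^ k n) x)) / of_nat N)
           (\<lambda>x. complex_cond_exp M (invariant_algebra M T) f x *
                complex_cond_exp M (invariant_algebra M S) g x)"
    if ud: "\<forall>\<alpha>::real. \<forall>h::nat. h \<ge> 1 \<longrightarrow>
      uniformly_distributed_in (orbit_closure \<alpha>) (\<lambda>n. (real (k (n + h)) - real (k n)) * \<alpha>)"
    using converges_if_uniformly_distributed_in_orbit_closures[OF mp ud] by blast
  show "\<forall>A\<in>sets M.
         (\<exists>\<nu>. is_spectral_measure M T (indicator A) \<nu> \<and> mutually_singular \<nu> lebesgue01) \<longrightarrow>
         (\<exists>L::real.
            (\<lambda>N. (\<Sum>n=1..N. measure M (A \<inter> (T ^^ n) -` A \<inter> (S ^^ k n) -` A)) / real N)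
              \<longlonglongrightarrow> L \<and>
            L \<ge> (measure M A) ^ 3)"
    if ud: "\<forall>\<alpha>::real. \<forall>h::nat. h \<ge> 1 \<longrightarrow>
      uniformly_distributed_in (orbit_closure \<alpha>) (\<lambda>n. (real (k (n + h)) - real (k n)) * \<alpha>)"
  proof (intro ballI impI)
    fix A assume A: "A \<in> sets M"
      and "\<exists>\<nu>. is_spectral_measure M T (indicator A) \<nu> \<and> mutually_singular \<nu> lebesgue01"
    from converges_if_uniformly_distributed_in_orbit_closures[OF mp ud
        indicator_Linfty[OF A] indicator_Linfty[OF A] this(2)]
    show "\<exists>L::real. (\<lambda>N. (\<Sum>n=1..N. measure M (A \<inter> (T ^^ n) -` A \<inter> (S ^^ k n) -` A)) / real N)
        \<longlonglongrightarrow> L \<and> L \<ge> (measure M A) ^ 3"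
      by (rule triple_recurrence[OF mp A])
  qed
  show "\<forall>f g. f \<in> Linfty M \<and> g \<in> Linfty M \<and>
         (\<exists>\<nu>. is_spectral_measure M T f \<nu> \<and> mutually_singular \<nu> lebesgue01) \<and>
         (AE x in M. complex_cond_exp M (K_rat M S) g x =
                     complex_cond_exp M (invariant_algebra M S) g x) \<longrightarrow>
         L2_converges M
           (\<lambda>N x. (\<Sum>n=1..N. f ((T ^^ n) x) * g ((S ^^ k n) x)) / of_nat N)
           (\<lambda>x. complex_cond_exp M (invariant_algebra M T) f x *
                complex_cond_exp M (invariant_algebra M S) g x)"
    if ud: "\<forall>\<alpha>::real. \<forall>h::nat. \<alpha> \<notin> \<rat> \<and> h \<ge> 1 \<longrightarrow>
      uniformly_distributed_mod1 (\<lambda>n. (real (k (n + h)) - real (k n)) * \<alpha>)"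
    using converges_if_uniformly_distributed_mod1[OF mp ud] by blast
  show "\<forall>A\<in>sets M.
         (\<exists>\<nu>. is_spectral_measure M T (indicator A) \<nu> \<and> mutually_singular \<nu> lebesgue01) \<and>
         (AE x in M. complex_cond_exp M (K_rat M S) (indicator A) x =
                     complex_cond_exp M (invariant_algebra M S) (indicator A) x) \<longrightarrow>
         (\<exists>L::real.
            (\<lambda>N. (\<Sum>n=1..N. measure M (A \<inter> (T ^^ n) -` A \<inter> (S ^^ k n) -` A)) / real N)
              \<longlonglongrightarrow> L \<and>
            L \<ge> (measure M A) ^ 3)"
    if ud: "\<forall>\<alpha>::real. \<forall>h::nat. \<alpha> \<notin> \<rat> \<and> h \<ge> 1 \<longrightarrow>
      uniformly_distributed_mod1 (\<lambda>n. (real (k (n + h)) - real (k n)) * \<alpha>)"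
  proof (intro ballI impI, elim conjE)
    fix A assume A: "A \<in> sets M"
      and "\<exists>\<nu>. is_spectral_measure M T (indicator A) \<nu> \<and> mutually_singular \<nu> lebesgue01"
      and "AE x in M. complex_cond_exp M (K_rat M S) (indicator A) x =
                     complex_cond_exp M (invariant_algebra M S) (indicator A) x"
    from converges_if_uniformly_distributed_mod1[OF mp ud
        indicator_Linfty[OF A] indicator_Linfty[OF A] this(2,3)]
    show "\<exists>L::real. (\<lambda>N. (\<Sum>n=1..N. measure M (A \<inter> (T ^^ n) -` A \<inter> (S ^^ k n) -` A)) / real N)
        \<longlonglongrightarrow> L \<and> L \<ge> (measure M A) ^ 3"
      by (rule triple_recurrence[OF mp A])
  qed
qed

end
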